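(* Let $\ell\in\mathbb Z$ and let $\mathcal C\subset Constr_\ell$ be a constriction curve, i.e. a connected component of $Constr_\ell$. Suppose that the restriction to $\mathcal C$ of the coordinate function $a$ is bounded on at least one side of $\mathcal C$: splitting $\mathcal C$ into two semi-curves separated by a point, $a$ is bounded on at least one of them. Then $\mathcal C$ coincides with one of the curves $\mathcal C_{\ell,k}$, $k\in\mathbb N$.
   Context: $\mathbb R_+=(0,+\infty)$. For $\ell\in\mathbb Z$ let $h_{\ell,a,s}:S^1\to S^1$, $S^1=\mathbb R/2\pi\mathbb Z$, be the time $2\pi$ flow map (from $\tau=0$ to $\tau=2\pi$) of the equation $\frac{d\theta}{d\tau}=a\cos\theta+\ell+s\cos\tau$ (obtained from the overdamped Josephson junction model $\frac{d\phi}{dt}=-\sin\phi+B+A\cos\omega t$ by $\tau=\omega t$, $\theta=\phi+\frac\pi2$, $\ell=\frac B\omega$, $a=\frac1\omega$, $s=\frac A\omega$). The constriction submanifold is $$Constr_\ell=\{(a,s)\in\mathbb R_+^2:\ h_{\ell,a,s}=Id\};$$ equivalently, the set of $(a,s)\in\mathbb R_+^2$ such that $(B,A)=(\ell/a,s/a)$ is a constriction (separation point with $A\neq0$ between consecutive domains) of the planar phase-lock area $\{\rho=\ell\}$ with $\omega=a^{-1}$, where $\rho$ is the rotation number. It is known to be a one-dimensional analytic submanifold, closed in $\mathbb R_+^2$, and the coordinate $a$ is unbounded from above on each of its components (so each component is non-compact, homeomorphic to a line). For $k\in\mathbb N$, $\mathcal C_{\ell,k}$ denotes the unique connected component of $Constr_\ell$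 whose closure in $\mathbb R^2$ contains the point $\beta_{\ell,k}=(0,s_{\ell,k})$, where $s_{\ell,k}$ is the $k$-th positive zero of the Bessel function $J_\ell$. *)

theory Defs
  imports "HOL-Analysis.Analysis"
begin

text \<open>The equation on the circle is lifted to the line: \<open>\<theta>\<close> is a real-valued solution on the
  period \<open>[0, 2\<pi>]\<close>.\<close>

definition josephson_solution :: "int \<Rightarrow> real \<Rightarrow> real \<Rightarrow> (real \<Rightarrow> real) \<Rightarrow> bool" where
  "josephson_solution l a s \<theta> \<longleftrightarrow>
     (\<forall>\<tau>\<in>{0..2*pi}.
        (\<theta> has_real_derivative (a * cos (\<theta> \<tau>) + of_int l + s * cos \<tau>)) (at \<tau> within {0..2*pi}))"

text \<open>The circle \<open>\<real>/2\<pi>\<int>\<close> is identified with the unit circle in the complex plane through \<open>cis\<close>.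
  The value below is meaningful for \<open>z\<close> on the unit circle: the right-hand side of the equation
  is globally Lipschitz and \<open>2\<pi>\<close>-periodic in \<open>\<theta>\<close>, so a lifted solution exists
  for every initial value and the end point on the circle does not depend on the lift.\<close>

definition flow_map :: "int \<Rightarrow> real \<Rightarrow> real \<Rightarrow> complex \<Rightarrow> complex" where
  "flow_map l a s z =
     (THE w. \<exists>\<theta>. josephson_solution l a s \<theta> \<and> cis (\<theta> 0) = z \<and> w = cis (\<theta> (2*pi)))"

definition Constr :: "int \<Rightarrow> (real \<times> real) set" where
  "Constr l = {(a, s). 0 < a \<and> 0 < s \<and> (\<forall>z\<in>sphere 0 1. flow_map l a s z = z)}"

text \<open>The power series of the Bessel function of the first kind. As \<^const>\<open>rGamma\<close> vanishes at
  the non-positive integers, the formula covers negative orders as well.\<close>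

definition bessel_J :: "int \<Rightarrow> real \<Rightarrow> real" where
  "bessel_J l x =
     (\<Sum>m. (-1) ^ m / fact m * rGamma (of_int (int m + l + 1)) * (x / 2) powi (2 * int m + l))"

text \<open>The positive zeros are counted from \<open>k = 1\<close>.\<close>

definition bessel_zero :: "int \<Rightarrow> nat \<Rightarrow> real" where
  "bessel_zero l k =
     (THE s. 0 < s \<and> bessel_J l s = 0 \<and>
        finite {x. 0 < x \<and> x \<le> s \<and> bessel_J l x = 0} \<and>
        card {x. 0 < x \<and> x \<le> s \<and> bessel_J l x = 0} = k)"

definition constr_curve :: "int \<Rightarrow> nat \<Rightarrow> (real \<times> real) set" where
  "constr_curve l k =
     (THE C. C \<in> components (Constr l) \<and> (0, bessel_zero l k) \<in> closure C)"

end

theory Submission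
  imports Defs "HOL-Real_Asymp.Real_Asymp" "HOL-Complex_Analysis.Complex_Analysis"
begin

text \<open>Write \<open>m = |l|\<close>. Time reversal reduces \<open>l > 0\<close> to \<open>l = - m\<close>. There the
  lift of the equation to a linear system (a double confluent Heun equation in \<open>z = e\<^sup>i\<^sup>\<tau>\<close>) has
  only single-valued solutions iff it has an entire one; on Taylor coefficients this says that the
  solution of the three-term recurrence
  \<open>e\<^sub>n\<^sub>+\<^sub>1 + e\<^sub>n\<^sub>-\<^sub>1 = (2/s) (n + m + a\<^sup>2/(4n)) e\<^sub>n\<close>, \<open>e\<^sub>0 = 0\<close>, \<open>e\<^sub>1 = 1\<close>
  is bounded. The coefficients of this recurrence increase with \<open>a\<close> and decrease with \<open>s\<close>, so by
  Sturm theory there is, for every \<open>a \<ge> 0\<close> and every \<open>K\<close>, exactly one \<open>s = \<sigma>\<^sub>K(a\<^sup>2)\<close> for which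
  the solution is bounded and has \<open>K\<close> sign changes, and \<open>\<sigma>\<^sub>K\<close> is continuous. The constriction
  curves are therefore the graphs of the functions \<open>\<sigma>\<^sub>K(a\<^sup>2)\<close> over \<open>a > 0\<close>. At \<open>a = 0\<close> the
  recurrence is that of the Bessel functions \<open>J\<^sub>n\<^sub>+\<^sub>m(s)\<close>, so \<open>\<sigma>\<^sub>K(0)\<close> is a zero of \<open>J\<^sub>l\<close>.\<close>

section \<open>Three-term recurrences and sign changes\<close>

text \<open>The sign l = -m makes all coefficients with n >= 1 positive, hence monotone in s. The
  term \<open>a\<^sup>2\<close>/(4n) comes from the second unknown of the linear system, whose n-th
  mode is -a/(2n) times that of the first; the resonant mode n = 0 forces e_0 = 0. Only
  \<open>a\<^sup>2\<close> enters, so b = \<open>a\<^sup>2\<close> can be carried down to 0, where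
  the flow map for l is the identity for every s but the recurrence still singles out the Bessel
  zeros. The number of sign changes of an unbounded solution is stable under perturbation, so as a
  function of s it jumps only where the solution is bounded. Two obstacles shape the analytic half.
  Periodicity of the angle gives periodicity of linear solutions only up to a multiplier
  \<plusminus>1, and -1 is excluded with half-integer Fourier modes. Conversely, a bounded solution
  of the recurrence yields one holomorphic solution; the second is its reflection in the unit
  circle, independent of the first because |u| and |v| differ, which a contour integral shows.
  Periodic solutions of the nonlinear equation are then built from these two explicitly.\<close>

fun rec_sol :: "(nat \<Rightarrow> real) \<Rightarrow> nat \<Rightarrow> real" where
  "rec_sol q 0 = 0"
| "rec_sol q (Suc 0) = 1"
| "rec_sol q (Suc (Suc n)) = q (Suc n) * rec_sol q (Suc n) - rec_sol q n"

text \<open>A zero at \<open>n + 1\<close> counts as a change at \<open>n\<close>, and not again at \<open>n + 1\<close>.\<close>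

definition changes_at :: "(nat \<Rightarrow> real) \<Rightarrow> nat \<Rightarrow> bool" where
  "changes_at q n \<longleftrightarrow> rec_sol q n \<noteq> 0 \<and> rec_sol q n * rec_sol q (Suc n) \<le> 0"

primrec sign_changes :: "(nat \<Rightarrow> real) \<Rightarrow> nat \<Rightarrow> nat" where
  "sign_changes q 0 = 0"
| "sign_changes q (Suc n) = sign_changes q n + (if changes_at q n then 1 else 0)"

lemma rec_sol_no_double_zero: "rec_sol q n = 0 \<Longrightarrow> rec_sol q (Suc n) \<noteq> 0"
proof (induction n)
  case (Suc n)
  then show ?case by (cases n) auto
qed simp

lemma sign_changes_mono: "M \<le> N \<Longrightarrow> sign_changes q M \<le> sign_changes q N"
  by (induction rule: dec_induct) auto

lemma sign_changes_stable:
  assumes "\<And>k. k \<ge> M \<Longrightarrow> \<not> changes_at q k" and "M \<le> N"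
  shows "sign_changes q N = sign_changes q M"
  using assms(2) by (induction rule: dec_induct) (use assms(1) in auto)

text \<open>The convention for zeros makes the parity of the count the sign of e_n or, if e_n = 0,
  of e_(n+1): a zero was already counted one step earlier, and e_(n+1) = -e_(n-1) there.\<close>

lemma rec_sol_sign:
  "(-1) ^ sign_changes q n * rec_sol q n \<ge> 0 \<and>
   (rec_sol q n = 0 \<longrightarrow> (-1) ^ sign_changes q n * rec_sol q (Suc n) > 0)"
proof (induction n)
  case (Suc n)
  define k :: real where "k = (-1) ^ sign_changes q n"
  have k: "k = 1 \<or> k = -1" unfolding k_def by (metis neg_one_even_power neg_one_odd_power)
  have zero: "rec_sol q (Suc (Suc n)) = - rec_sol q n" if "rec_sol q (Suc n) = 0"
    using that by simp
  have nz: "rec_sol q n \<noteq> 0" if "rec_sol q (Suc n) = 0"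
    using that rec_sol_no_double_zero by blast
  show ?case
    using Suc.IH k zero nz unfolding sign_changes.simps changes_at_def k_def[symmetric]
    by (auto simp: k_def[symmetric] not_le mult_le_0_iff zero_less_mult_iff simp del: rec_sol.simps)
qed simp

text \<open>A smaller coefficient rotates the vector
  \<open>(e\<^sub>n, e\<^sub>n\<^sub>+\<^sub>1)\<close> faster, which shows either in the number of sign changes or, if these
  agree, in the sign of the Casoratian.\<close>

lemma sturm_comparison:
  assumes q: "\<And>n. n \<ge> 1 \<Longrightarrow> q' n < q n" and n: "n \<ge> 1"
  shows "sign_changes q n < sign_changes q' n \<or>
    (sign_changes q n = sign_changes q' n \<and>
     rec_sol q (Suc n) * rec_sol q' n - rec_sol q n * rec_sol q' (Suc n) > 0)"
  using n
proof (induction n rule: dec_induct)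
  case base
  then show ?case using q[of 1] by (simp add: changes_at_def)
next
  case (step n)
  define V where "V = sign_changes q n"
  define V' where "V' = sign_changes q' n"
  \<comment> \<open>Multiplying both solutions by the sign that makes \<open>rec_sol q n\<close>
    nonnegative halves the cases; products of two entries do not notice it.\<close>
  define k :: real where "k = (-1) ^ V"
  define a where "a = k * rec_sol q n"
  define b where "b = k * rec_sol q (Suc n)"
  define a' where "a' = k * rec_sol q' n"
  define b' where "b' = k * rec_sol q' (Suc n)"
  have kk: "k * k = 1" unfolding k_def by (simp flip: power_add)
  have k0: "k \<noteq> 0" using kk by auto
  have e: "rec_sol q n = k * a" "rec_sol q (Suc n) = k * b"
    "rec_sol q' n = k * a'" "rec_sol q' (Suc n) = k * b'"
    unfolding a_def b_def a'_def b'_def using kk by (simp_all flip: mult.assoc)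
  have pr: "k * x * (k * y) = x * y" for x y :: real
    using kk by (metis mult.assoc mult.left_commute mult_1)
  define d where "d = q (Suc n) - q' (Suc n)"
  have d: "d > 0" using q[of "Suc n"] by (simp add: d_def)
  have W: "rec_sol q (Suc (Suc n)) * rec_sol q' (Suc n) - rec_sol q (Suc n) * rec_sol q' (Suc (Suc n))
      = b * a' - a * b' + d * (b * b')"
  proof -
    have "(q (Suc n) * (k * b) - k * a) * (k * b') - (k * b) * (q' (Suc n) * (k * b') - k * a')
      = (k * k) * (b * a' - a * b' + d * (b * b'))"
      unfolding d_def by (simp add: algebra_simps)
    then show ?thesis unfolding rec_sol.simps e kk by simp
  qed
  have c: "changes_at q n \<longleftrightarrow> a \<noteq> 0 \<and> a * b \<le> 0" "changes_at q' n \<longleftrightarrow> a' \<noteq> 0 \<and> a' * b' \<le> 0"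
    unfolding changes_at_def e pr using k0 by auto
  have s: "a \<ge> 0" "a = 0 \<Longrightarrow> b > 0"
    using rec_sol_sign[of q n] unfolding a_def b_def k_def V_def by auto
  have IH: "V < V' \<or> (V = V' \<and> b * a' - a * b' > 0)"
    using step.IH unfolding V_def[symmetric] V'_def[symmetric] e pr .
  show ?case
  proof (cases "V = V'")
    case True
    then have s': "a' \<ge> 0" "a' = 0 \<Longrightarrow> b' > 0"
      using rec_sol_sign[of q' n] unfolding a'_def b'_def k_def V'_def by auto
    have I: "b * a' - a * b' > 0" using IH True by auto
    show ?thesis
    proof (cases "changes_at q n = changes_at q' n")
      case same: True
      have "b * b' \<ge> 0"
      proof (cases "changes_at q n")
        case True
        then have "a > 0" "a' > 0" "a * b \<le> 0" "a' * b' \<le> 0" using same c s s' by auto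
        then have "b \<le> 0" "b' \<le> 0" by (simp_all add: mult_le_0_iff)
        then show ?thesis by (simp add: mult_nonpos_nonpos)
      next
        case False
        then have "a = 0 \<or> a * b > 0" "a' = 0 \<or> a' * b' > 0" using same c by auto
        then have "b \<ge> 0" "b' \<ge> 0" using s s' by (auto simp: zero_less_mult_iff)
        then show ?thesis by simp
      qed
      then have "b * a' - a * b' + d * (b * b') > 0" using I d by (simp add: add_pos_nonneg)
      then show ?thesis using same True unfolding W V_def V'_def by simp
    next
      case diff: False
      \<comment> \<open>With equal counts, a change of \<open>q\<close> alone would put b \<le> 0
        \<le> b' beside a > 0 and a' \<ge> 0, against the positive Casoratian.\<close>
      have "\<not> (changes_at q n \<and> \<not> changes_at q' n)"
      proof
        assume "changes_at q n \<and> \<not> changes_at q' n"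
        then have "a > 0" "a * b \<le> 0" "a' = 0 \<or> a' * b' > 0" using c s by auto
        then have "b \<le> 0" "b' \<ge> 0" using s' by (auto simp: mult_le_0_iff zero_less_mult_iff)
        then have "b * a' \<le> 0" "a * b' \<ge> 0" using s' \<open>a > 0\<close> by (auto simp: mult_nonpos_nonneg)
        then show False using I by linarith
      qed
      then show ?thesis using diff True unfolding V_def V'_def by simp
    qed
  next
    case False
    then have lt: "V < V'" using IH by auto
    show ?thesis
    \<comment> \<open>A lead of one can be lost only in this case. The counts become equal, and the
      new Casoratian is positive by the signs of its terms alone.\<close>
    proof (cases "Suc V = V' \<and> changes_at q n \<and> \<not> changes_at q' n")
      case True
      have "(-1) ^ V' = - k" using True unfolding k_def by (metis power_Suc mult_minus1)
      then have s': "a' \<le> 0" "a' = 0 \<Longrightarrow> b' < 0"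
        using rec_sol_sign[of q' n] unfolding a'_def b'_def V'_def by auto
      have "a > 0" "a * b \<le> 0" "a' = 0 \<or> a' * b' > 0" using True c s by auto
      then have bb: "b \<le> 0" "b' < 0" using s' by (auto simp: mult_le_0_iff zero_less_mult_iff)
      have "b * a' \<ge> 0" "a * b' < 0" "b * b' \<ge> 0"
        using bb s' \<open>a > 0\<close> by (auto simp: mult_nonpos_nonpos mult_pos_neg)
      then have "b * a' - a * b' + d * (b * b') > 0" using d by (simp add: add_pos_nonneg)
      then show ?thesis using True unfolding W V_def V'_def by simp
    next
      case False
      then show ?thesis using lt unfolding V_def V'_def by auto
    qed
  qed
qed

lemma sign_changes_antimono:
  assumes "\<And>n. n \<ge> 1 \<Longrightarrow> q' n < q n"
  shows "sign_changes q n \<le> sign_changes q' n"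
proof (cases n)
  case (Suc k)
  then show ?thesis using sturm_comparison[of q' q n] assms by auto
qed simp

lemma tendsto_rec_sol:
  assumes "\<And>n. ((\<lambda>x. q x n) \<longlongrightarrow> q0 n) F"
  shows "((\<lambda>x. rec_sol (q x) n) \<longlongrightarrow> rec_sol q0 n) F"
proof (induction n rule: less_induct)
  case (less n)
  consider "n = 0" | "n = 1" | k where "n = Suc (Suc k)" by (metis One_nat_def not0_implies_Suc)
  then show ?case
    by cases (use assms less in \<open>auto intro!: tendsto_intros\<close>)
qed

text \<open>An isolated zero of the solution contributes exactly one sign change, wherever it moves.\<close>

lemma sign_changes_locally_constant:
  assumes q: "\<And>n. ((\<lambda>x. q x n) \<longlongrightarrow> q0 n) F" and N: "rec_sol q0 N \<noteq> 0"
  shows "\<forall>\<^sub>F x in F. sign_changes (q x) N = sign_changes q0 N"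
  using N
proof (induction N rule: less_induct)
  case (less N)
  have pos: "\<forall>\<^sub>F x in F. rec_sol (q x) n > 0" if "rec_sol q0 n > 0" for n
    using tendsto_rec_sol[OF q] that by (rule order_tendstoD)
  have neg: "\<forall>\<^sub>F x in F. rec_sol (q x) n < 0" if "rec_sol q0 n < 0" for n
    using tendsto_rec_sol[OF q] that by (rule order_tendstoD)
  obtain n where n: "N = Suc n" using less.prems by (cases N) auto
  show ?case
  proof (cases "rec_sol q0 n = 0")
    case False
    have ev: "\<forall>\<^sub>F x in F. sign_changes (q x) n = sign_changes q0 n"
      using less.IH[of n] n False by auto
    have "\<forall>\<^sub>F x in F. changes_at (q x) n = changes_at q0 n"
    proof -
      consider "rec_sol q0 n > 0" "rec_sol q0 N > 0" | "rec_sol q0 n > 0" "rec_sol q0 N < 0"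
        | "rec_sol q0 n < 0" "rec_sol q0 N > 0" | "rec_sol q0 n < 0" "rec_sol q0 N < 0"
        using False less.prems by linarith
      then show ?thesis
      proof cases
        case 1
        then show ?thesis using eventually_conj[OF pos[OF 1(1)] pos[OF 1(2)]] unfolding n changes_at_def
          by (auto elim!: eventually_mono simp: mult_le_0_iff)
      next
        case 2
        then show ?thesis using eventually_conj[OF pos[OF 2(1)] neg[OF 2(2)]] unfolding n changes_at_def
          by (auto elim!: eventually_mono simp: mult_le_0_iff)
      next
        case 3
        then show ?thesis using eventually_conj[OF neg[OF 3(1)] pos[OF 3(2)]] unfolding n changes_at_def
          by (auto elim!: eventually_mono simp: mult_le_0_iff)
      next
        case 4
        then show ?thesis using eventually_conj[OF neg[OF 4(1)] neg[OF 4(2)]] unfolding n changes_at_def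
          by (auto elim!: eventually_mono simp: mult_le_0_iff)
      qed
    qed
    with ev show ?thesis by eventually_elim (simp add: n)
  next
    case zero: True
    show ?thesis
    proof (cases n)
      case 0
      then show ?thesis by (simp add: n changes_at_def)
    next
      case (Suc k)
      have k: "rec_sol q0 k \<noteq> 0" using zero rec_sol_no_double_zero Suc by blast
      have opp: "rec_sol q0 N = - rec_sol q0 k" using zero by (simp add: n Suc)
      have lim: "sign_changes q0 N = Suc (sign_changes q0 k)"
        using zero k unfolding n Suc by (simp add: changes_at_def)
      have ev: "\<forall>\<^sub>F x in F. sign_changes (q x) k = sign_changes q0 k"
        using less.IH[of k] n Suc k by auto
      \<comment> \<open>Nearby solutions also have opposite signs at k and N, on both sides of the
        zero of the limit, hence exactly one change at k or at \<open>Suc k\<close>, whatever their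
        sign in between.\<close>
      have "\<forall>\<^sub>F x in F. rec_sol (q x) k * rec_sol (q x) N < 0"
      proof (rule order_tendstoD(2))
        show "((\<lambda>x. rec_sol (q x) k * rec_sol (q x) N) \<longlongrightarrow> rec_sol q0 k * rec_sol q0 N) F"
          by (intro tendsto_intros tendsto_rec_sol q)
        show "rec_sol q0 k * rec_sol q0 N < 0" unfolding opp using k by (simp flip: power2_eq_square)
      qed
      with ev show ?thesis
      proof eventually_elim
        case (elim x)
        show ?case
        proof -
          have "(if changes_at (q x) k then 1 else 0) + (if changes_at (q x) (Suc k) then 1 else 0) = (1::nat)"
            using elim(2) unfolding n Suc changes_at_def
            by (auto simp del: rec_sol.simps(3) simp: mult_le_0_iff mult_less_0_iff split: if_splits)
          then show ?thesis unfolding lim unfolding n Suc using elim(1) by simp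
        qed
      qed
    qed
  qed
qed

section \<open>Growth or decay where the coefficients are at least 4\<close>

lemma rec_sol_growth_step:
  assumes "q (Suc n) \<ge> 4" and "\<bar>rec_sol q n\<bar> \<le> 2 * \<bar>rec_sol q (Suc n)\<bar>"
  shows "2 * \<bar>rec_sol q (Suc n)\<bar> \<le> \<bar>rec_sol q (Suc (Suc n))\<bar>"
    and "rec_sol q (Suc n) * rec_sol q (Suc (Suc n)) > 0" and "rec_sol q (Suc n) \<noteq> 0"
proof -
  define a where "a = rec_sol q n"
  define b where "b = rec_sol q (Suc n)"
  define c where "c = q (Suc n)"
  have r: "rec_sol q (Suc (Suc n)) = c * b - a" by (simp add: a_def b_def c_def)
  show b: "rec_sol q (Suc n) \<noteq> 0"
    using assms(2) rec_sol_no_double_zero[of q n] by (cases "rec_sol q n = 0") auto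
  have *: "4 * \<bar>b\<bar> \<le> c * \<bar>b\<bar>" "\<bar>a\<bar> \<le> 2 * \<bar>b\<bar>" "c \<ge> 4"
    using assms by (auto simp: a_def b_def c_def mult_right_mono)
  have "2 * \<bar>b\<bar> \<le> \<bar>c * b - a\<bar> \<and> b * (c * b - a) > 0"
  proof (cases "b > 0")
    case True
    then have "c * b - a \<ge> 2 * b" using * by linarith
    then show ?thesis using True by (simp add: zero_less_mult_iff)
  next
    case False
    then have "b < 0" using b by (simp add: b_def)
    then have "c * b - a \<le> 2 * b" using * by linarith
    then show ?thesis using \<open>b < 0\<close> by (simp add: zero_less_mult_iff)
  qed
  then show "2 * \<bar>rec_sol q (Suc n)\<bar> \<le> \<bar>rec_sol q (Suc (Suc n))\<bar>"
    "rec_sol q (Suc n) * rec_sol q (Suc (Suc n)) > 0"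
    unfolding r b_def by auto
qed

text \<open>The bound 4 = 2 + 2 lets the regime |e_n| \<le> 2 |e_(n+1)| reproduce itself: |e_(n+2)|
  \<ge> 4 |e_(n+1)| - 2 |e_(n+1)|. From then on the solution doubles at least and keeps its
  sign.\<close>

lemma rec_sol_growth:
  assumes q: "\<And>k. k > n \<Longrightarrow> q k \<ge> 4" and g: "\<bar>rec_sol q n\<bar> \<le> 2 * \<bar>rec_sol q (Suc n)\<bar>" and "k \<ge> n"
  shows "\<bar>rec_sol q k\<bar> \<le> 2 * \<bar>rec_sol q (Suc k)\<bar> \<and> rec_sol q (Suc k) \<noteq> 0 \<and>
    \<bar>rec_sol q (Suc k)\<bar> \<ge> 2 ^ (k - n) * \<bar>rec_sol q (Suc n)\<bar> \<and> (k > n \<longrightarrow> \<not> changes_at q k)"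
  using \<open>k \<ge> n\<close>
proof (induction rule: dec_induct)
  case base
  then show ?case using g rec_sol_growth_step(3)[OF q g] by auto
next
  case (step k)
  note st = rec_sol_growth_step[of q k, OF q[of "Suc k"]]
  have 1: "2 * \<bar>rec_sol q (Suc k)\<bar> \<le> \<bar>rec_sol q (Suc (Suc k))\<bar>"
    "rec_sol q (Suc k) * rec_sol q (Suc (Suc k)) > 0" "rec_sol q (Suc k) \<noteq> 0"
    using st step by auto
  have "2 ^ (Suc k - n) * \<bar>rec_sol q (Suc n)\<bar> = 2 * (2 ^ (k - n) * \<bar>rec_sol q (Suc n)\<bar>)"
    using step.hyps by (simp add: Suc_diff_le)
  also have "\<dots> \<le> 2 * \<bar>rec_sol q (Suc k)\<bar>" using step.IH by linarith
  finally have 2: "2 ^ (Suc k - n) * \<bar>rec_sol q (Suc n)\<bar> \<le> \<bar>rec_sol q (Suc (Suc k))\<bar>" using 1 by linarith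
  have 3: "\<not> changes_at q (Suc k)" using 1(2) by (simp add: changes_at_def del: rec_sol.simps)
  have 4: "rec_sol q (Suc (Suc k)) \<noteq> 0" using 1(2) by (metis less_irrefl mult_zero_right)
  have 5: "\<bar>rec_sol q (Suc k)\<bar> \<le> 2 * \<bar>rec_sol q (Suc (Suc k))\<bar>" using 1(1) by linarith
  show ?case using 2 3 4 5 by (simp del: rec_sol.simps)
qed

text \<open>A single failure would enter the regime of \<open>rec_sol_growth\<close> and double the
  solution forever, against boundedness.\<close>

lemma bounded_rec_sol_decay:
  assumes q: "\<And>k. k > N \<Longrightarrow> q k \<ge> 4" and b: "bounded (range (rec_sol q))" and n: "n \<ge> N"
  shows "2 * \<bar>rec_sol q (Suc n)\<bar> < \<bar>rec_sol q n\<bar>"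
proof (rule ccontr)
  assume "\<not> ?thesis"
  then have g: "\<bar>rec_sol q n\<bar> \<le> 2 * \<bar>rec_sol q (Suc n)\<bar>" by simp
  obtain B where B: "\<And>k. \<bar>rec_sol q k\<bar> \<le> B" using b by (auto simp: bounded_iff)
  have gr: "2 ^ j * \<bar>rec_sol q (Suc n)\<bar> \<le> B" for j
    using rec_sol_growth[of n q "n + j"] q n g B[of "Suc (n + j)"] by fastforce
  have p: "\<bar>rec_sol q (Suc n)\<bar> > 0" using rec_sol_growth[of n q n] q n g by auto
  obtain j where "B / \<bar>rec_sol q (Suc n)\<bar> < 2 ^ j" using real_arch_pow[of 2] by auto
  then show False using gr[of j] p by (simp add: divide_less_eq)
qed

text \<open>As e_(n+2) is smaller than half of e_(n+1), the first term dominates in e_n = q e_(n+1)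
  - e_(n+2) and imposes its sign.\<close>

lemma bounded_rec_sol_same_sign:
  assumes q: "\<And>k. k > N \<Longrightarrow> q k \<ge> 4" and b: "bounded (range (rec_sol q))" and n: "n \<ge> N"
  shows "rec_sol q n * rec_sol q (Suc n) > 0"
proof -
  define a b c where "a = rec_sol q n" and "b = rec_sol q (Suc n)" and "c = q (Suc n)"
  have 2: "2 * \<bar>c * b - a\<bar> < \<bar>b\<bar>"
    using bounded_rec_sol_decay[of N q "Suc n", OF q b] n
    unfolding a_def b_def c_def rec_sol.simps by simp
  have c: "c \<ge> 4" using q[of "Suc n"] n by (simp add: c_def)
  have "a > 0 \<and> b > 0 \<or> a < 0 \<and> b < 0"
  proof (cases "b < 0")
    case True
    then have "c * b \<le> 4 * b" using c by (intro mult_right_mono_neg) auto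
    then have "a < 0" using 2 True by argo
    then show ?thesis using True by simp
  next
    case False
    then have "c * b \<ge> 4 * b" using c by (intro mult_right_mono) auto
    moreover have "b \<noteq> 0" using 2 by auto
    ultimately have "a > 0" using 2 False by argo
    moreover have "b \<noteq> 0" using 2 by auto
    ultimately show ?thesis using False by auto
  qed
  then have "a * b > 0" by (simp add: zero_less_mult_iff)
  then show ?thesis by (simp add: a_def b_def)
qed

lemma bounded_rec_sol_no_change:
  assumes "\<And>k. k > N \<Longrightarrow> q k \<ge> 4" and "bounded (range (rec_sol q))" and "n \<ge> N"
  shows "\<not> changes_at q n"
  using bounded_rec_sol_same_sign[OF assms] by (simp add: changes_at_def)

lemma bounded_rec_sol_geometric:
  assumes q: "\<And>k. k > N \<Longrightarrow> q k \<ge> 4" and b: "bounded (range (rec_sol q))"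
  obtains C where "C > 0" "\<And>n. \<bar>rec_sol q n\<bar> \<le> C * (1/2) ^ n"
proof -
  define g where "g n = \<bar>rec_sol q n\<bar> * 2 ^ n" for n
  define C where "C = 1 + (\<Sum>n\<le>N. g n)"
  have g: "g n \<ge> 0" for n by (simp add: g_def)
  have small: "g n \<le> C" if "n \<le> N" for n
    using member_le_sum[of n "{..N}" g] that g by (simp add: C_def)
  have "g n \<le> g N" if "n \<ge> N" for n
    using that
  proof (induction rule: dec_induct)
    case (step n)
    have "2 * \<bar>rec_sol q (Suc n)\<bar> \<le> \<bar>rec_sol q n\<bar>"
      using bounded_rec_sol_decay[of N q n, OF q b] step.hyps by simp
    then have "g (Suc n) \<le> g n" using mult_right_mono[of _ _ "2 ^ n :: real"]
      unfolding g_def by (fastforce simp del: rec_sol.simps)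
    then show ?case using step.IH by simp
  qed simp
  then have "g n \<le> C" for n using small order_trans[OF _ small[of N]] by (cases "n \<le> N") auto
  then have "\<bar>rec_sol q n\<bar> \<le> C * (1/2) ^ n" for n
    by (simp add: g_def power_divide field_simps)
  moreover have "C > 0" unfolding C_def using g by (simp add: add_pos_nonneg sum_nonneg)
  ultimately show ?thesis using that by blast
qed

text \<open>The discrete Wronskian of \<open>rec_sol q\<close> and an arbitrary solution f keeps its
  value at n = 0. If \<open>rec_sol q\<close> decays and f is bounded, this value must be 0, and f
  vanishes at 0.\<close>

lemma casoratian:
  assumes "\<And>n. f (Suc (Suc n)) = of_real (q (Suc n)) * f (Suc n) - f n"
  shows "of_real (rec_sol q n) * f (Suc n) - of_real (rec_sol q (Suc n)) * f n
    = - (f 0 :: 'a :: {real_algebra_1, comm_ring_1})"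
proof (induction n)
  case (Suc n)
  have "of_real (rec_sol q (Suc n)) * f (Suc (Suc n)) - of_real (rec_sol q (Suc (Suc n))) * f (Suc n)
    = of_real (rec_sol q n) * f (Suc n) - of_real (rec_sol q (Suc n)) * f n"
    unfolding assms by (simp add: algebra_simps)
  with Suc show ?case by simp
qed simp

lemma rec_sol_proportional:
  assumes "\<And>n. f (Suc (Suc n)) = of_real (q (Suc n)) * f (Suc n) - f n"
    and "f 0 = (0 :: 'a :: {real_algebra_1, comm_ring_1})"
  shows "f n = f (Suc 0) * of_real (rec_sol q n)"
proof -
  have "f n = f (Suc 0) * of_real (rec_sol q n) \<and> f (Suc n) = f (Suc 0) * of_real (rec_sol q (Suc n))"
    by (induction n) (auto simp: assms algebra_simps)
  then show ?thesis ..
qed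

lemma unbounded_rec_sol_growth:
  assumes u: "\<not> bounded (range (rec_sol q))"
  shows "\<exists>n\<ge>N. \<bar>rec_sol q n\<bar> \<le> 2 * \<bar>rec_sol q (Suc n)\<bar>"
proof (rule ccontr)
  assume "\<not> ?thesis"
  then have d: "\<bar>rec_sol q (Suc n)\<bar> \<le> \<bar>rec_sol q n\<bar>" if "n \<ge> N" for n
    using that by (smt (verit))
  have le: "\<bar>rec_sol q n\<bar> \<le> \<bar>rec_sol q N\<bar>" if "n \<ge> N" for n
    using that by (induction rule: dec_induct) (use d order_trans in auto)
  have "range (rec_sol q) \<subseteq> rec_sol q ` {..N} \<union> {-\<bar>rec_sol q N\<bar>..\<bar>rec_sol q N\<bar>}"
  proof
    fix y assume "y \<in> range (rec_sol q)"
    then obtain n where "y = rec_sol q n" by auto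
    then show "y \<in> rec_sol q ` {..N} \<union> {-\<bar>rec_sol q N\<bar>..\<bar>rec_sol q N\<bar>}"
      using le[of n] by (cases "n \<le> N") auto
  qed
  then have "bounded (range (rec_sol q))"
    by (rule bounded_subset[rotated]) (auto intro: finite_imp_bounded)
  with u show False ..
qed

text \<open>After a change, e_(n+1) and -e_n do not have opposite signs, so nothing cancels in
  e_(n+2) = q e_(n+1) - e_n. The solution is then in the growth regime and changes no more.\<close>

lemma sign_changes_tail:
  assumes q: "\<And>k. k > N \<Longrightarrow> q k \<ge> 4"
  shows "sign_changes q M \<le> Suc (sign_changes q N)"
proof (cases "N \<le> M")
  case True
  have quiet: "\<not> changes_at q k" if c: "changes_at q n" and n: "n \<ge> N" and k: "k > n" for n k
  proof -
    define a b c where "a = rec_sol q n" and "b = rec_sol q (Suc n)" and "c = q (Suc n)"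
    have r: "rec_sol q (Suc (Suc n)) = c * b - a" by (simp add: a_def b_def c_def)
    have ab: "a \<noteq> 0" "a * b \<le> 0" "c \<ge> 4" using c q[of "Suc n"] n by (auto simp: changes_at_def a_def b_def c_def)
    have "\<bar>b\<bar> \<le> 2 * \<bar>c * b - a\<bar> \<and> (b \<noteq> 0 \<longrightarrow> b * (c * b - a) > 0)"
    proof -
      consider "b = 0" | "b > 0" "a < 0" | "b < 0" "a > 0"
        using ab by (metis linorder_neqE_linordered_idom mult_pos_pos mult_neg_neg not_less)
      then show ?thesis
      proof cases
        case 2
        then have "c * b \<ge> 4 * b" using ab by (intro mult_right_mono) auto
        then have "c * b - a > 4 * b" using 2 by linarith
        then show ?thesis using 2 by (simp add: zero_less_mult_iff)
      next
        case 3
        then have "c * b \<le> 4 * b" using ab by (intro mult_right_mono_neg) auto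
        then have "c * b - a < 4 * b" using 3 by linarith
        then show ?thesis using 3 by (simp add: zero_less_mult_iff)
      qed simp
    qed
    then have g: "\<bar>rec_sol q (Suc n)\<bar> \<le> 2 * \<bar>rec_sol q (Suc (Suc n))\<bar>" and "\<not> changes_at q (Suc n)"
      unfolding r b_def changes_at_def by auto
    then show ?thesis using rec_sol_growth[of "Suc n" q k, OF q g] n k by (cases "k = Suc n") auto
  qed
  have "sign_changes q M = sign_changes q N \<or>
    (sign_changes q M = Suc (sign_changes q N) \<and> (\<forall>k\<ge>M. \<not> changes_at q k))"
    using True
  proof (induction rule: dec_induct)
    case (step M)
    then show ?case using quiet[of M] by auto
  qed simp
  then show ?thesis by auto
next
  case False
  then show ?thesis using sign_changes_mono[of M N q] by simp
qed

text \<open>Sturm comparison at infinity. If \<open>q'\<close> had no further change, the Casoratian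
  W would be positive and nondecreasing in the tail, while the ratio e'/e does not increase there;
  so e' decays with e, and W tends to 0.\<close>

lemma more_sign_changes:
  assumes q4: "\<And>k. k > N \<Longrightarrow> q k \<ge> 4" and b: "bounded (range (rec_sol q))"
    and lt: "\<And>n. n \<ge> 1 \<Longrightarrow> q' n < q n"
  shows "\<exists>M. sign_changes q N < sign_changes q' M"
proof (rule ccontr)
  assume "\<not> ?thesis"
  then have le: "sign_changes q' M \<le> sign_changes q N" for M by (simp add: not_less)
  define e e' where "e = rec_sol q" and "e' = rec_sol q'"
  define k :: real where "k = (-1) ^ sign_changes q N"
  define W where "W n = e (Suc n) * e' n - e n * e' (Suc n)" for n
  define M where "M = Suc N"
  have kk: "k * k = 1" unfolding k_def by (simp flip: power_add)
  have same: "sign_changes q n = sign_changes q N" if "n \<ge> M" for n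
    using sign_changes_stable[of N q n] bounded_rec_sol_no_change[OF q4 b] that by (simp add: M_def)
  have W0: "W n > 0" and same': "sign_changes q' n = sign_changes q N" if "n \<ge> M" for n
    using sturm_comparison[of q' q n] lt that same[OF that] le[of n] unfolding M_def W_def e_def e'_def by auto
  have e: "k * e n > 0" if "n \<ge> M" for n
  proof -
    have "e n \<noteq> 0"
      using bounded_rec_sol_same_sign[OF q4 b, of n] that unfolding e_def M_def by force
    moreover have "k * e n \<ge> 0" using rec_sol_sign[of q n] unfolding same[OF that] k_def e_def by simp
    moreover have "k \<noteq> 0" by (simp add: k_def)
    ultimately show ?thesis by (metis less_le mult_eq_0_iff)
  qed
  have e': "k * e' n \<ge> 0" if "n \<ge> M" for n
    using rec_sol_sign[of q' n] same'[OF that] unfolding k_def e'_def by auto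
  have pr: "x * y = (k * x) * (k * y)" for x y :: real
    using kk by (metis mult.assoc mult.left_commute mult_1)
  have W_step: "W (Suc n) \<ge> W n" if "n \<ge> M" for n
  proof -
    have "W (Suc n) - W n = (q (Suc n) - q' (Suc n)) * (e (Suc n) * e' (Suc n))"
      unfolding W_def e_def e'_def by (simp add: algebra_simps)
    also have "\<dots> \<ge> 0"
      unfolding pr[of "e (Suc n)"] using lt[of "Suc n"] e[of "Suc n"] e'[of "Suc n"] that by simp
    finally show ?thesis by simp
  qed
  have W_ge: "W n \<ge> W M" if "n \<ge> M" for n
    using that by (induction rule: dec_induct) (use W_step order_trans in auto)
  \<comment> \<open>The ratio e'/e at the start of the tail, an upper bound for all later ones since
    W > 0.\<close>
  define C where "C = (k * e' M) / (k * e M)"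
  have C: "k * e' n \<le> C * (k * e n)" if "n \<ge> M" for n
    using that
  proof (induction rule: dec_induct)
    case base
    have "k * e M \<noteq> 0" using e[OF order_refl] by (rule less_imp_neq[symmetric])
    then have "C * (k * e M) = k * e' M" unfolding C_def
      by (metis nonzero_mult_div_cancel_right times_divide_eq_left)
    then show ?case by (simp only: order_refl)
  next
    case (step n)
    have p: "k * e n > 0" "k * e (Suc n) > 0" using e[of n] e[of "Suc n"] step.hyps by auto
    have "(k * e n) * (k * e' (Suc n)) \<le> (k * e (Suc n)) * (k * e' n)"
      using W0[of n] step.hyps unfolding W_def pr[of "e (Suc n)"] pr[of "e n"] by simp
    also have "\<dots> \<le> (k * e (Suc n)) * (C * (k * e n))"
      using step.IH p by (intro mult_left_mono) auto
    finally have "(k * e n) * (k * e' (Suc n)) \<le> (k * e n) * (C * (k * e (Suc n)))" by (simp add: mult_ac)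
    then show ?case using p by (simp only: mult_le_cancel_left_pos)
  qed
  have C0: "C \<ge> 0" unfolding C_def using e[OF order_refl] e'[OF order_refl] by (intro divide_nonneg_pos)
  have ka: "\<bar>k * x\<bar> = \<bar>x\<bar>" for x by (simp add: k_def abs_mult power_abs)
  have dec: "k * e (M + j) \<le> (1/2) ^ j * (k * e M)" for j
  proof (induction j)
    case (Suc j)
    have "k * e (M + Suc j) = \<bar>e (M + Suc j)\<bar>" "k * e (M + j) = \<bar>e (M + j)\<bar>"
      using e[of "M + j"] e[of "M + Suc j"] ka[of "e (M + j)"] ka[of "e (M + Suc j)"] by auto
    then have "k * e (M + Suc j) \<le> (1/2) * (k * e (M + j))"
      using bounded_rec_sol_decay[of N q "M + j", OF q4 b] unfolding e_def M_def
      by (simp del: rec_sol.simps)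
    also have "\<dots> \<le> (1/2) * ((1/2) ^ j * (k * e M))" using Suc by simp
    finally show ?case by simp
  qed simp
  have WU: "W M \<le> (1/2) ^ j * (C * (k * e M)\<^sup>2)" for j
  proof -
    have p: "k * e (M + j) > 0" "k * e (Suc (M + j)) > 0" "k * e M > 0" using e by auto
    have "W M \<le> W (M + j)" by (rule W_ge) simp
    also have "\<dots> \<le> (k * e (Suc (M + j))) * (k * e' (M + j))"
      unfolding W_def pr[of "e (Suc (M + j))"] pr[of "e (M + j)"]
      using p e'[of "Suc (M + j)"] by simp
    also have "\<dots> \<le> (k * e M) * (C * ((1/2) ^ j * (k * e M)))"
    proof (rule mult_mono)
      have "k * e (Suc (M + j)) \<le> (1/2) ^ Suc j * (k * e M)" using dec[of "Suc j"] by simp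
      also have "\<dots> \<le> 1 * (k * e M)" using p by (intro mult_right_mono power_le_one) auto
      finally show "k * e (Suc (M + j)) \<le> k * e M" by simp
      show "k * e' (M + j) \<le> C * ((1/2) ^ j * (k * e M))"
        using C[of "M + j"] mult_left_mono[OF dec[of j] C0] by linarith
    qed (use p e' in auto)
    finally show ?thesis by (simp add: power2_eq_square mult_ac)
  qed
  have "(\<lambda>j. (1/2) ^ j * (C * (k * e M)\<^sup>2)) \<longlonglongrightarrow> 0 * (C * (k * e M)\<^sup>2)"
    by (intro tendsto_intros LIMSEQ_realpow_zero) auto
  then have "W M \<le> 0" using WU by (intro LIMSEQ_le_const[of _ 0]) auto
  then show False using W0[of M] by simp
qed

section \<open>The spectral curves\<close>

definition jcoef :: "nat \<Rightarrow> real \<Rightarrow> real \<Rightarrow> nat \<Rightarrow> real" where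
  "jcoef m b s n = 2 / s * (real n + real m + b / (4 * real n))"

definition in_spec :: "nat \<Rightarrow> real \<Rightarrow> real \<Rightarrow> bool" where
  "in_spec m b s \<longleftrightarrow> bounded (range (rec_sol (jcoef m b s)))"

text \<open>The index \<lceil>2 * s\<rceil> is where 2n/s reaches 4. For b \<ge> 0 and s > 0 all
  later coefficients are at least 4, so a bounded solution has made all its changes by then.\<close>

definition spec_index :: "nat \<Rightarrow> real \<Rightarrow> real \<Rightarrow> nat" where
  "spec_index m b s = sign_changes (jcoef m b s) (nat \<lceil>2 * s\<rceil>)"

text \<open>Asking for one N, rather than for a total count, gives a condition that is open in (b,
  s) and is inherited by larger s.\<close>

definition exceeds :: "nat \<Rightarrow> nat \<Rightarrow> real \<Rightarrow> real \<Rightarrow> bool" where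
  "exceeds m K b s \<longleftrightarrow> (\<exists>N. sign_changes (jcoef m b s) N > K)"

lemma jcoef_lower:
  assumes "b \<ge> 0" "s > 0"
  shows "jcoef m b s n \<ge> 2 * real n / s"
proof -
  have "2 / s * (real n + real m + b / (4 * real n)) \<ge> 2 / s * real n"
    using assms by (intro mult_left_mono) auto
  then show ?thesis by (simp add: jcoef_def)
qed

lemma jcoef_ge_4:
  assumes "b \<ge> 0" "s > 0" "real n \<ge> 2 * s"
  shows "jcoef m b s n \<ge> 4"
proof -
  have "4 \<le> 2 * real n / s" using assms by (simp add: field_simps)
  then show ?thesis using jcoef_lower[of b s n m] assms by linarith
qed

lemma jcoef_ge_4_beyond:
  assumes "b \<ge> 0" "0 < s" "s \<le> s'" "k > nat \<lceil>2 * s'\<rceil>"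
  shows "jcoef m b s k \<ge> 4"
proof -
  have "2 * s' \<le> real (nat \<lceil>2 * s'\<rceil>)" by (rule of_nat_ceiling)
  also have "\<dots> \<le> real k" by (rule of_nat_mono[OF less_imp_le[OF assms(4)]])
  finally have "2 * s' \<le> real k" .
  then show ?thesis using assms by (intro jcoef_ge_4) linarith+
qed

lemma jcoef_strict_antimono:
  assumes "b \<ge> 0" "0 < s" "s < s'" "n \<ge> 1"
  shows "jcoef m b s' n < jcoef m b s n"
  unfolding jcoef_def
  by (intro mult_strict_right_mono divide_strict_left_mono add_pos_nonneg)
    (use assms in \<open>auto intro: add_pos_nonneg\<close>)

lemma tendsto_jcoef:
  assumes "(bf \<longlongrightarrow> b) F" "(sf \<longlongrightarrow> s) F" "s \<noteq> 0"
  shows "((\<lambda>x. jcoef m (bf x) (sf x) n) \<longlongrightarrow> jcoef m b s n) F"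
proof (cases n)
  case (Suc k)
  then show ?thesis unfolding jcoef_def using assms by (intro tendsto_intros) auto
next
  case 0
  then show ?thesis unfolding jcoef_def using assms by (auto intro!: tendsto_intros)
qed

lemma
  assumes "in_spec m b s" "b \<ge> 0" "s > 0"
  shows in_spec_index_eq: "real N \<ge> 2 * s \<Longrightarrow> sign_changes (jcoef m b s) N = spec_index m b s"
    and in_spec_index_ge: "sign_changes (jcoef m b s) M \<le> spec_index m b s"
proof -
  define N0 where "N0 = nat \<lceil>2 * s\<rceil>"
  have st: "sign_changes (jcoef m b s) N = sign_changes (jcoef m b s) N0" if "N \<ge> N0" for N
  proof (rule sign_changes_stable[OF _ that])
    fix k assume "k \<ge> N0"
    then show "\<not> changes_at (jcoef m b s) k"
      using assms jcoef_ge_4_beyond[of b s s] unfolding in_spec_def N0_def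
      by (intro bounded_rec_sol_no_change[of N0]) (auto simp: N0_def)
  qed
  show "sign_changes (jcoef m b s) N = spec_index m b s" if "real N \<ge> 2 * s"
    using st[of N] that unfolding spec_index_def N0_def by (auto simp: nat_le_iff ceiling_le_iff)
  show "sign_changes (jcoef m b s) M \<le> spec_index m b s"
    using st[of "max M N0"] sign_changes_mono[of M "max M N0" "jcoef m b s"]
    unfolding spec_index_def N0_def by auto
qed

lemma exceeds_mono:
  assumes "exceeds m K b s" "b \<ge> 0" "0 < s" "s \<le> s'"
  shows "exceeds m K b s'"
proof (cases "s = s'")
  case False
  then have "sign_changes (jcoef m b s) N \<le> sign_changes (jcoef m b s') N" for N
    using assms by (intro sign_changes_antimono jcoef_strict_antimono) auto
  then show ?thesis using assms(1) unfolding exceeds_def by (meson less_le_trans)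
qed (use assms in simp)

text \<open>For s \<le> 1 all coefficients are at least 2, so the solution is convex from 0, 1 on
  and stays positive. This keeps the curves away from s = 0.\<close>

lemma not_exceeds_small:
  assumes "b \<ge> 0" "0 < s" "s \<le> 1"
  shows "\<not> exceeds m K b s"
proof -
  define q where "q = jcoef m b s"
  have q: "q n \<ge> 2" if "n \<ge> 1" for n
  proof -
    have "real n \<ge> 1" using that by simp
    then have "2 \<le> 2 * real n / s" using assms by (simp add: pos_le_divide_eq)
    then show ?thesis using jcoef_lower[of b s n m] assms unfolding q_def by linarith
  qed
  have e: "rec_sol q (Suc n) > 0 \<and> rec_sol q (Suc n) \<ge> rec_sol q n" for n
  proof (induction n)
    case (Suc n)
    have "q (Suc n) * rec_sol q (Suc n) \<ge> 2 * rec_sol q (Suc n)"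
      using q[of "Suc n"] Suc by (intro mult_right_mono) auto
    then have "q (Suc n) * rec_sol q (Suc n) - rec_sol q n \<ge> rec_sol q (Suc n)" using Suc by linarith
    then show ?case using Suc unfolding rec_sol.simps by linarith
  qed simp
  have "\<not> changes_at q n" for n
  proof (cases n)
    case (Suc k)
    then show ?thesis using e[of k] e[of "Suc k"] unfolding changes_at_def
      by (simp add: mult_le_0_iff not_le del: rec_sol.simps)
  qed (simp add: changes_at_def)
  then have "sign_changes q n = 0" for n by (induction n) auto
  then show ?thesis unfolding exceeds_def q_def by auto
qed

text \<open>The limit of the recurrence as s tends to infinity: the solution 0, 1, 0, -1, ...
  changes sign once in every two steps.\<close>

lemma sign_changes_zero_coeff: "sign_changes (\<lambda>_. 0) (Suc (2 * k)) = k"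
  and rec_sol_zero_coeff: "rec_sol (\<lambda>_. 0) (2 * k) = 0" "rec_sol (\<lambda>_. 0) (Suc (2 * k)) = (-1) ^ k"
proof -
  show 1: "rec_sol (\<lambda>_. 0) (2 * k) = 0" for k by (induction k) auto
  show 2: "rec_sol (\<lambda>_. 0) (Suc (2 * k)) = (-1) ^ k" for k by (induction k) auto
  show "sign_changes (\<lambda>_. 0) (Suc (2 * k)) = k"
  proof (induction k)
    case (Suc k)
    have "changes_at (\<lambda>_. 0) (Suc (2 * k))" "\<not> changes_at (\<lambda>_. 0) (Suc (Suc (2 * k)))"
      using 1[of "Suc k"] 2[of k] by (auto simp: changes_at_def)
    then show ?case using Suc by simp
  qed (simp add: changes_at_def)
qed

lemma exceeds_large: "\<exists>s>0. exceeds m K b s"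
proof -
  have "((\<lambda>s. jcoef m b s n) \<longlongrightarrow> 0) at_top" for n
    unfolding jcoef_def by real_asymp
  \<comment> \<open>An odd index, because the limit solution vanishes at the even ones and counts
    are stable only where it does not vanish.\<close>
  then have "\<forall>\<^sub>F s in at_top. sign_changes (jcoef m b s) (Suc (2 * Suc K))
      = sign_changes (\<lambda>_. 0) (Suc (2 * Suc K))"
    by (rule sign_changes_locally_constant) (simp add: rec_sol_zero_coeff(2) del: mult_Suc_right)
  then have "\<forall>\<^sub>F s in at_top. exceeds m K b s"
    unfolding exceeds_def sign_changes_zero_coeff by (rule eventually_mono) (metis lessI)
  then have "\<forall>\<^sub>F s in at_top. exceeds m K b s \<and> s > 0"
    by (rule eventually_conj) (rule eventually_gt_at_top)
  then show ?thesis using eventually_happens'[OF trivial_limit_at_top_linorder] by blast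
qed

section \<open>Stability of the count under perturbation of the parameters\<close>

lemma exceeds_open:
  assumes "exceeds m K b s" "(bf \<longlongrightarrow> b) F" "(sf \<longlongrightarrow> s) F" "s \<noteq> 0"
  shows "\<forall>\<^sub>F x in F. exceeds m K (bf x) (sf x)"
proof -
  obtain N where N: "sign_changes (jcoef m b s) N > K" using assms(1) by (auto simp: exceeds_def)
  \<comment> \<open>Counts are stable where the solution is nonzero; of N and N + 1 at least one is
    such an index.\<close>
  obtain M where M: "M \<ge> N" "rec_sol (jcoef m b s) M \<noteq> 0"
    using rec_sol_no_double_zero[of "jcoef m b s" N] by (metis le_SucI order_refl)
  have "\<forall>\<^sub>F x in F. sign_changes (jcoef m (bf x) (sf x)) M = sign_changes (jcoef m b s) M"
    using M assms by (intro sign_changes_locally_constant tendsto_jcoef)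
  then show ?thesis
  proof eventually_elim
    case (elim x)
    then show ?case using N sign_changes_mono[OF M(1), of "jcoef m b s"] unfolding exceeds_def
      by (metis less_le_trans)
  qed
qed

text \<open>A perturbation can raise the count only by a change that arrives from infinity. If the
  solution is unbounded, growth has set in at some index, an open condition that forbids later
  changes. If it is bounded with fewer than K changes, the tail supplies at most one more.\<close>

lemma not_exceeds_open:
  assumes ne: "\<not> exceeds m K b s" and sp: "\<not> (in_spec m b s \<and> spec_index m b s = K)"
    and lim: "(bf \<longlongrightarrow> b) F" "(sf \<longlongrightarrow> s) F" and pos: "s > 0" "\<forall>\<^sub>F x in F. bf x \<ge> 0"
  shows "\<forall>\<^sub>F x in F. \<not> exceeds m K (bf x) (sf x)"
proof -
  \<comment> \<open>Taken at s + 1 instead of s, so that one N serves all nearby parameters.\<close>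
  define N where "N = nat \<lceil>2 * (s + 1)\<rceil>"
  have ev: "\<forall>\<^sub>F x in F. 0 < sf x \<and> sf x < s + 1 \<and> bf x \<ge> 0"
    using order_tendstoD(1)[OF lim(2) pos(1)] order_tendstoD(2)[OF lim(2), of "s + 1"] pos(2)
    by (auto intro!: eventually_conj)
  have tail: "jcoef m b' s' k \<ge> 4" if "k > N" "0 < s'" "s' < s + 1" "b' \<ge> 0" for b' s' k
    using that by (intro jcoef_ge_4_beyond[of b' s' "s + 1"]) (auto simp: N_def)
  have le: "sign_changes (jcoef m b s) M \<le> K" for M using ne by (auto simp: exceeds_def not_less)
  note lc = sign_changes_locally_constant[OF tendsto_jcoef[OF lim, of m]]
  have Fb: "b \<ge> 0" if "F \<noteq> bot" using tendsto_lowerbound[OF lim(1) pos(2) that] .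
  show ?thesis
  proof (cases "F = bot")
    case True
    then show ?thesis by simp
  next
    case False
    note b0 = Fb[OF False]
    show ?thesis
    proof (cases "in_spec m b s")
      case True
      then have "spec_index m b s \<noteq> K" using sp by simp
      moreover have "sign_changes (jcoef m b s) N = spec_index m b s"
        using in_spec_index_eq[OF True b0 pos(1), of N] pos(1) by (simp add: N_def) linarith
      ultimately have lt: "sign_changes (jcoef m b s) N < K" using le[of N] by simp
      have "rec_sol (jcoef m b s) N \<noteq> 0"
        using bounded_rec_sol_same_sign[of N "jcoef m b s" N] True tail[of _ s b] pos(1) b0
        unfolding in_spec_def by force
      from lc[OF _ this] have "\<forall>\<^sub>F x in F. sign_changes (jcoef m (bf x) (sf x)) N = sign_changes (jcoef m b s) N"
        using pos(1) by simp
      with ev show ?thesis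
      proof eventually_elim
        case (elim x)
        then have "sign_changes (jcoef m (bf x) (sf x)) M \<le> Suc (sign_changes (jcoef m b s) N)" for M
          using sign_changes_tail[of N "jcoef m (bf x) (sf x)" M] tail[of _ "sf x" "bf x"] by auto
        then show ?case using lt unfolding exceeds_def by (metis Suc_leI le_trans not_le)
      qed
    next
      case False
      then obtain n where n: "n \<ge> N" "\<bar>rec_sol (jcoef m b s) n\<bar> \<le> 2 * \<bar>rec_sol (jcoef m b s) (Suc n)\<bar>"
        using unbounded_rec_sol_growth unfolding in_spec_def by blast
      define M where "M = Suc (Suc n)"
      have g: "2 * \<bar>rec_sol (jcoef m b s) (Suc n)\<bar> \<le> \<bar>rec_sol (jcoef m b s) M\<bar>"
        "rec_sol (jcoef m b s) (Suc n) \<noteq> 0"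
        using rec_sol_growth_step[of "jcoef m b s" n] tail[of "Suc n" s b] n pos(1) b0 unfolding M_def by auto
      have M0: "rec_sol (jcoef m b s) M \<noteq> 0" using g by auto
      have "\<forall>\<^sub>F x in F. sign_changes (jcoef m (bf x) (sf x)) M = sign_changes (jcoef m b s) M"
        using lc[OF _ M0] pos(1) by simp
      moreover have "\<forall>\<^sub>F x in F. \<bar>rec_sol (jcoef m (bf x) (sf x)) (Suc n)\<bar> - 2 * \<bar>rec_sol (jcoef m (bf x) (sf x)) M\<bar> < 0"
      proof (rule order_tendstoD(2))
        show "((\<lambda>x. \<bar>rec_sol (jcoef m (bf x) (sf x)) (Suc n)\<bar> - 2 * \<bar>rec_sol (jcoef m (bf x) (sf x)) M\<bar>) \<longlongrightarrow>
          \<bar>rec_sol (jcoef m b s) (Suc n)\<bar> - 2 * \<bar>rec_sol (jcoef m b s) M\<bar>) F"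
          using pos(1) by (intro tendsto_intros tendsto_rec_sol tendsto_jcoef lim) auto
        show "\<bar>rec_sol (jcoef m b s) (Suc n)\<bar> - 2 * \<bar>rec_sol (jcoef m b s) M\<bar> < 0"
          using g by simp
      qed
      ultimately show ?thesis using ev
      proof eventually_elim
        case (elim x)
        let ?q = "jcoef m (bf x) (sf x)"
        have "\<not> changes_at ?q k" if "k > Suc n" for k
          using rec_sol_growth[of "Suc n" ?q k] tail[of _ "sf x" "bf x"] elim n(1) that
          unfolding M_def by simp
        then have "sign_changes ?q L = sign_changes ?q M" if "L \<ge> M" for L
          using that by (intro sign_changes_stable) (auto simp: M_def)
        then have "sign_changes ?q L \<le> sign_changes ?q M" for L
          using sign_changes_mono[of L M ?q] by (metis le_cases order_refl)
        then show ?case using elim(1) le[of M] unfolding exceeds_def by (metis le_trans not_le)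
      qed
    qed
  qed
qed

lemma in_spec_exceeds:
  assumes "in_spec m b s" "b \<ge> 0" "0 < s" "s < s'"
  shows "exceeds m (spec_index m b s) b s'"
proof -
  define N where "N = nat \<lceil>2 * s\<rceil>"
  have "\<exists>M. sign_changes (jcoef m b s) N < sign_changes (jcoef m b s') M"
  proof (rule more_sign_changes)
    show "jcoef m b s k \<ge> 4" if "k > N" for k
      using that assms by (intro jcoef_ge_4_beyond[of b s s]) (auto simp: N_def)
  qed (use assms in \<open>auto simp: in_spec_def intro!: jcoef_strict_antimono\<close>)
  then show ?thesis unfolding exceeds_def spec_index_def N_def .
qed

lemma in_spec_not_exceeds:
  assumes "in_spec m b s" "b \<ge> 0" "0 < s"
  shows "\<not> exceeds m (spec_index m b s) b s"
  using in_spec_index_ge[OF assms] by (auto simp: exceeds_def not_less)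

text \<open>For b \<ge> 0 the set is an open half-line, since \<open>exceeds\<close> is open and
  inherited by larger s; its end point is \<open>\<sigma>\<^sub>K\<close> evaluated at b.\<close>

definition spec_curve :: "nat \<Rightarrow> nat \<Rightarrow> real \<Rightarrow> real" where
  "spec_curve m K b = Inf {s. 0 < s \<and> exceeds m K b s}"

lemma spec_curve_ge_1:
  assumes "b \<ge> 0"
  shows "spec_curve m K b \<ge> 1"
  unfolding spec_curve_def
proof (rule cInf_greatest)
  show "{s. 0 < s \<and> exceeds m K b s} \<noteq> {}" using exceeds_large by auto
  show "1 \<le> s" if "s \<in> {s. 0 < s \<and> exceeds m K b s}" for s
    using not_exceeds_small[of b s m K] that assms by force
qed

lemma exceeds_above_curve:
  assumes "b \<ge> 0" "spec_curve m K b < s"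
  shows "exceeds m K b s"
proof -
  obtain s' where "0 < s'" "exceeds m K b s'" "s' < s"
  proof -
    have "bdd_below {s. 0 < s \<and> exceeds m K b s}" by (auto intro!: bdd_belowI[of _ 0])
    moreover have "{s. 0 < s \<and> exceeds m K b s} \<noteq> {}" using exceeds_large by auto
    ultimately show ?thesis using that assms(2) unfolding spec_curve_def
      by (subst (asm) cInf_less_iff) auto
  qed
  then show ?thesis using exceeds_mono assms by (meson less_imp_le)
qed

lemma spec_curve_le:
  assumes "exceeds m K b s" "0 < s"
  shows "spec_curve m K b \<le> s"
  unfolding spec_curve_def by (rule cInf_lower) (use assms in \<open>auto intro!: bdd_belowI[of _ 0]\<close>)

lemma not_exceeds_below_curve:
  assumes "0 < s" "s < spec_curve m K b"
  shows "\<not> exceeds m K b s"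
  using spec_curve_le[of m K b s] assms by auto

lemma not_exceeds_curve:
  assumes b: "b \<ge> 0"
  shows "\<not> exceeds m K b (spec_curve m K b)"
proof
  let ?s = "spec_curve m K b"
  assume e: "exceeds m K b ?s"
  have "\<forall>\<^sub>F s in at_left ?s. exceeds m K b s"
    using spec_curve_ge_1[OF b, of m K]
    by (intro exceeds_open[OF e] tendsto_intros) auto
  moreover have "\<forall>\<^sub>F s in at_left ?s. 0 < s \<and> s < ?s"
    using spec_curve_ge_1[OF b, of m K] eventually_at_left_real[of 0 ?s] by (auto elim!: eventually_mono)
  ultimately have "\<forall>\<^sub>F s in at_left ?s. False"
    by eventually_elim (use not_exceeds_below_curve in blast)
  then show False by simp
qed

text \<open>At the threshold \<open>exceeds\<close> fails, yet it holds everywhere to the right. By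
  \<open>not_exceeds_open\<close> such a jump happens only at a bounded solution with exactly K
  changes.\<close>

lemma in_spec_curve:
  assumes b: "b \<ge> 0"
  shows "in_spec m b (spec_curve m K b) \<and> spec_index m b (spec_curve m K b) = K"
proof (rule ccontr)
  let ?s = "spec_curve m K b"
  assume n: "\<not> ?thesis"
  have "\<forall>\<^sub>F s in at_right ?s. \<not> exceeds m K b s"
    using spec_curve_ge_1[OF b, of m K] b
    by (intro not_exceeds_open[OF not_exceeds_curve[OF b] n] tendsto_intros) auto
  moreover have "\<forall>\<^sub>F s in at_right ?s. ?s < s" by (simp add: eventually_at_filter)
  ultimately have "\<forall>\<^sub>F s in at_right ?s. False"
    by eventually_elim (use exceeds_above_curve b in blast)
  then show False by simp
qed

text \<open>The strict comparison at infinity: immediately to the right of a bounded solution the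
  count exceeds its index, so its parameter is the threshold.\<close>

lemma spec_curve_unique:
  assumes "in_spec m b s" "b \<ge> 0" "s > 0"
  shows "spec_curve m (spec_index m b s) b = s"
proof (rule antisym)
  let ?t = "spec_curve m (spec_index m b s) b"
  show "?t \<le> s"
  proof (rule ccontr)
    assume "\<not> ?t \<le> s"
    then obtain s' where "s < s'" "s' < ?t" using dense[of s ?t] by auto
    then show False using in_spec_exceeds[OF assms, of s'] not_exceeds_below_curve[of s'] assms by auto
  qed
  show "s \<le> ?t"
    using exceeds_above_curve[of b m "spec_index m b s" s] in_spec_not_exceeds[OF assms] assms by force
qed

text \<open>The position of the curve relative to a fixed s is decided by \<open>exceeds\<close>.
  Both answers persist for nearby b, the negative one because no bounded solution of index K lies
  strictly below the curve.\<close>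

lemma continuous_spec_curve: "continuous_on {0..} (spec_curve m K)"
  unfolding continuous_on_def
proof (intro ballI order_tendstoI)
  fix b t :: real
  assume "b \<in> {0..}"
  then have b: "b \<ge> 0" by simp
  let ?F = "at b within {0..}"
  have ev: "\<forall>\<^sub>F b' in ?F. b' \<ge> 0" by (simp add: eventually_at_filter)
  note one = spec_curve_ge_1[OF b, of m K]
  show "\<forall>\<^sub>F b' in ?F. t < spec_curve m K b'" if t: "t < spec_curve m K b"
  proof -
    obtain s where s: "max t 0 < s" "s < spec_curve m K b"
      using dense[of "max t 0" "spec_curve m K b"] t one by auto
    have "\<not> (in_spec m b s \<and> spec_index m b s = K)"
      using spec_curve_unique[of m b s] s b by auto
    then have "\<forall>\<^sub>F b' in ?F. \<not> exceeds m K b' s"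
      using s b ev by (intro not_exceeds_open[where b = b and s = s] not_exceeds_below_curve tendsto_intros) auto
    with ev show ?thesis
    proof eventually_elim
      case (elim b')
      then show ?case using exceeds_above_curve[of b' m K s] s by fastforce
    qed
  qed
  show "\<forall>\<^sub>F b' in ?F. spec_curve m K b' < t" if t: "spec_curve m K b < t"
  proof -
    obtain s where s: "spec_curve m K b < s" "s < t" using dense[OF t] by auto
    have "\<forall>\<^sub>F b' in ?F. exceeds m K b' s"
      using exceeds_above_curve[OF b s(1)] s one by (intro exceeds_open[where b = b and s = s] tendsto_intros) auto
    then show ?thesis
    proof eventually_elim
      case (elim b')
      then show ?case using spec_curve_le[of m K b' s] s one by auto
    qed
  qed
qed

text \<open>A bounded solution is nonzero at an index past all its changes, and one such index
  serves all nearby parameters, so the count there is stable. This makes the index constant on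
  connected sets of spectral points.\<close>

lemma spec_index_locally_constant:
  assumes sp: "in_spec m b s" and pos: "b \<ge> 0" "s > 0"
    and lim: "(bf \<longlongrightarrow> b) F" "(sf \<longlongrightarrow> s) F"
    and ev: "\<forall>\<^sub>F x in F. bf x \<ge> 0 \<and> in_spec m (bf x) (sf x)"
  shows "\<forall>\<^sub>F x in F. spec_index m (bf x) (sf x) = spec_index m b s"
proof -
  define N where "N = nat \<lceil>2 * (s + 1)\<rceil>"
  have N: "real N \<ge> 2 * (s + 1)" using pos by (simp add: N_def)
  have "rec_sol (jcoef m b s) N \<noteq> 0"
    using bounded_rec_sol_same_sign[of N "jcoef m b s" N] sp jcoef_ge_4[of b s _ m] pos N
    unfolding in_spec_def by force
  then have "\<forall>\<^sub>F x in F. sign_changes (jcoef m (bf x) (sf x)) N = sign_changes (jcoef m b s) N"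
    using pos by (intro sign_changes_locally_constant tendsto_jcoef lim) auto
  moreover have "\<forall>\<^sub>F x in F. 0 < sf x" "\<forall>\<^sub>F x in F. sf x < s + 1"
    using order_tendstoD[OF lim(2)] pos by auto
  ultimately show ?thesis using ev
  proof eventually_elim
    case (elim x)
    then have "sign_changes (jcoef m (bf x) (sf x)) N = spec_index m (bf x) (sf x)"
      using N by (intro in_spec_index_eq) auto
    moreover have "sign_changes (jcoef m b s) N = spec_index m b s"
      using sp pos N by (intro in_spec_index_eq) auto
    ultimately show ?case using elim by simp
  qed
qed

text \<open>The index of a spectral point is at most \<lceil>2 * s\<rceil>, so only finitely many
  curves are met. This yields the finiteness of the positive Bessel zeros up to t, on which their
  numbering rests.\<close>

lemma finite_spec_below:
  "finite {s. 0 < s \<and> s \<le> t \<and> in_spec m 0 s}"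
proof -
  have "{s. 0 < s \<and> s \<le> t \<and> in_spec m 0 s} \<subseteq> (\<lambda>K. spec_curve m K 0) ` {..nat \<lceil>2 * t\<rceil>}"
  proof
    fix s assume "s \<in> {s. 0 < s \<and> s \<le> t \<and> in_spec m 0 s}"
    then have s: "0 < s" "s \<le> t" "in_spec m 0 s" by auto
    have "sign_changes q N \<le> N" for q N by (induction N) auto
    then have "spec_index m 0 s \<le> nat \<lceil>2 * s\<rceil>" unfolding spec_index_def .
    also have "\<dots> \<le> nat \<lceil>2 * t\<rceil>" using s by (intro nat_mono ceiling_mono) auto
    finally show "s \<in> (\<lambda>K. spec_curve m K 0) ` {..nat \<lceil>2 * t\<rceil>}"
      using spec_curve_unique[of m 0 s] s by (intro image_eqI[of _ _ "spec_index m 0 s"]) auto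
  qed
  then show ?thesis by (rule finite_subset) auto
qed

section \<open>Bessel functions\<close>

definition bessel_term :: "nat \<Rightarrow> real \<Rightarrow> nat \<Rightarrow> real" where
  "bessel_term k x j = (-1) ^ j / (fact j * fact (j + k)) * (x / 2) ^ (2 * j + k)"

lemma rGamma_of_nat: "rGamma (1 + real n) = 1 / fact n"
  by (simp add: rGamma_inverse_Gamma Gamma_fact field_simps)

lemma abs_bessel_term:
  "\<bar>bessel_term k x j\<bar> \<le> \<bar>x / 2\<bar> ^ k / fact k * (inverse (fact j) * ((x / 2)\<^sup>2) ^ j)"
proof -
  have "(fact (j + k) :: real) \<ge> fact k" by (intro fact_mono) auto
  then have "1 / fact (j + k) \<le> (1 / fact k :: real)" by (intro divide_left_mono) auto
  then have "1 / fact (j + k) * (\<bar>x / 2\<bar> ^ k * (inverse (fact j) * ((x / 2)\<^sup>2) ^ j))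
    \<le> 1 / fact k * (\<bar>x / 2\<bar> ^ k * (inverse (fact j) * ((x / 2)\<^sup>2) ^ j))"
    by (intro mult_right_mono) auto
  moreover have "\<bar>bessel_term k x j\<bar> = 1 / fact (j + k) * (\<bar>x / 2\<bar> ^ k * (inverse (fact j) * ((x / 2)\<^sup>2) ^ j))"
  proof -
    define z where "z = x / 2"
    have "\<bar>z\<bar> ^ (2 * j + k) = \<bar>z\<bar> ^ k * (z\<^sup>2) ^ j"
      by (subst power_add, subst power_mult) (simp only: power2_abs mult.commute)
    then show ?thesis unfolding bessel_term_def z_def[symmetric]
      by (simp add: abs_mult power_abs divide_inverse)
  qed
  ultimately show ?thesis by simp
qed

lemma summable_abs_bessel_term: "summable (\<lambda>j. \<bar>bessel_term k x j\<bar>)"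
  by (rule summable_comparison_test'[of "\<lambda>j. \<bar>x / 2\<bar> ^ k / fact k * (inverse (fact j) * ((x / 2)\<^sup>2) ^ j)" 0])
    (use abs_bessel_term summable_exp[of "(x/2)\<^sup>2"] in \<open>auto intro!: summable_mult\<close>)

lemma summable_bessel_term: "summable (bessel_term k x)"
  using summable_abs_bessel_term by (rule summable_rabs_cancel)

lemma exp_series: "(\<Sum>n. inverse (fact n) * x ^ n) = exp (x :: real)"
  by (simp add: exp_def)

lemma bessel_J_nat: "bessel_J (int k) x = (\<Sum>j. bessel_term k x j)"
  unfolding bessel_J_def
proof (rule suminf_cong)
  fix j
  have 1: "(x / 2) powi (2 * int j + int k) = (x / 2) ^ (2 * j + k)"
    using power_int_of_nat[of "x / 2" "2 * j + k"] by simp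
  have 2: "rGamma (of_int (int j + int k + 1) :: real) = 1 / fact (j + k)"
    using rGamma_of_nat[of "j + k"] by (simp add: add_ac)
  show "(-1) ^ j / fact j * rGamma (of_int (int j + int k + 1)) * (x / 2) powi (2 * int j + int k)
    = bessel_term k x j"
    unfolding 1 2 bessel_term_def by simp
qed

lemma bessel_J_neg: "bessel_J (- int k) x = (-1) ^ k * bessel_J (int k) x"
proof -
  define f where "f j = (-1) ^ j / fact j * rGamma (of_int (int j + - int k + 1)) * (x / 2) powi (2 * int j + - int k)" for j
  have f0: "f j = 0" if "j < k" for j
  proof -
    have "(of_int (int j + - int k + 1) :: real) = - of_nat (k - Suc j)" using that by simp
    then have "rGamma (of_int (int j + - int k + 1) :: real) = 0"
      by (simp only: rGamma_eq_zero_iff minus_of_nat_in_nonpos_Ints)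
    then show ?thesis by (simp add: f_def)
  qed
  have fs: "f (i + k) = (-1) ^ k * bessel_term k x i" for i
  proof -
    have 1: "(x / 2) powi (2 * int (i + k) + - int k) = (x / 2) ^ (2 * i + k)"
      using power_int_of_nat[of "x / 2" "2 * i + k"] by (simp add: algebra_simps)
    have 2: "rGamma (of_int (int (i + k) + - int k + 1) :: real) = 1 / fact i"
      using rGamma_of_nat[of i] by (simp add: add_ac)
    show ?thesis unfolding f_def 1 2 bessel_term_def by (simp add: power_add mult_ac)
  qed
  have "summable (\<lambda>i. f (i + k))" unfolding fs by (intro summable_mult summable_bessel_term)
  then have "summable f" by (simp add: summable_iff_shift)
  then have "suminf f = (\<Sum>i. f (i + k))"
    using suminf_split_initial_segment[of f k] f0 by simp
  also have "\<dots> = (-1) ^ k * bessel_J (int k) x"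
    unfolding fs bessel_J_nat by (intro suminf_mult summable_bessel_term)
  finally show ?thesis unfolding bessel_J_def f_def .
qed

lemma bessel_J_recurrence:
  assumes "x \<noteq> 0"
  shows "bessel_J (int (Suc (Suc k))) x = 2 / x * (1 + real k) * bessel_J (int (Suc k)) x - bessel_J (int k) x"
proof -
  have nz: "x / 2 \<noteq> 0" using assms by simp
  \<comment> \<open>The series of order k + 2 is delayed by one index, so that the three series
    agree in the power 2j + k.\<close>
  define g where "g j = (case j of 0 \<Rightarrow> 0 | Suc i \<Rightarrow> bessel_term (Suc (Suc k)) x i)" for j
  have "(\<lambda>i. g (Suc i)) sums bessel_J (int (Suc (Suc k))) x"
    unfolding g_def bessel_J_nat by (simp add: summable_bessel_term summable_sums)
  then have g: "g sums bessel_J (int (Suc (Suc k))) x"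
    using sums_Suc[of g] by (simp add: g_def)
  have eq: "g j = 2 / x * (1 + real k) * bessel_term (Suc k) x j - bessel_term k x j" for j
  proof -
    define y where "y = x / 2"
    have y: "y \<noteq> 0" "2 / x = 1 / y" using nz by (auto simp: y_def)
    have r: "2 / x * (1 + real k) * bessel_term (Suc k) x j - bessel_term k x j
      = (-1) ^ j * y ^ (2 * j + k) * ((1 + real k) / (fact j * fact (Suc (j + k))) - 1 / (fact j * fact (j + k)))"
    proof -
      have p: "y ^ (2 * j + Suc k) = y * y ^ (2 * j + k)" "j + Suc k = Suc (j + k)" by simp_all
      show ?thesis unfolding bessel_term_def y_def[symmetric] y(2) p using y(1)
        by (simp add: right_diff_distrib mult_ac del: fact_Suc)
    qed
    \<comment> \<open>Over the common denominator the numerators give (1 + k) - (1 + j + k) = -j,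
      which reduces j! to (j - 1)! as in the delayed series.\<close>
    have "(1 + real k) / (fact j * fact (Suc (j + k))) - 1 / (fact j * fact (j + k))
      = - real j / (fact j * fact (Suc (j + k)))"
    proof -
      define c where "c = 1 + real j + real k"
      have fS: "fact (Suc (j + k)) = c * fact (j + k)" by (simp add: c_def algebra_simps)
      have c1: "1 + real k = c - real j" by (simp add: c_def)
      have c0: "c \<noteq> 0" by (simp add: c_def)
      have "(c - J) / (F * (c * G)) - 1 / (F * G) = - J / (F * (c * G))"
        if "F \<noteq> 0" "G \<noteq> 0" for F G J
        using that c0 by (simp add: field_simps)
      from this[OF fact_nonzero fact_nonzero] show ?thesis unfolding fS c1 .
    qed
    note r = r[unfolded this]
    show ?thesis
    proof (cases j)
      case 0
      then show ?thesis unfolding r by (simp add: g_def)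
    next
      case (Suc i)
      have "real (Suc i) / (fact (Suc i) * fact (Suc (Suc i + k))) = 1 / (fact i * fact (Suc (Suc i + k)) :: real)"
        by simp
      then have q: "- real (Suc i) / (fact (Suc i) * fact (Suc (Suc i + k))) = - (1 / (fact i * fact (Suc (Suc i + k))))"
        by (simp only: minus_divide_left[symmetric])
      have idx: "i + Suc (Suc k) = Suc (Suc i + k)" "2 * i + Suc (Suc k) = 2 * Suc i + k" by simp_all
      show ?thesis unfolding r unfolding Suc q g_def bessel_term_def y_def[symmetric] nat.case idx
        by (simp del: fact_Suc mult_Suc_right)
    qed
  qed
  have "(\<lambda>j. 2 / x * (1 + real k) * bessel_term (Suc k) x j - bessel_term k x j) sums
    (2 / x * (1 + real k) * bessel_J (int (Suc k)) x - bessel_J (int k) x)"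
    unfolding bessel_J_nat by (intro sums_diff sums_mult summable_sums summable_bessel_term)
  with g show ?thesis unfolding eq by (rule sums_unique2)
qed

text \<open>Crude but uniform in the order, as \<open>\<bar>x / 2\<bar> ^ k / fact k\<close> is a
  single term of an exponential series.\<close>

lemma bessel_J_bound:
  "\<bar>bessel_J (int k) x\<bar> \<le> exp \<bar>x / 2\<bar> * exp ((x / 2)\<^sup>2)"
proof -
  let ?g = "\<lambda>j. \<bar>x / 2\<bar> ^ k / fact k * (inverse (fact j) * ((x / 2)\<^sup>2) ^ j)"
  have sg: "summable ?g" by (intro summable_mult summable_exp)
  have "\<bar>bessel_J (int k) x\<bar> \<le> (\<Sum>j. \<bar>bessel_term k x j\<bar>)"
    unfolding bessel_J_nat by (rule summable_rabs[OF summable_abs_bessel_term])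
  also have "\<dots> \<le> suminf ?g" by (intro suminf_le abs_bessel_term summable_abs_bessel_term sg)
  also have "\<dots> = \<bar>x / 2\<bar> ^ k / fact k * exp ((x / 2)\<^sup>2)"
    by (subst suminf_mult) (auto intro: summable_exp simp: exp_series)
  also have "\<dots> \<le> exp \<bar>x / 2\<bar> * exp ((x / 2)\<^sup>2)"
  proof (rule mult_right_mono)
    have "sum (\<lambda>n. inverse (fact n) * \<bar>x / 2\<bar> ^ n) {k} \<le> (\<Sum>n. inverse (fact n) * \<bar>x / 2\<bar> ^ n)"
      by (intro sum_le_suminf summable_exp) auto
    then show "\<bar>x / 2\<bar> ^ k / fact k \<le> exp \<bar>x / 2\<bar>" unfolding exp_series by (simp add: field_simps)
  qed auto
  finally show ?thesis .
qed

text \<open>For large order the leading term of the series dominates the rest.\<close>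

lemma bessel_J_pos:
  assumes x: "x > 0" and k: "real k + 1 > exp ((x / 2)\<^sup>2)"
  shows "bessel_J (int k) x > 0"
proof -
  define y where "y = x / 2"
  have y: "y > 0" using x by (simp add: y_def)
  \<comment> \<open>For j \<ge> 1 the factorial (j + k)! contains a factor k + 1 beyond k!, and k +
    1 beats the sum \<open>exp (y\<^sup>2)\<close> of the remaining factors.\<close>
  let ?g = "\<lambda>j. y ^ k / fact k / (real k + 1) * (inverse (fact j) * (y\<^sup>2) ^ j)"
  have sg: "summable ?g" by (intro summable_mult summable_exp)
  have nn: "?g j \<ge> 0" for j using y by auto
  have le: "\<bar>bessel_term k x j\<bar> \<le> ?g j" if "j \<ge> 1" for j
  proof -
    have "real k + 1 \<le> real (fact (j + k)) / fact k"
    proof -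
      have "fact (Suc k) \<le> (fact (j + k) :: real)" using that by (intro fact_mono) auto
      then show ?thesis by (simp add: pos_le_divide_eq field_simps)
    qed
    then have "fact k * (real k + 1) \<le> (fact (j + k) :: real)"
      by (simp add: pos_le_divide_eq mult.commute)
    then have "1 / fact (j + k) \<le> 1 / (fact k * (real k + 1))" by (intro divide_left_mono) auto
    then have "1 / fact (j + k) * (y ^ k * (inverse (fact j) * (y\<^sup>2) ^ j))
      \<le> 1 / (fact k * (real k + 1)) * (y ^ k * (inverse (fact j) * (y\<^sup>2) ^ j))"
      using y by (intro mult_right_mono) auto
    moreover have "\<bar>bessel_term k x j\<bar> = 1 / fact (j + k) * (y ^ k * (inverse (fact j) * (y\<^sup>2) ^ j))"
    proof -
      have "y ^ (2 * j + k) = y ^ k * (y\<^sup>2) ^ j" by (subst power_add, subst power_mult) (simp add: mult.commute)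
      then show ?thesis unfolding bessel_term_def y_def[symmetric] using y
        by (simp add: abs_mult power_abs divide_inverse)
    qed
    ultimately show ?thesis by simp
  qed
  have sh: "summable (\<lambda>j. \<bar>bessel_term k x (Suc j)\<bar>)"
    using summable_abs_bessel_term[of k x] by (subst summable_Suc_iff)
  have "\<bar>\<Sum>j. bessel_term k x (Suc j)\<bar> \<le> (\<Sum>j. \<bar>bessel_term k x (Suc j)\<bar>)"
    by (rule summable_rabs[OF sh])
  also have "\<dots> \<le> (\<Sum>j. ?g (Suc j))"
  proof (rule suminf_le[OF _ sh])
    show "\<bar>bessel_term k x (Suc j)\<bar> \<le> ?g (Suc j)" for j by (rule le) simp
    show "summable (\<lambda>j. ?g (Suc j))" using sg by (subst summable_Suc_iff)
  qed
  also have "\<dots> = suminf ?g - ?g 0" by (rule suminf_split_head[OF sg])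
  also have "\<dots> < y ^ k / fact k"
  proof -
    have "suminf ?g = y ^ k / fact k / (real k + 1) * exp (y\<^sup>2)"
      by (subst suminf_mult) (auto intro: summable_exp simp: exp_series)
    also have "\<dots> < y ^ k / fact k / (real k + 1) * (real k + 1)"
      using k y unfolding y_def[symmetric] by (intro mult_strict_left_mono) auto
    also have "\<dots> = y ^ k / fact k"
    proof -
      have "real k + 1 \<noteq> 0" by simp
      then show ?thesis by simp
    qed
    finally show ?thesis using nn[of 0] by linarith
  qed
  finally have "\<bar>\<Sum>j. bessel_term k x (Suc j)\<bar> < bessel_term k x 0"
    by (simp add: bessel_term_def y_def)
  moreover have "(\<Sum>j. bessel_term k x (Suc j)) = bessel_J (int k) x - bessel_term k x 0"
    unfolding bessel_J_nat by (rule suminf_split_head[OF summable_bessel_term])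
  ultimately show ?thesis by linarith
qed

text \<open>The numbers J_(n+m)(s) form a bounded nonzero solution f of the same recurrence. If f
  vanishes at 0, \<open>rec_sol\<close> is a multiple of it. If \<open>rec_sol\<close> is bounded,
  it decays, and the constant Casoratian -f 0 of the two is 0.\<close>

lemma bessel_zero_iff_in_spec:
  assumes s: "s > 0"
  shows "bessel_J l s = 0 \<longleftrightarrow> in_spec (nat \<bar>l\<bar>) 0 s"
proof -
  define m where "m = nat \<bar>l\<bar>"
  define f where "f n = bessel_J (int (n + m)) s" for n
  define q where "q = jcoef m 0 s"
  have "l = int m \<or> l = - int m" by (auto simp: m_def)
  then have J: "bessel_J l s = 0 \<longleftrightarrow> f 0 = 0"
    using bessel_J_neg[of m s] by (auto simp: f_def)
  have rec: "f (Suc (Suc n)) = of_real (q (Suc n)) * f (Suc n) - f n" for n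
    using bessel_J_recurrence[of s "n + m"] s by (simp add: f_def q_def jcoef_def add_ac)
  have fb: "\<bar>f n\<bar> \<le> exp \<bar>s / 2\<bar> * exp ((s / 2)\<^sup>2)" for n unfolding f_def by (rule bessel_J_bound)
  show ?thesis unfolding J m_def[symmetric]
  proof
    assume f0: "f 0 = 0"
    have pr: "f n = f (Suc 0) * rec_sol q n" for n
      using rec_sol_proportional[of f q n, OF rec f0] by simp
    have "f (Suc 0) \<noteq> 0"
    proof
      assume "f (Suc 0) = 0"
      then have "f n = 0" for n using pr[of n] by simp
      moreover obtain n :: nat where "exp ((s / 2)\<^sup>2) < real n" using reals_Archimedean2 by blast
      then have "f n > 0" unfolding f_def using s by (intro bessel_J_pos) auto
      ultimately show False by simp
    qed
    then have "\<bar>rec_sol q n\<bar> \<le> exp \<bar>s / 2\<bar> * exp ((s / 2)\<^sup>2) / \<bar>f (Suc 0)\<bar>" for n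
      using fb[of n] pr[of n] by (simp add: pos_le_divide_eq abs_mult mult.commute)
    then show "in_spec m 0 s" unfolding in_spec_def q_def[symmetric] bounded_iff by auto
  next
    assume "in_spec m 0 s"
    then have b: "bounded (range (rec_sol q))" by (simp add: in_spec_def q_def)
    obtain C where C: "C > 0" "\<And>n. \<bar>rec_sol q n\<bar> \<le> C * (1/2) ^ n"
      by (rule bounded_rec_sol_geometric[OF _ b, of "nat \<lceil>2 * s\<rceil>"])
        (use s jcoef_ge_4_beyond[of 0 s s] in \<open>auto simp: q_def\<close>)
    define B where "B = exp \<bar>s / 2\<bar> * exp ((s / 2)\<^sup>2)"
    have nul: "(\<lambda>n. rec_sol q (g n) * f (h n)) \<longlonglongrightarrow> 0" if "\<And>n. g n \<ge> n" for g h :: "nat \<Rightarrow> nat"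
    proof (rule Lim_null_comparison)
      have "\<bar>rec_sol q (g n)\<bar> * \<bar>f (h n)\<bar> \<le> (C * (1/2) ^ n) * B" for n
      proof (rule mult_mono)
        have "C * (1/2) ^ g n \<le> C * (1/2) ^ n" using C(1) that[of n] by (intro mult_left_mono power_decreasing) auto
        then show "\<bar>rec_sol q (g n)\<bar> \<le> C * (1/2) ^ n" using C(2)[of "g n"] by linarith
      qed (use C(1) fb in \<open>auto simp: B_def\<close>)
      then show "\<forall>\<^sub>F n in sequentially. norm (rec_sol q (g n) * f (h n)) \<le> (C * (1/2) ^ n) * B"
        by (simp add: abs_mult)
      have "(\<lambda>n. (C * (1/2) ^ n) * B) \<longlonglongrightarrow> (C * 0) * B" by (intro tendsto_intros LIMSEQ_realpow_zero) auto
      then show "(\<lambda>n. (C * (1/2) ^ n) * B) \<longlonglongrightarrow> 0" by simp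
    qed
    have "(\<lambda>n. rec_sol q n * f (Suc n) - rec_sol q (Suc n) * f n) \<longlonglongrightarrow> 0 - 0"
      by (intro tendsto_diff nul) auto
    moreover have "rec_sol q n * f (Suc n) - rec_sol q (Suc n) * f n = - f 0" for n
      using casoratian[of f q n, OF rec] by simp
    ultimately have "(\<lambda>n::nat. - f 0) \<longlonglongrightarrow> 0" by simp
    then show "f 0 = 0" using LIMSEQ_unique[OF tendsto_const] by force
  qed
qed

section \<open>The flow and its linear system\<close>

text \<open>D exp(-Lt) does not increase and D exp(Lt) does not decrease; the sign \<sigma> =
  \<plusminus>1 treats both, so that a zero spreads forwards and backwards in time.\<close>

lemma gronwall_zero:
  fixes D D' :: "real \<Rightarrow> real"
  assumes der: "\<And>t. t \<in> {a..b} \<Longrightarrow> (D has_real_derivative D' t) (at t within {a..b})"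
    and nn: "\<And>t. t \<in> {a..b} \<Longrightarrow> D t \<ge> 0"
    and le: "\<And>t. t \<in> {a..b} \<Longrightarrow> \<bar>D' t\<bar> \<le> L * D t"
    and t0: "t0 \<in> {a..b}" "D t0 = 0" and t: "t \<in> {a..b}"
  shows "D t = 0"
proof -
  have mono: "\<sigma> * D u * exp (- (\<sigma> * L * u)) \<ge> \<sigma> * D v * exp (- (\<sigma> * L * v))"
    if "u \<in> {a..b}" "v \<in> {a..b}" "u \<le> v" "\<sigma> = 1 \<or> \<sigma> = -1" for u v \<sigma> :: real
  proof -
    define f where "f x = \<sigma> * D x * exp (- (\<sigma> * L * x))" for x
    define f' where "f' x = (\<sigma> * D' x - \<sigma> * \<sigma> * L * D x) * exp (- (\<sigma> * L * x))" for x
    have df: "(f has_derivative (\<lambda>h. h * f' x)) (at x within {u..v})" if x: "u \<le> x" "x \<le> v" for x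
    proof -
      have "(f has_real_derivative f' x) (at x within {a..b})"
        unfolding f_def f'_def using \<open>u \<in> _\<close> \<open>v \<in> _\<close> x
        by (auto intro!: derivative_eq_intros der simp: algebra_simps)
      then have "(f has_real_derivative f' x) (at x within {u..v})"
        by (rule DERIV_subset) (use \<open>u \<in> _\<close> \<open>v \<in> _\<close> in auto)
      then show ?thesis by (simp add: has_field_derivative_def mult.commute[of _ "f' x"] mult_commute_abs)
    qed
    obtain x where x: "x \<in> {u..v}" "f v - f u = (v - u) * f' x"
      using mvt_very_simple[OF \<open>u \<le> v\<close> df] by blast
    have "\<bar>D' x\<bar> \<le> L * D x" using le x(1) \<open>u \<in> _\<close> \<open>v \<in> _\<close> by auto
    then have "\<sigma> * D' x - \<sigma> * \<sigma> * L * D x \<le> 0" using that(4) by auto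
    then have "f' x \<le> 0" unfolding f'_def by (intro mult_nonpos_nonneg) auto
    then have "f v - f u \<le> 0" unfolding x(2) using \<open>u \<le> v\<close> by (intro mult_nonneg_nonpos) auto
    then show ?thesis by (simp add: f_def)
  qed
  have "D t \<le> 0"
  proof (cases "t0 \<le> t")
    case True
    then have "D t * exp (- (L * t)) \<le> 0" using mono[of t0 t 1] t0 t by simp
    then show ?thesis by (simp add: mult_le_0_iff)
  next
    case False
    then have "D t * exp (L * t) \<le> 0" using mono[of t t0 "-1"] t0 t by simp
    then show ?thesis by (simp add: mult_le_0_iff)
  qed
  then show ?thesis using nn[OF t] by simp
qed

lemma abs_cos_diff_le: "\<bar>cos x - cos y\<bar> \<le> \<bar>x - y\<bar>" for x y :: real
proof -
  have "\<bar>cos x - cos y\<bar> = 2 * \<bar>sin ((x + y) / 2)\<bar> * \<bar>sin ((y - x) / 2)\<bar>"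
    by (simp add: cos_diff_cos abs_mult)
  also have "\<dots> \<le> 2 * 1 * \<bar>(y - x) / 2\<bar>"
    by (intro mult_mono abs_sin_x_le_abs_x) auto
  finally show ?thesis by simp
qed

lemma josephson_solution_unique:
  assumes "josephson_solution l a s \<theta>" "josephson_solution l a s \<eta>" "\<theta> 0 = \<eta> 0" "t \<in> {0..2*pi}"
  shows "\<theta> t = \<eta> t"
proof -
  define D where "D t = (\<theta> t - \<eta> t)\<^sup>2" for t
  define D' where "D' t = 2 * (\<theta> t - \<eta> t) * (a * cos (\<theta> t) - a * cos (\<eta> t))" for t
  have "D t = 0"
  proof (rule gronwall_zero[of 0 "2 * pi" D D' "2 * \<bar>a\<bar>" 0 t])
    fix t assume t: "t \<in> {0..2*pi}"
    have d: "(\<theta> has_real_derivative a * cos (\<theta> t) + of_int l + s * cos t) (at t within {0..2*pi})"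
      "(\<eta> has_real_derivative a * cos (\<eta> t) + of_int l + s * cos t) (at t within {0..2*pi})"
      using assms t by (auto simp: josephson_solution_def)
    show "(D has_real_derivative D' t) (at t within {0..2*pi})"
      unfolding D_def D'_def by (rule derivative_eq_intros d refl | simp)+
    have "\<bar>cos (\<theta> t) - cos (\<eta> t)\<bar> * (2 * \<bar>a\<bar> * \<bar>\<theta> t - \<eta> t\<bar>) \<le> \<bar>\<theta> t - \<eta> t\<bar> * (2 * \<bar>a\<bar> * \<bar>\<theta> t - \<eta> t\<bar>)"
      by (intro mult_right_mono abs_cos_diff_le) auto
    moreover have "\<bar>D' t\<bar> = \<bar>cos (\<theta> t) - cos (\<eta> t)\<bar> * (2 * \<bar>a\<bar> * \<bar>\<theta> t - \<eta> t\<bar>)"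
      unfolding D'_def right_diff_distrib[symmetric] abs_mult by (simp only: abs_numeral mult_ac)
    moreover have "2 * \<bar>a\<bar> * D t = \<bar>\<theta> t - \<eta> t\<bar> * (2 * \<bar>a\<bar> * \<bar>\<theta> t - \<eta> t\<bar>)"
    proof -
      have "D t = \<bar>\<theta> t - \<eta> t\<bar> * \<bar>\<theta> t - \<eta> t\<bar>" by (simp add: D_def power2_eq_square)
      then show ?thesis by (simp only: mult_ac)
    qed
    ultimately show "\<bar>D' t\<bar> \<le> 2 * \<bar>a\<bar> * D t" by (simp only:)
  qed (use assms in \<open>auto simp: D_def\<close>)
  then show ?thesis by (simp add: D_def)
qed

lemma cis_eq_iff: "cis x = cis y \<longleftrightarrow> (\<exists>n::int. x = y + 2 * pi * of_int n)"
  using sin_cos_eq_iff[of x y] by (auto simp: complex_eq_iff)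

lemma cis_flow_unique:
  assumes "josephson_solution l a s \<theta>" "josephson_solution l a s \<eta>" "cis (\<theta> 0) = cis (\<eta> 0)"
  shows "cis (\<theta> (2 * pi)) = cis (\<eta> (2 * pi))"
proof -
  obtain n :: int where n: "\<theta> 0 = \<eta> 0 + 2 * pi * of_int n" using assms(3) by (auto simp: cis_eq_iff)
  define \<zeta> where "\<zeta> t = \<eta> t + 2 * pi * of_int n" for t
  have "cos (\<zeta> t) = cos (\<eta> t)" for t using sin_cos_eq_iff[of "\<zeta> t" "\<eta> t"] by (auto simp: \<zeta>_def)
  then have "josephson_solution l a s \<zeta>"
    using assms(2) unfolding josephson_solution_def \<zeta>_def by (auto intro!: derivative_eq_intros)
  then have "\<theta> (2 * pi) = \<zeta> (2 * pi)"
    using josephson_solution_unique[OF assms(1)] n by (auto simp: \<zeta>_def)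
  then show ?thesis by (auto simp: cis_eq_iff \<zeta>_def)
qed

lemma flow_map_eq:
  assumes "josephson_solution l a s \<theta>"
  shows "flow_map l a s (cis (\<theta> 0)) = cis (\<theta> (2 * pi))"
  unfolding flow_map_def by (rule the_equality) (use assms cis_flow_unique in blast)+

text \<open>The description operator yields one and the same value for all arguments without a
  solution, so a flow map equal to the identity has a solution for all initial values but one.\<close>

lemma flow_map_id_solutions:
  assumes "\<And>z. z \<in> sphere 0 1 \<Longrightarrow> flow_map l a s z = z"
  shows "\<exists>c. \<forall>z\<in>sphere 0 1 - {c}. \<exists>\<theta>. josephson_solution l a s \<theta> \<and> cis (\<theta> 0) = z \<and> cis (\<theta> (2 * pi)) = z"
proof (rule exI[of _ "THE w. False"], rule ballI)
  fix z :: complex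
  assume z: "z \<in> sphere 0 1 - {THE w. False}"
  show "\<exists>\<theta>. josephson_solution l a s \<theta> \<and> cis (\<theta> 0) = z \<and> cis (\<theta> (2 * pi)) = z"
  proof (cases "\<exists>\<theta>. josephson_solution l a s \<theta> \<and> cis (\<theta> 0) = z")
    case True
    then show ?thesis using flow_map_eq assms z by (metis DiffD1)
  next
    case False
    then have "(\<lambda>w. \<exists>\<theta>. josephson_solution l a s \<theta> \<and> cis (\<theta> 0) = z \<and> w = cis (\<theta> (2 * pi))) = (\<lambda>w. False)"
      by blast
    then have "flow_map l a s z = (THE w. False)" unfolding flow_map_def by simp
    then show ?thesis using assms z by auto
  qed
qed

text \<open>Reversal negates the right-hand side; the shift of the angle by pi restores the sign of
  the \<open>a\<close> term, so only \<open>l\<close> and \<open>s\<close> change sign.\<close>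

lemma josephson_solution_reverse:
  assumes "josephson_solution l a s \<theta>"
  shows "josephson_solution (- l) a (- s) (\<lambda>t. \<theta> (2 * pi - t) + pi)"
  unfolding josephson_solution_def
proof
  fix t :: real assume t: "t \<in> {0..2 * pi}"
  have im: "(\<lambda>t. 2 * pi - t) ` {0..2 * pi} = {0..2 * pi}"
    by (auto simp: image_iff intro: bexI[of _ "2 * pi - _"])
  have "(\<theta> has_real_derivative a * cos (\<theta> (2 * pi - t)) + of_int l + s * cos (2 * pi - t))
    (at (2 * pi - t) within (\<lambda>t. 2 * pi - t) ` {0..2 * pi})"
    using assms t unfolding im josephson_solution_def by (elim ballE[of _ _ "2 * pi - t"]) auto
  moreover have "((\<lambda>t. 2 * pi - t) has_real_derivative - 1) (at t within {0..2 * pi})"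
    by (auto intro!: derivative_eq_intros)
  ultimately have "((\<theta> \<circ> (\<lambda>t. 2 * pi - t)) has_real_derivative
    (a * cos (\<theta> (2 * pi - t)) + of_int l + s * cos (2 * pi - t)) * - 1) (at t within {0..2 * pi})"
    by (rule DERIV_image_chain)
  then show "((\<lambda>t. \<theta> (2 * pi - t) + pi) has_real_derivative
    a * cos (\<theta> (2 * pi - t) + pi) + of_int (- l) + - s * cos t) (at t within {0..2 * pi})"
    by (auto simp: o_def intro!: derivative_eq_intros)
qed

text \<open>A linearisation of the Riccati equation for exp(i theta) = u / v. The common scaling of
  u and v is chosen so that the second equation has no v term; on Fourier modes v is then eliminated
  by one division.\<close>

definition lin_sys :: "int \<Rightarrow> real \<Rightarrow> real \<Rightarrow> (real \<Rightarrow> complex) \<Rightarrow> (real \<Rightarrow> complex) \<Rightarrow> bool" where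
  "lin_sys l a s u v \<longleftrightarrow> (\<forall>t\<in>{0..2*pi}.
     (u has_vector_derivative \<i> * of_real (of_int l + s * cos t) * u t + \<i> * of_real (a / 2) * v t)
       (at t within {0..2*pi}) \<and>
     (v has_vector_derivative - (\<i> * of_real (a / 2) * u t)) (at t within {0..2*pi}))"

lemma has_vector_derivative_exp_compose:
  assumes "(f has_vector_derivative f') (at t within S)"
  shows "((\<lambda>t. exp (f t)) has_vector_derivative f' * exp (f t :: complex)) (at t within S)"
  using field_vector_diff_chain_within[OF assms, of exp "exp (f t)"] DERIV_exp[THEN DERIV_subset]
  by (auto simp: o_def)

lemma lin_sys_continuous:
  assumes "lin_sys l a s u v"
  shows "continuous_on {0..2*pi} u" "continuous_on {0..2*pi} v"
  using assms unfolding lin_sys_def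
  by (auto intro!: continuous_on_vector_derivative)

lemma lin_sys_combination:
  assumes "lin_sys l a s u v" "lin_sys l a s u' v'"
  shows "lin_sys l a s (\<lambda>t. \<alpha> * u t + \<beta> * u' t) (\<lambda>t. \<alpha> * v t + \<beta> * v' t)"
  unfolding lin_sys_def
proof (intro ballI conjI)
  fix t :: real assume "t \<in> {0..2 * pi}"
  then have d: "(u has_vector_derivative \<i> * of_real (of_int l + s * cos t) * u t + \<i> * of_real (a / 2) * v t) (at t within {0..2*pi})"
     "(v has_vector_derivative - (\<i> * of_real (a / 2) * u t)) (at t within {0..2*pi})"
     "(u' has_vector_derivative \<i> * of_real (of_int l + s * cos t) * u' t + \<i> * of_real (a / 2) * v' t) (at t within {0..2*pi})"
     "(v' has_vector_derivative - (\<i> * of_real (a / 2) * u' t)) (at t within {0..2*pi})"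
    using assms by (auto simp: lin_sys_def)
  show "((\<lambda>t. \<alpha> * u t + \<beta> * u' t) has_vector_derivative \<i> * of_real (of_int l + s * cos t) * (\<alpha> * u t + \<beta> * u' t)
      + \<i> * of_real (a / 2) * (\<alpha> * v t + \<beta> * v' t)) (at t within {0..2*pi})"
    by (rule has_vector_derivative_eq_rhs,
        rule has_vector_derivative_add[OF has_vector_derivative_mult_right has_vector_derivative_mult_right], rule d, rule d)
      (simp add: algebra_simps)
  show "((\<lambda>t. \<alpha> * v t + \<beta> * v' t) has_vector_derivative - (\<i> * of_real (a / 2) * (\<alpha> * u t + \<beta> * u' t)))
    (at t within {0..2*pi})"
    by (rule has_vector_derivative_eq_rhs,
        rule has_vector_derivative_add[OF has_vector_derivative_mult_right has_vector_derivative_mult_right], rule d, rule d)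
      (simp add: algebra_simps)
qed

text \<open>With \<open>R = exp (\<integral> (a/2) sin \<theta>)\<close> and \<open>g = (l t + s sin t) / 2\<close>, the pair
  \<open>u = R exp (\<i> (g + \<theta>/2))\<close>, \<open>v = R exp (\<i> (g - \<theta>/2))\<close> solves the linear system
  and has \<open>u / v = exp (\<i> \<theta>)\<close>.\<close>

lemma josephson_lin_sys:
  assumes sol: "josephson_solution l a s \<theta>" and per: "cis (\<theta> (2 * pi)) = cis (\<theta> 0)"
  obtains u v and \<nu> :: real where "lin_sys l a s u v" "u 0 = cis (\<theta> 0 / 2)" "v 0 = cis (- \<theta> 0 / 2)"
    "u (2 * pi) = of_real \<nu> * u 0" "v (2 * pi) = of_real \<nu> * v 0"
proof -
  let ?I = "{0..2 * pi}"
  have d\<theta>: "(\<theta> has_real_derivative (a * cos (\<theta> t) + of_int l + s * cos t)) (at t within ?I)" if "t \<in> ?I" for t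
    using sol that by (auto simp: josephson_solution_def)
  have c\<theta>: "continuous_on ?I \<theta>" using d\<theta> by (rule DERIV_continuous_on)
  define r where "r t = integral {0..t} (\<lambda>t. a / 2 * sin (\<theta> t))" for t
  have dr: "(r has_real_derivative a / 2 * sin (\<theta> t)) (at t within ?I)" if "t \<in> ?I" for t
    unfolding r_def by (rule integral_has_real_derivative[OF _ that]) (intro continuous_intros c\<theta>)
  have r0: "r 0 = 0" by (simp add: r_def)
  define g where "g t = (of_int l * t + s * sin t) / 2" for t
  define w where "w \<sigma> t = exp (of_real (r t) + \<i> * of_real (g t + \<sigma> * \<theta> t / 2))" for \<sigma> t
  define u where "u = w 1"
  define v where "v = w (- 1)"
  have "lin_sys l a s u v"
    unfolding lin_sys_def
  proof (intro ballI conjI)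
    fix t assume t: "t \<in> ?I"
    define G where "G = (of_int l + s * cos t) / 2"
    define A where "A \<sigma> = of_real (a / 2 * sin (\<theta> t)) + \<i> * of_real (G + \<sigma> * (a * cos (\<theta> t) + of_int l + s * cos t) / 2)" for \<sigma>
    have dw: "(w \<sigma> has_vector_derivative A \<sigma> * w \<sigma> t) (at t within ?I)" for \<sigma>
    proof -
      have "((\<lambda>t. g t + \<sigma> * \<theta> t / 2) has_real_derivative G + \<sigma> * (a * cos (\<theta> t) + of_int l + s * cos t) / 2) (at t within ?I)"
        unfolding g_def G_def by (rule derivative_eq_intros d\<theta>[OF t] refl | simp)+
      then show ?thesis unfolding w_def A_def
        by (intro has_vector_derivative_exp_compose has_vector_derivative_add has_vector_derivative_mult_right
            has_vector_derivative_of_real dr t)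
    qed
    have uv: "v t = cis (- \<theta> t) * u t" "u t = cis (\<theta> t) * v t"
      unfolding u_def v_def w_def cis_conv_exp exp_add[symmetric] by (simp_all add: algebra_simps)
    have A: "A 1 = \<i> * of_real (of_int l + s * cos t) + \<i> * of_real (a / 2) * cis (- \<theta> t)"
      "A (- 1) = - (\<i> * of_real (a / 2) * cis (\<theta> t))"
      by (simp_all add: complex_eq_iff A_def G_def field_simps)
    have Au: "A 1 * u t = \<i> * of_real (of_int l + s * cos t) * u t + \<i> * of_real (a / 2) * v t"
      unfolding A uv(1) by (simp only: distrib_right mult.assoc)
    have Av: "A (- 1) * v t = - (\<i> * of_real (a / 2) * u t)"
      unfolding A uv(2) by (simp only: mult_minus_left mult.assoc)
    show "(u has_vector_derivative \<i> * of_real (of_int l + s * cos t) * u t + \<i> * of_real (a / 2) * v t) (at t within ?I)"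
      using dw[of 1] unfolding u_def[symmetric] Au .
    show "(v has_vector_derivative - (\<i> * of_real (a / 2) * u t)) (at t within ?I)"
      using dw[of "- 1"] unfolding v_def[symmetric] Av .
  qed
  moreover have u0: "u 0 = cis (\<theta> 0 / 2)" and v0: "v 0 = cis (- \<theta> 0 / 2)"
    unfolding u_def v_def w_def r0 g_def cis_conv_exp by auto
  moreover obtain k :: int where k: "\<theta> (2 * pi) = \<theta> 0 + 2 * pi * of_int k"
    using per by (auto simp: cis_eq_iff)
  \<comment> \<open>Over a period the half angle advances by pi k and g by pi l, so the phase factor
    is the sign (-1)^(l+k); for v it is (-1)^(l-k), the same.\<close>
  define \<nu> where "\<nu> = exp (r (2 * pi)) * cos (pi * of_int (l + k))"
  have ci: "cis (pi * of_int n) = of_real (cos (pi * of_int n))" for n :: int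
    by (simp add: complex_eq_iff)
  have wc: "w \<sigma> t = of_real (exp (r t)) * cis (g t + \<sigma> * \<theta> t / 2)" for \<sigma> t
    by (simp add: w_def exp_add cis_conv_exp exp_of_real)
  have g2: "g (2 * pi) = pi * of_int l" by (simp add: g_def)
  have "u (2 * pi) = of_real \<nu> * u 0"
  proof -
    have "u (2 * pi) = of_real (exp (r (2 * pi))) * (cis (pi * of_int (l + k)) * cis (\<theta> 0 / 2))"
      unfolding u_def wc g2 k cis_mult by (simp add: field_simps)
    then show ?thesis unfolding ci u0 \<nu>_def by simp
  qed
  moreover have "v (2 * pi) = of_real \<nu> * v 0"
  proof -
    have "v (2 * pi) = of_real (exp (r (2 * pi))) * (cis (pi * of_int (l - k)) * cis (- \<theta> 0 / 2))"
      unfolding v_def wc g2 k cis_mult by (simp add: field_simps)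
    moreover have "cis (pi * of_int (l - k)) = cis (pi * of_int (l + k))"
      unfolding cis_eq_iff by (intro exI[of _ "-k"]) (simp add: algebra_simps)
    ultimately show ?thesis unfolding ci v0 \<nu>_def by simp
  qed
  ultimately show ?thesis using that by blast
qed

text \<open>Liouville's formula: the trace i (l + s cos t) has integral 2 pi i l over a period, so
  the monodromy has determinant 1.\<close>

lemma wronskian_periodic:
  assumes "lin_sys l a s u v" "lin_sys l a s u' v'"
  shows "u (2 * pi) * v' (2 * pi) - u' (2 * pi) * v (2 * pi) = u 0 * v' 0 - u' 0 * v 0"
proof -
  define f where "f t = (u t * v' t - u' t * v t) * exp (- (\<i> * of_real (of_int l * t + s * sin t)))" for t
  have "(f has_vector_derivative 0) (at t within {0..2*pi})" if "t \<in> {0..2*pi}" for t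
  proof -
    have d: "(u has_vector_derivative \<i> * of_real (of_int l + s * cos t) * u t + \<i> * of_real (a / 2) * v t) (at t within {0..2*pi})"
     "(v has_vector_derivative - (\<i> * of_real (a / 2) * u t)) (at t within {0..2*pi})"
     "(u' has_vector_derivative \<i> * of_real (of_int l + s * cos t) * u' t + \<i> * of_real (a / 2) * v' t) (at t within {0..2*pi})"
     "(v' has_vector_derivative - (\<i> * of_real (a / 2) * u' t)) (at t within {0..2*pi})"
      using assms that by (auto simp: lin_sys_def)
    have "((\<lambda>t. of_int l * t + s * sin t) has_real_derivative of_int l + s * cos t) (at t within {0..2*pi})"
      by (auto intro!: derivative_eq_intros)
    then have e: "((\<lambda>t. - (\<i> * complex_of_real (of_int l * t + s * sin t))) has_vector_derivative
      - (\<i> * of_real (of_int l + s * cos t))) (at t within {0..2*pi})"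
      by (intro has_vector_derivative_minus has_vector_derivative_mult_right has_vector_derivative_of_real)
    show ?thesis unfolding f_def
      by (rule has_vector_derivative_eq_rhs,
          rule has_vector_derivative_mult[OF has_vector_derivative_diff[OF has_vector_derivative_mult[OF d(1) d(4)]
            has_vector_derivative_mult[OF d(3) d(2)]] has_vector_derivative_exp_compose[OF e]])
        (simp add: algebra_simps)
  qed
  then obtain c where c: "\<And>t. t \<in> {0..2*pi} \<Longrightarrow> f t = c"
    using has_vector_derivative_zero_constant[of "{0..2*pi}" f] by (auto simp: convex_real_interval)
  have "exp (- (\<i> * complex_of_real (of_int l * (2 * pi)))) = cis (- (2 * pi * of_int l))"
    by (simp add: cis_conv_exp mult_ac)
  also have "\<dots> = 1" using cis_eq_iff[of "- (2 * pi * of_int l)" 0] by (auto intro: exI[of _ "- l"])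
  finally have "exp (- (\<i> * complex_of_real (of_int l * (2 * pi)))) = 1" .
  then show ?thesis using c[of 0] c[of "2 * pi"] unfolding f_def by simp
qed

section \<open>Fourier coefficients of periodic solutions\<close>

text \<open>The shift h adapts the modes to functions with multiplier
  \<open>cis (2 * pi * h)\<close>: h = 0 serves periodic and h = 1/2 antiperiodic solutions. There
  is no factor 1/(2 pi).\<close>

definition fcoeff :: "real \<Rightarrow> (real \<Rightarrow> complex) \<Rightarrow> int \<Rightarrow> complex" where
  "fcoeff h f n = integral {0..2*pi} (\<lambda>t. f t * cis (- (of_int n + h) * t))"

lemma fcoeff_combination:
  assumes "continuous_on {0..2*pi} f" "continuous_on {0..2*pi} g"
  shows "fcoeff h (\<lambda>t. \<alpha> * f t + \<beta> * g t) n = \<alpha> * fcoeff h f n + \<beta> * fcoeff h g n"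
proof -
  have "fcoeff h (\<lambda>t. \<alpha> * f t + \<beta> * g t) n
    = integral {0..2*pi} (\<lambda>t. \<alpha> * (f t * cis (- (of_int n + h) * t)) + \<beta> * (g t * cis (- (of_int n + h) * t)))"
    unfolding fcoeff_def by (simp add: algebra_simps)
  also have "\<dots> = \<alpha> * fcoeff h f n + \<beta> * fcoeff h g n"
    unfolding fcoeff_def
    by (subst integral_add) (auto intro!: integrable_continuous_real continuous_intros assms)
  finally show ?thesis .
qed

lemma fcoeff_cos:
  assumes "continuous_on {0..2*pi} f"
  shows "fcoeff h (\<lambda>t. of_real (cos t) * f t) n = (fcoeff h f (n - 1) + fcoeff h f (n + 1)) / 2"
proof -
  have "(\<lambda>t. of_real (cos t) * f t * cis (- (of_int n + h) * t))
    = (\<lambda>t. 1/2 * (f t * cis (- (of_int (n - 1) + h) * t)) + 1/2 * (f t * cis (- (of_int (n + 1) + h) * t)))"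
  proof
    fix t
    have c: "complex_of_real (cos t) = (cis t + cis (- t)) / 2" by (simp add: complex_eq_iff)
    have "of_real (cos t) * cis (- (of_int n + h) * t) = (cis (- (of_int n + h) * t + t) + cis (- (of_int n + h) * t + - t)) / 2"
      unfolding c cis_mult[symmetric] by (simp add: algebra_simps)
    also have "- (of_int n + h) * t + t = - (of_int (n - 1) + h) * t" by (simp add: algebra_simps)
    also have "- (of_int n + h) * t + - t = - (of_int (n + 1) + h) * t" by (simp add: algebra_simps)
    finally have "of_real (cos t) * f t * cis (- (of_int n + h) * t)
      = f t * ((cis (- (of_int (n - 1) + h) * t) + cis (- (of_int (n + 1) + h) * t)) / 2)"
      by (simp only: mult_ac)
    moreover have "F * ((A + B) / 2) = 1/2 * (F * A) + 1/2 * (F * B)" for F A B :: complex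
      by (simp add: field_simps)
    ultimately show "of_real (cos t) * f t * cis (- (of_int n + h) * t)
      = 1/2 * (f t * cis (- (of_int (n - 1) + h) * t)) + 1/2 * (f t * cis (- (of_int (n + 1) + h) * t))"
      by (simp only:)
  qed
  then show ?thesis unfolding fcoeff_def
    by (simp only:) (subst integral_add; (intro integrable_continuous_real continuous_intros assms)?; simp add: add_divide_distrib)
qed

lemma fcoeff_sin:
  assumes "continuous_on {0..2*pi} f"
  shows "fcoeff h (\<lambda>t. of_real (sin t) * f t) n = (fcoeff h f (n - 1) - fcoeff h f (n + 1)) / (2 * \<i>)"
proof -
  define \<kappa> where "\<kappa> = 1 / (2 * \<i>)"
  have "(\<lambda>t. of_real (sin t) * f t * cis (- (of_int n + h) * t))
    = (\<lambda>t. \<kappa> * (f t * cis (- (of_int (n - 1) + h) * t)) - \<kappa> * (f t * cis (- (of_int (n + 1) + h) * t)))"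
  proof
    fix t
    have c: "complex_of_real (sin t) = (cis t - cis (- t)) / (2 * \<i>)" by (simp add: complex_eq_iff)
    have "of_real (sin t) * cis (- (of_int n + h) * t) = (cis (- (of_int n + h) * t + t) - cis (- (of_int n + h) * t + - t)) / (2 * \<i>)"
      unfolding c cis_mult[symmetric] by (simp add: algebra_simps)
    also have "- (of_int n + h) * t + t = - (of_int (n - 1) + h) * t" by (simp add: algebra_simps)
    also have "- (of_int n + h) * t + - t = - (of_int (n + 1) + h) * t" by (simp add: algebra_simps)
    finally have "of_real (sin t) * f t * cis (- (of_int n + h) * t)
      = f t * ((cis (- (of_int (n - 1) + h) * t) - cis (- (of_int (n + 1) + h) * t)) / (2 * \<i>))"
      by (simp only: mult_ac)
    moreover have "F * ((A - B) / (2 * \<i>)) = \<kappa> * (F * A) - \<kappa> * (F * B)" for F A B :: complex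
      by (simp add: \<kappa>_def field_simps)
    ultimately show "of_real (sin t) * f t * cis (- (of_int n + h) * t)
      = \<kappa> * (f t * cis (- (of_int (n - 1) + h) * t)) - \<kappa> * (f t * cis (- (of_int (n + 1) + h) * t))"
      by (simp only:)
  qed
  then have "fcoeff h (\<lambda>t. of_real (sin t) * f t) n = \<kappa> * fcoeff h f (n - 1) - \<kappa> * fcoeff h f (n + 1)"
    unfolding fcoeff_def
    by (simp only:) (subst integral_diff; (intro integrable_continuous_real continuous_intros assms)?; simp)
  then show ?thesis by (simp add: \<kappa>_def field_simps)
qed

section \<open>Functions with vanishing Fourier coefficients\<close>

lemma real_polynomial_function_fcoeff_zero:
  fixes p :: "complex \<Rightarrow> real"
  assumes "real_polynomial_function p"
  shows "continuous_on {0..2*pi} f \<Longrightarrow> (\<forall>n. fcoeff 0 f n = 0) \<Longrightarrow>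
    continuous_on {0..2*pi} (\<lambda>t. of_real (p (cis t)) * f t) \<and>
    (\<forall>n. fcoeff 0 (\<lambda>t. of_real (p (cis t)) * f t) n = 0)"
  using assms
proof (induction arbitrary: f rule: real_polynomial_function.induct)
  case (linear p)
  \<comment> \<open>On the circle a linear form is a combination of cos t and sin t, and
    multiplication by these only mixes neighbouring modes.\<close>
  have p: "p (cis t) = p 1 * cos t + p \<i> * sin t" for t
  proof -
    have "cis t = cos t *\<^sub>R 1 + sin t *\<^sub>R \<i>" by (simp add: complex_eq_iff)
    then have "p (cis t) = p (cos t *\<^sub>R 1 + sin t *\<^sub>R \<i>)" by simp
    also have "\<dots> = cos t *\<^sub>R p 1 + sin t *\<^sub>R p \<i>"
      using linear.hyps by (simp only: bounded_linear.linear linear_add linear_scale)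
    finally show ?thesis by simp
  qed
  have c: "continuous_on {0..2*pi} (\<lambda>t. of_real (cos t) * f t)" "continuous_on {0..2*pi} (\<lambda>t. of_real (sin t) * f t)"
    by (intro continuous_intros linear.prems)+
  have eq: "(\<lambda>t. of_real (p (cis t)) * f t) = (\<lambda>t. of_real (p 1) * (of_real (cos t) * f t) + of_real (p \<i>) * (of_real (sin t) * f t))"
    by (simp add: p algebra_simps)
  show ?case unfolding eq fcoeff_combination[OF c] fcoeff_cos[OF linear.prems(1)] fcoeff_sin[OF linear.prems(1)]
    using linear.prems(2) by (auto intro!: continuous_intros linear.prems(1))
next
  case (const c)
  have "fcoeff 0 (\<lambda>t. of_real c * f t) n = 0" for n
    using fcoeff_combination[OF const(1) const(1), of 0 "of_real c" 0 n] const(2) by simp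
  then show ?case using const by (auto intro!: continuous_intros)
next
  case (add p q)
  have 1: "continuous_on {0..2*pi} (\<lambda>t. of_real (p (cis t)) * f t)" "\<forall>n. fcoeff 0 (\<lambda>t. of_real (p (cis t)) * f t) n = 0"
    and 2: "continuous_on {0..2*pi} (\<lambda>t. of_real (q (cis t)) * f t)" "\<forall>n. fcoeff 0 (\<lambda>t. of_real (q (cis t)) * f t) n = 0"
    using add.IH add.prems by auto
  show ?case
    using fcoeff_combination[OF 1(1) 2(1), of 0 1 1] 1 2 by (auto simp: distrib_right intro!: continuous_intros)
next
  case (mult p q)
  have "continuous_on {0..2*pi} (\<lambda>t. of_real (q (cis t)) * f t)" "\<forall>n. fcoeff 0 (\<lambda>t. of_real (q (cis t)) * f t) n = 0"
    using mult.IH mult.prems by auto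
  from mult.IH(1)[OF this] show ?case by (simp add: mult.assoc)
qed

text \<open>As f may take different values at the two ends, it is no function on the circle;
  Stone-Weierstrass is applied to the test function instead.\<close>

lemma fcoeff_zero_test:
  fixes \<phi> :: "complex \<Rightarrow> real"
  assumes f: "continuous_on {0..2*pi} f" and z: "\<And>n. fcoeff 0 f n = 0" and \<phi>: "continuous_on (sphere 0 1) \<phi>"
  shows "integral {0..2*pi} (\<lambda>t. of_real (\<phi> (cis t)) * f t) = 0"
proof -
  have c\<phi>: "continuous_on {0..2*pi} (\<lambda>t. \<phi> (cis t))"
    by (rule continuous_on_compose2[OF \<phi>]) (auto intro!: continuous_intros)
  obtain M where M: "M > 0" "\<And>t. t \<in> {0..2*pi} \<Longrightarrow> cmod (f t) \<le> M"
    using compact_imp_bounded[OF compact_continuous_image[OF f compact_Icc]]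
    by (auto simp: bounded_pos)
  have le: "cmod (integral {0..2*pi} (\<lambda>t. of_real (\<phi> (cis t)) * f t)) \<le> e * (M * (2 * pi))" if e: "e > 0" for e
  proof -
    obtain p where p: "real_polynomial_function p" "\<And>x. x \<in> sphere 0 1 \<Longrightarrow> \<bar>\<phi> x - p x\<bar> < e"
      using Stone_Weierstrass_real_polynomial_function[OF compact_sphere \<phi> e] by blast
    note P = real_polynomial_function_fcoeff_zero[OF p(1) f]
    have Pc: "continuous_on {0..2*pi} (\<lambda>t. of_real (p (cis t)) * f t)"
      and P0: "integral {0..2*pi} (\<lambda>t. of_real (p (cis t)) * f t) = 0"
      using P z unfolding fcoeff_def by (auto dest: spec[of _ 0])
    have "integral {0..2*pi} (\<lambda>t. of_real (\<phi> (cis t)) * f t)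
      = integral {0..2*pi} (\<lambda>t. of_real (\<phi> (cis t)) * f t) - integral {0..2*pi} (\<lambda>t. of_real (p (cis t)) * f t)"
      using P0 by simp
    also have "\<dots> = integral {0..2*pi} (\<lambda>t. of_real (\<phi> (cis t)) * f t - of_real (p (cis t)) * f t)"
      by (rule integral_diff[symmetric]) (auto intro!: integrable_continuous_real continuous_intros c\<phi> f Pc)
    also have "cmod \<dots> \<le> e * M * (2 * pi - 0)"
    proof (rule integral_bound)
      show "continuous_on {0..2*pi} (\<lambda>t. of_real (\<phi> (cis t)) * f t - of_real (p (cis t)) * f t)"
        by (intro continuous_intros c\<phi> f Pc)
      fix t assume t: "t \<in> {0..2*pi}"
      have "\<bar>\<phi> (cis t) - p (cis t)\<bar> * cmod (f t) \<le> e * M"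
        using p(2)[of "cis t"] M(2)[OF t] e by (intro mult_mono) auto
      then show "cmod (of_real (\<phi> (cis t)) * f t - of_real (p (cis t)) * f t) \<le> e * M"
        unfolding left_diff_distrib[symmetric] norm_mult of_real_diff[symmetric] norm_of_real .
    qed auto
    finally show ?thesis by (simp add: mult_ac)
  qed
  have "cmod (integral {0..2*pi} (\<lambda>t. of_real (\<phi> (cis t)) * f t)) \<le> 0"
  proof (rule field_le_epsilon)
    fix e :: real assume "e > 0"
    then show "cmod (integral {0..2*pi} (\<lambda>t. of_real (\<phi> (cis t)) * f t)) \<le> 0 + e"
      using le[of "e / (M * (2 * pi))"] M(1) by simp
  qed
  then show ?thesis by simp
qed

text \<open>A bump around \<open>cis \<tau>\<close> tests f where
  \<open>cnj (f \<tau>) * f t\<close> has positive real part. The ends of the interval are one point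
  of the circle at which f may have two values, hence the open interval.\<close>

lemma fcoeff_zero_imp_zero_interior:
  assumes f: "continuous_on {0..2*pi} f" and z: "\<And>n. fcoeff 0 f n = 0" and \<tau>: "0 < \<tau>" "\<tau> < 2 * pi"
  shows "f \<tau> = 0"
proof (rule ccontr)
  assume nz: "f \<tau> \<noteq> 0"
  define w where "w t = Re (cnj (f \<tau>) * f t)" for t
  have cw: "continuous_on {0..2*pi} w" unfolding w_def by (intro continuous_intros f)
  have "cnj (f \<tau>) * f \<tau> = of_real ((cmod (f \<tau>))\<^sup>2)" 
    unfolding complex_norm_square by (rule mult.commute)
  then have w\<tau>: "w \<tau> > 0" using nz by (simp add: w_def)
  obtain \<delta> where \<delta>: "\<delta> > 0" "\<And>t. t \<in> {0..2*pi} \<Longrightarrow> \<bar>t - \<tau>\<bar> < \<delta> \<Longrightarrow> w t > 0"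
  proof -
    obtain d where "d > 0" "\<And>t. t \<in> {0..2*pi} \<Longrightarrow> dist t \<tau> < d \<Longrightarrow> dist (w t) (w \<tau>) < w \<tau>"
      using cw w\<tau> \<tau> unfolding continuous_on_iff by (metis atLeastAtMost_iff less_imp_le)
    then show ?thesis using that[of d] by (fastforce simp: dist_real_def)
  qed
  define S where "S = {0..2*pi} - {\<tau> - \<delta><..<\<tau> + \<delta>}"
  have "compact S" unfolding S_def by (intro compact_diff) auto
  obtain r where r: "r > 0" "\<And>t. t \<in> S \<Longrightarrow> cmod (cis t - cis \<tau>) \<ge> r"
  proof (cases "S = {}")
    case True
    then show ?thesis using that[of 1] by auto
  next
    case False
    have "continuous_on S (\<lambda>t. cmod (cis t - cis \<tau>))" by (intro continuous_intros)
    then obtain t0 where t0: "t0 \<in> S" "\<And>t. t \<in> S \<Longrightarrow> cmod (cis t0 - cis \<tau>) \<le> cmod (cis t - cis \<tau>)"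
      using continuous_attains_inf[OF \<open>compact S\<close> False] by blast
    have "cis t0 \<noteq> cis \<tau>"
    proof
      assume "cis t0 = cis \<tau>"
      then obtain n :: int where n: "t0 = \<tau> + 2 * pi * of_int n" by (auto simp: cis_eq_iff)
      have "\<bar>t0 - \<tau>\<bar> < 2 * pi" using t0(1) \<tau> by (auto simp: S_def)
      then have "2 * pi * \<bar>of_int n\<bar> < 2 * pi * 1" unfolding n by (simp add: abs_mult)
      then have "\<bar>real_of_int n\<bar> < 1"
        using mult_less_cancel_left_pos[of "2 * pi" "\<bar>real_of_int n\<bar>" 1] pi_gt_zero by simp
      then have "n = 0" by linarith
      then show False using t0(1) n \<delta>(1) by (auto simp: S_def)
    qed
    then show ?thesis using that[of "cmod (cis t0 - cis \<tau>)"] t0(2) by auto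
  qed
  define \<phi> where "\<phi> x = max 0 (r - cmod (x - cis \<tau>))" for x
  have c\<phi>: "continuous_on A \<phi>" for A unfolding \<phi>_def by (intro continuous_intros)
  have ci: "continuous_on {0..2*pi} (\<lambda>t. \<phi> (cis t) * w t)"
    by (intro continuous_intros cw continuous_on_compose2[OF c\<phi>[of UNIV]]) auto
  have "integral {0..2*pi} (\<lambda>t. \<phi> (cis t) * w t) = 0"
  proof -
    have c: "continuous_on {0..2*pi} (\<lambda>t. of_real (\<phi> (cis t)) * f t)"
      by (intro continuous_intros f continuous_on_compose2[OF c\<phi>[of UNIV]]) auto
    have "integral {0..2*pi} (\<lambda>t. \<phi> (cis t) * w t)
      = integral {0..2*pi} (\<lambda>t. Re (cnj (f \<tau>) * (of_real (\<phi> (cis t)) * f t)))"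
      by (simp add: w_def algebra_simps)
    also have "\<dots> = Re (integral {0..2*pi} (\<lambda>t. cnj (f \<tau>) * (of_real (\<phi> (cis t)) * f t)))"
      using integral_linear[OF integrable_continuous_real bounded_linear_Re,
          of 0 "2*pi" "\<lambda>t. cnj (f \<tau>) * (of_real (\<phi> (cis t)) * f t)"] c
      by (simp add: o_def continuous_on_mult_left)
    also have "\<dots> = Re (cnj (f \<tau>) * integral {0..2*pi} (\<lambda>t. of_real (\<phi> (cis t)) * f t))" by simp
    also have "\<dots> = 0" using fcoeff_zero_test[OF f z c\<phi>] by simp
    finally show ?thesis .
  qed
  moreover have "\<phi> (cis t) * w t \<ge> 0" if t: "t \<in> {0..2*pi}" for t
  proof (cases "\<bar>t - \<tau>\<bar> < \<delta>")
    case True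
    then show ?thesis using \<delta>(2)[OF t] by (simp add: \<phi>_def)
  next
    case False
    then have "t \<in> S" using t by (auto simp: S_def abs_if split: if_splits)
    then have "\<phi> (cis t) = 0" using r(2)[of t] by (simp add: \<phi>_def)
    then show ?thesis by simp
  qed
  ultimately have "\<forall>t\<in>{0..2*pi}. \<phi> (cis t) * w t = 0" using integral_eq_0_iff[OF ci] by auto
  then have "\<phi> (cis \<tau>) * w \<tau> = 0" using \<tau> by simp
  then show False using w\<tau> r(1) by (simp add: \<phi>_def)
qed

lemma fcoeff_zero_imp_zero:
  assumes f: "continuous_on {0..2*pi} f" and z: "\<And>n. fcoeff h f n = 0" and t: "t \<in> {0..2*pi}"
  shows "f t = 0"
proof -
  define g where "g t = f t * cis (- h * t)" for t
  have cg: "continuous_on {0..2*pi} g" unfolding g_def by (intro continuous_intros f)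
  have "g t * cis (- (of_int n + 0) * t) = f t * cis (- (of_int n + h) * t)" for n t
    unfolding g_def by (simp add: mult.assoc cis_mult algebra_simps)
  then have "fcoeff 0 g n = 0" for n using z[of n] unfolding fcoeff_def by simp
  then have i: "g t = 0" if "t \<in> {0<..<2*pi}" for t
    using fcoeff_zero_imp_zero_interior[OF cg] that by auto
  have "g t = 0"
  proof (rule continuous_constant_on_closure[of "{0<..<2*pi}" g 0 t])
    show "continuous_on (closure {0<..<2*pi}) g" "t \<in> closure {0<..<2*pi}" using cg t by auto
  qed (use i in auto)
  then show ?thesis by (simp add: g_def)
qed

lemma fcoeff_bound:
  assumes f: "continuous_on {0..2*pi} f"
  obtains B where "B > 0" "\<And>n. cmod (fcoeff h f n) \<le> B"
proof -
  obtain M where M: "M > 0" "\<And>t. t \<in> {0..2*pi} \<Longrightarrow> cmod (f t) \<le> M"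
    using compact_imp_bounded[OF compact_continuous_image[OF f compact_Icc]]
    by (auto simp: bounded_pos)
  have "cmod (fcoeff h f n) \<le> M * (2 * pi - 0)" for n unfolding fcoeff_def
    by (rule integral_bound) (auto intro!: continuous_intros f M(2) simp: norm_mult)
  then show ?thesis using that[of "M * (2 * pi)"] M(1) by auto
qed

lemma fcoeff_derivative:
  assumes d: "\<And>t. t \<in> {0..2*pi} \<Longrightarrow> (f has_vector_derivative f' t) (at t within {0..2*pi})"
    and per: "f (2 * pi) = cis (2 * pi * h) * f 0" and c: "continuous_on {0..2*pi} f'"
  shows "fcoeff h f' n = \<i> * (of_int n + of_real h) * fcoeff h f n"
proof -
  let ?e = "\<lambda>t. cis (- (of_int n + h) * t)"
  have cf: "continuous_on {0..2*pi} f" by (rule continuous_on_vector_derivative[OF d])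
  have de: "(?e has_vector_derivative - (\<i> * (of_int n + of_real h)) * ?e t) (at t within {0..2*pi})" for t
  proof -
    have "((\<lambda>t. - (of_int n + h) * t) has_real_derivative - (of_int n + h)) (at t within {0..2*pi})"
      by (auto intro!: derivative_eq_intros)
    then have "((\<lambda>t. \<i> * complex_of_real (- (of_int n + h) * t)) has_vector_derivative \<i> * of_real (- (of_int n + h)))
      (at t within {0..2*pi})"
      by (intro has_vector_derivative_mult_right has_vector_derivative_of_real)
    from has_vector_derivative_exp_compose[OF this] show ?thesis
      unfolding cis_conv_exp by (rule has_vector_derivative_eq_rhs) (simp add: algebra_simps)
  qed
  have "((\<lambda>t. f t * (- (\<i> * (of_int n + of_real h)) * ?e t) + f' t * ?e t) has_integral
      f (2 * pi) * ?e (2 * pi) - f 0 * ?e 0) {0..2*pi}"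
    by (intro fundamental_theorem_of_calculus has_vector_derivative_mult d de) auto
  moreover have "cis (2 * pi * h) * ?e (2 * pi) = 1"
    unfolding cis_mult using cis_eq_iff[of "2 * pi * h + - (of_int n + h) * (2 * pi)" 0]
    by (auto intro!: exI[of _ "- n"] simp: algebra_simps)
  then have "f (2 * pi) * ?e (2 * pi) - f 0 * ?e 0 = 0" unfolding per by (simp add: mult_ac)
  ultimately have "integral {0..2*pi} (\<lambda>t. f t * (- (\<i> * (of_int n + of_real h)) * ?e t) + f' t * ?e t) = 0"
    by (simp add: integral_unique)
  then have "integral {0..2*pi} (\<lambda>t. - (\<i> * (of_int n + of_real h)) * (f t * ?e t) + f' t * ?e t) = 0"
    by (simp add: mult_ac)
  then have "- (\<i> * (of_int n + of_real h)) * fcoeff h f n + fcoeff h f' n = 0"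
    unfolding fcoeff_def
    by (subst (asm) integral_add) (auto intro!: integrable_continuous_real continuous_intros cf c)
  then show ?thesis by (simp add: algebra_simps)
qed

section \<open>Fourier modes of the linear system\<close>

lemma lin_sys_fcoeff:
  assumes sys: "lin_sys l a s u v"
    and per: "u (2 * pi) = cis (2 * pi * h) * u 0" "v (2 * pi) = cis (2 * pi * h) * v 0"
  shows "(of_int n + of_real h) * fcoeff h v n = - of_real (a / 2) * fcoeff h u n"
    and "of_real (s / 2) * (fcoeff h u (n + 1) + fcoeff h u (n - 1))
      = (of_int n + of_real h - of_int l) * fcoeff h u n - of_real (a / 2) * fcoeff h v n"
proof -
  note c = lin_sys_continuous[OF sys]
  define u' where "u' t = \<i> * of_real (of_int l + s * cos t) * u t + \<i> * of_real (a / 2) * v t" for t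
  define v' where "v' t = - (\<i> * of_real (a / 2) * u t)" for t
  have d: "(u has_vector_derivative u' t) (at t within {0..2*pi})" "(v has_vector_derivative v' t) (at t within {0..2*pi})"
    if "t \<in> {0..2*pi}" for t
    using sys that unfolding lin_sys_def u'_def v'_def by auto
  have "fcoeff h v' n = - (\<i> * of_real (a / 2)) * fcoeff h u n"
    using fcoeff_combination[OF c(1) c(1), of h "- (\<i> * of_real (a / 2))" 0 n] unfolding v'_def by simp
  moreover have "fcoeff h v' n = \<i> * (of_int n + of_real h) * fcoeff h v n"
    by (rule fcoeff_derivative[OF d(2) per(2)]) (auto simp: v'_def intro!: continuous_intros c)
  ultimately have "\<i> * ((of_int n + of_real h) * fcoeff h v n) = \<i> * (- of_real (a / 2) * fcoeff h u n)"
    by (simp add: mult.assoc)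
  then show "(of_int n + of_real h) * fcoeff h v n = - of_real (a / 2) * fcoeff h u n"
    unfolding mult_cancel_left by simp
  have cc: "continuous_on {0..2*pi} (\<lambda>t. of_real (cos t) * u t)" by (intro continuous_intros c)
  have cl: "continuous_on {0..2*pi} (\<lambda>t. of_int l * u t + of_real s * (of_real (cos t) * u t))" by (intro continuous_intros c)
  have "u' = (\<lambda>t. \<i> * (of_int l * u t + of_real s * (of_real (cos t) * u t)) + \<i> * of_real (a / 2) * v t)"
    by (auto simp: u'_def algebra_simps)
  then have "fcoeff h u' n = \<i> * (of_int l * fcoeff h u n + of_real s * ((fcoeff h u (n - 1) + fcoeff h u (n + 1)) / 2))
      + \<i> * of_real (a / 2) * fcoeff h v n"
    by (simp only: fcoeff_combination[OF cl c(2)] fcoeff_combination[OF c(1) cc] fcoeff_cos[OF c(1)])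
  moreover have "fcoeff h u' n = \<i> * (of_int n + of_real h) * fcoeff h u n"
    by (rule fcoeff_derivative[OF d(1) per(1)]) (auto simp: u'_def intro!: continuous_intros c)
  ultimately have "\<i> * (of_int n + of_real h) * fcoeff h u n
    = \<i> * (of_int l * fcoeff h u n + of_real s * ((fcoeff h u (n - 1) + fcoeff h u (n + 1)) / 2))
      + \<i> * of_real (a / 2) * fcoeff h v n"
    by (rule trans[OF sym, rotated])
  then have "\<i> * ((of_int n + of_real h) * fcoeff h u n)
    = \<i> * ((of_int l * fcoeff h u n + of_real s * ((fcoeff h u (n - 1) + fcoeff h u (n + 1)) / 2))
      + of_real (a / 2) * fcoeff h v n)"
    by (simp only: mult.assoc distrib_left[symmetric])
  then have "(of_int n + of_real h) * fcoeff h u n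
    = (of_int l * fcoeff h u n + of_real s * ((fcoeff h u (n - 1) + fcoeff h u (n + 1)) / 2))
      + of_real (a / 2) * fcoeff h v n"
    unfolding mult_cancel_left by simp
  then show "of_real (s / 2) * (fcoeff h u (n + 1) + fcoeff h u (n - 1))
      = (of_int n + of_real h - of_int l) * fcoeff h u n - of_real (a / 2) * fcoeff h v n"
    by (simp add: algebra_simps)
qed

text \<open>All Fourier coefficients of a solution are determined by two consecutive ones.\<close>

lemma lin_sys_fcoeff_zero:
  assumes sys: "lin_sys l a s u v" and s: "s \<noteq> 0"
    and per: "u (2 * pi) = cis (2 * pi * h) * u 0" "v (2 * pi) = cis (2 * pi * h) * v 0"
    and z: "fcoeff h u 0 = 0" "fcoeff h u 1 = 0"
    and v0: "\<And>n. of_int n + of_real h = (0 :: complex) \<Longrightarrow> fcoeff h v n = 0"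
  shows "u 0 = 0 \<and> v 0 = 0"
proof -
  note F = lin_sys_fcoeff[OF sys per]
  \<comment> \<open>In the resonant case n + h = 0 the relation between the modes leaves that of v
    free, and \<open>v0\<close> settles it.\<close>
  have v: "fcoeff h v n = 0" if "fcoeff h u n = 0" for n
    using F(1)[of n] v0[of n] that by auto
  have step: "fcoeff h u (n + 1) + fcoeff h u (n - 1) = 0" if "fcoeff h u n = 0" for n
    using F(2)[of n] v[OF that] that s by simp
  have up: "fcoeff h u (int k) = 0 \<and> fcoeff h u (int k + 1) = 0" for k
  proof (induction k)
    case (Suc k)
    then show ?case using step[of "int k + 1"] by (simp add: add.commute add.left_commute)
  qed (use z in simp)
  have down: "fcoeff h u (- int k) = 0 \<and> fcoeff h u (1 - int k) = 0" for k
  proof (induction k)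
    case (Suc k)
    have e: "- int (Suc k) = - int k - 1" "1 - int (Suc k) = - int k" "- int k + 1 = 1 - int k" by auto
    show ?case unfolding e(1,2) using Suc step[of "- int k"] unfolding e(3) by simp
  qed (use z in simp)
  have uz: "fcoeff h u n = 0" for n
    using up[of "nat n"] down[of "nat (- n)"] by (cases "n \<ge> 0") auto
  have "u 0 = 0" by (rule fcoeff_zero_imp_zero[OF lin_sys_continuous(1)[OF sys] uz]) simp
  moreover have "v 0 = 0" by (rule fcoeff_zero_imp_zero[OF lin_sys_continuous(2)[OF sys] v[OF uz]]) simp
  ultimately show ?thesis ..
qed

lemma nontrivial_kernel:
  fixes a b c d :: "'a :: field"
  assumes "a * d - b * c = 0"
  obtains x y where "(x, y) \<noteq> (0, 0)" "x * a + y * b = 0" "x * c + y * d = 0"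
proof (cases "a = 0 \<and> b = 0")
  case True
  show ?thesis
  proof (cases "c = 0 \<and> d = 0")
    case False
    then show ?thesis using True by (intro that[of d "- c"]) auto
  qed (use True in \<open>intro that[of 1 0], auto\<close>)
next
  case False
  then show ?thesis using assms by (intro that[of b "- a"]) (auto simp: algebra_simps)
qed

text \<open>For multiplier 1, the mode n = 0 of the second equation gives u_0 = 0, so the modes u_n,
  n \<ge> 0, are a bounded multiple of \<open>rec_sol\<close>, nonzero for one of the two solutions.
  For multiplier -1 no mode is resonant, and two bounded solutions of a recurrence with growing
  coefficients have Casoratian 0, so a nontrivial combination vanishes, against
  independence.\<close>

lemma lin_sys_in_spec:
  assumes sys: "lin_sys l a s u v" "lin_sys l a s u' v'" and l: "l = - int m" and a: "a > 0" and s: "s \<noteq> 0"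
    and \<nu>: "\<nu> = 1 \<or> \<nu> = - 1"
    and per: "u (2 * pi) = \<nu> * u 0" "v (2 * pi) = \<nu> * v 0" "u' (2 * pi) = \<nu> * u' 0" "v' (2 * pi) = \<nu> * v' 0"
    and W: "u 0 * v' 0 - u' 0 * v 0 \<noteq> 0"
  shows "in_spec m (a\<^sup>2) s"
proof -
  define h :: real where "h = (if \<nu> = 1 then 0 else 1/2)"
  have h: "cis (2 * pi * h) = \<nu>" using \<nu> by (auto simp: h_def)
  note P = per[folded h]
  note F = lin_sys_fcoeff[OF sys(1) P(1,2)] and F' = lin_sys_fcoeff[OF sys(2) P(3,4)]
  note c = lin_sys_continuous[OF sys(1)] and c' = lin_sys_continuous[OF sys(2)]
  have no_zero: False
    if xy: "(x, y) \<noteq> (0, 0)" and z: "x * fcoeff h u 0 + y * fcoeff h u' 0 = 0" "x * fcoeff h u 1 + y * fcoeff h u' 1 = 0"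
      and v0: "\<And>n. of_int n + of_real h = (0 :: complex) \<Longrightarrow> x * fcoeff h v n + y * fcoeff h v' n = 0" for x y
  proof -
    have "x * u 0 + y * u' 0 = 0 \<and> x * v 0 + y * v' 0 = 0"
    proof (rule lin_sys_fcoeff_zero[OF lin_sys_combination[OF sys, of x y] s, of h])
      show "x * u (2 * pi) + y * u' (2 * pi) = cis (2 * pi * h) * (x * u 0 + y * u' 0)"
        "x * v (2 * pi) + y * v' (2 * pi) = cis (2 * pi * h) * (x * v 0 + y * v' 0)"
        unfolding P by (simp_all add: algebra_simps)
    qed (use z v0 in \<open>simp_all add: fcoeff_combination[OF c(1) c'(1)] fcoeff_combination[OF c(2) c'(2)]\<close>)
    then have e: "x * u 0 + y * u' 0 = 0" "x * v 0 + y * v' 0 = 0" by auto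
    have "x * (u 0 * v' 0 - u' 0 * v 0) = (x * u 0 + y * u' 0) * v' 0 - u' 0 * (x * v 0 + y * v' 0)"
      "y * (u 0 * v' 0 - u' 0 * v 0) = u 0 * (x * v 0 + y * v' 0) - (x * u 0 + y * u' 0) * v 0"
      by (simp_all add: algebra_simps)
    then have "x = 0" "y = 0" using W unfolding e by auto
    then show False using xy by simp
  qed
  define Q where "Q n = 2 / s * (of_int n + h + real m + a\<^sup>2 / (4 * (of_int n + h)))" for n :: int
  have rec: "fcoeff h f (n + 1) + fcoeff h f (n - 1) = of_real (Q n) * fcoeff h f n"
    if "of_int n + h \<noteq> 0" and "(f = u \<or> f = u')" for n f
  proof -
    have nz: "of_int n + of_real h \<noteq> (0 :: complex)"
      using that(1) by (metis of_real_add of_real_eq_0_iff of_real_of_int_eq)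
    note fu = that(2)
    obtain g where g: "(of_int n + of_real h) * fcoeff h g n = - of_real (a / 2) * fcoeff h f n"
      "of_real (s / 2) * (fcoeff h f (n + 1) + fcoeff h f (n - 1))
      = (of_int n + of_real h - of_int l) * fcoeff h f n - of_real (a / 2) * fcoeff h g n"
      using fu F F' by blast
    have g': "fcoeff h g n = - of_real (a / 2) * fcoeff h f n / (of_int n + of_real h)"
      unfolding nonzero_eq_divide_eq[OF nz] using g(1) by (simp only: mult.commute)
    have Q: "of_real (Q n) = 2 / of_real s * (of_int n + of_real h + of_nat m + (of_real a)\<^sup>2 / (4 * (of_int n + of_real h)) :: complex)"
      by (simp add: Q_def)
    have alg: "X = 2 / S * (N + M + A\<^sup>2 / (4 * N)) * E"
      if "S / 2 * X = (N + M) * E - A / 2 * (- (A / 2) * E / N)" "S \<noteq> 0" "N \<noteq> 0" for X S N M A E :: complex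
    proof -
      have "X = 2 / S * (S / 2 * X)" using that(2) by simp
      also have "\<dots> = 2 / S * (N + M + A\<^sup>2 / (4 * N)) * E"
        unfolding that(1) using that(2,3) by (simp add: power2_eq_square field_simps)
      finally show ?thesis .
    qed
    show ?thesis unfolding Q
      by (rule alg) (use g(2) s nz in \<open>simp_all add: g' l\<close>)
  qed
  obtain B where B: "B > 0" "\<And>n. cmod (fcoeff h u n) \<le> B" using fcoeff_bound[OF c(1)] by metis
  obtain B' where B': "B' > 0" "\<And>n. cmod (fcoeff h u' n) \<le> B'" using fcoeff_bound[OF c'(1)] by metis
  show ?thesis
  proof (cases "\<nu> = 1")
    case True
    then have h0: "h = 0" by (simp add: h_def)
    have E0: "fcoeff h u 0 = 0" "fcoeff h u' 0 = 0" using F(1)[of 0] F'(1)[of 0] a h0 by auto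
    have main: ?thesis if nz: "fcoeff h f 1 \<noteq> 0" and f0: "fcoeff h f 0 = 0" and fu: "f = u \<or> f = u'" for f
    proof -
      define e where "e n = fcoeff h f (int n)" for n
      have "e (Suc (Suc n)) = of_real (jcoef m (a\<^sup>2) s (Suc n)) * e (Suc n) - e n" for n
        using rec[of "int (Suc n)" f] fu unfolding e_def h0 Q_def jcoef_def
        by (simp add: algebra_simps)
      then have pr: "e n = e (Suc 0) * of_real (rec_sol (jcoef m (a\<^sup>2) s) n)" for n
        by (rule rec_sol_proportional) (simp add: e_def f0)
      have "\<bar>rec_sol (jcoef m (a\<^sup>2) s) n\<bar> \<le> (B + B') / cmod (fcoeff h f 1)" for n
      proof -
        have "cmod (e n) \<le> B + B'" using fu B B' unfolding e_def
          by (metis add_increasing add_increasing2 less_imp_le)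
        then show ?thesis using nz unfolding pr[of n] by (simp add: e_def norm_mult pos_le_divide_eq mult.commute)
      qed
      then show ?thesis unfolding in_spec_def bounded_iff by auto
    qed
    show ?thesis
    proof (rule ccontr)
      assume "\<not> ?thesis"
      then have E1: "fcoeff h u 1 = 0" "fcoeff h u' 1 = 0" using main E0 by blast+
      \<comment> \<open>With the modes 0 and 1 of \<open>u\<close> and \<open>u'\<close> all zero,
        the only free number left is the mode 0 of the second component, and a nontrivial
        combination removes it.\<close>
      obtain x y where "(x, y) \<noteq> (0, 0)" "x * fcoeff h v 0 + y * fcoeff h v' 0 = 0"
        using nontrivial_kernel[of "fcoeff h v 0" "fcoeff h v' 0" "fcoeff h v' 0" "fcoeff h v 0"]
          nontrivial_kernel[of "fcoeff h v 0" 0 "fcoeff h v' 0" 0] by auto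
      then show False using E0 E1 h0 by (intro no_zero[of x y]) auto
    qed
  next
    case False
    then have h2: "h = 1/2" by (simp add: h_def)
    have nz: "of_int n + h \<noteq> 0" for n :: int
    proof
      assume "of_int n + h = 0"
      then have "of_int (2 * n + 1) = (0 :: real)" unfolding h2 by simp
      then show False unfolding of_int_eq_0_iff by presburger
    qed
    define W where "W n = fcoeff h u n * fcoeff h u' (n + 1) - fcoeff h u' n * fcoeff h u (n + 1)" for n
    have Wc: "W n = W 0" if "n \<ge> 0" for n
      using that
    proof (induction rule: int_ge_induct)
      case (step n)
      have "fcoeff h f (n + 2) = of_real (Q (n + 1)) * fcoeff h f (n + 1) - fcoeff h f n" if "f = u \<or> f = u'" for f
        using rec[OF nz that, of "n + 1"] by (simp add: algebra_simps)
      then have r: "fcoeff h u (n + 1 + 1) = of_real (Q (n + 1)) * fcoeff h u (n + 1) - fcoeff h u n"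
        "fcoeff h u' (n + 1 + 1) = of_real (Q (n + 1)) * fcoeff h u' (n + 1) - fcoeff h u' n"
        by (simp_all add: add.assoc)
      have "W (n + 1) = W n" unfolding W_def r by (simp add: algebra_simps)
      then show ?case using step.IH by simp
    qed simp
    \<comment> \<open>The recurrence bounds Q_n u_n by two bounded neighbours. Since Q_n grows at
      least linearly, the constant W must be 0.\<close>
    have "\<bar>Q n\<bar> * cmod (W n) \<le> 4 * B * B'" if "n \<ge> 0" for n
    proof -
      have "\<bar>Q n\<bar> * cmod (fcoeff h f n) \<le> 2 * b" if f: "f = u \<or> f = u'" and b: "\<And>n. cmod (fcoeff h f n) \<le> b" for f b
      proof -
        have "\<bar>Q n\<bar> * cmod (fcoeff h f n) = cmod (fcoeff h f (n + 1) + fcoeff h f (n - 1))"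
          unfolding rec[OF nz f] by (simp add: norm_mult)
        also have "\<dots> \<le> b + b" by (rule norm_triangle_mono[OF b b])
        finally show ?thesis by simp
      qed
      then have q: "\<bar>Q n\<bar> * cmod (fcoeff h u n) \<le> 2 * B" "\<bar>Q n\<bar> * cmod (fcoeff h u' n) \<le> 2 * B'"
        using B(2) B'(2) by blast+
      have *: "(\<bar>Q n\<bar> * cmod (fcoeff h u n)) * cmod (fcoeff h u' (n + 1)) \<le> (2 * B) * B'"
        by (rule mult_mono[OF q(1) B'(2)]) (use B in simp_all)
      have **: "(\<bar>Q n\<bar> * cmod (fcoeff h u' n)) * cmod (fcoeff h u (n + 1)) \<le> (2 * B') * B"
        by (rule mult_mono[OF q(2) B(2)]) (use B' in simp_all)
      have "cmod (W n) \<le> cmod (fcoeff h u n) * cmod (fcoeff h u' (n + 1)) + cmod (fcoeff h u' n) * cmod (fcoeff h u (n + 1))"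
        unfolding W_def norm_mult[symmetric] by (rule norm_triangle_ineq4)
      then have "\<bar>Q n\<bar> * cmod (W n) \<le> \<bar>Q n\<bar> * (cmod (fcoeff h u n) * cmod (fcoeff h u' (n + 1)) + cmod (fcoeff h u' n) * cmod (fcoeff h u (n + 1)))"
        by (rule mult_left_mono) simp
      also have "\<dots> \<le> 4 * B * B'" using * ** mult.commute[of B' B] by (simp add: distrib_left mult.assoc)
      finally show ?thesis .
    qed
    moreover have "\<bar>Q (int n)\<bar> \<ge> 2 / \<bar>s\<bar> * real n" for n
      unfolding Q_def abs_mult abs_divide
      by (intro mult_mono) (auto simp: h2 intro!: add_increasing2)
    ultimately have "2 / \<bar>s\<bar> * real n * cmod (W 0) \<le> 4 * B * B'" for n
      using Wc[of "int n"] mult_right_mono[of "2 / \<bar>s\<bar> * real n" "\<bar>Q (int n)\<bar>" "cmod (W 0)"]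
      by (metis norm_ge_zero of_nat_0_le_iff order_trans)
    then have W0: "W 0 = 0"
    proof -
      assume le: "\<And>n. 2 / \<bar>s\<bar> * real n * cmod (W 0) \<le> 4 * B * B'"
      show ?thesis
      proof (rule ccontr)
        assume "W 0 \<noteq> 0"
        then have p: "2 / \<bar>s\<bar> * cmod (W 0) > 0" using s by simp
        obtain n :: nat where "4 * B * B' / (2 / \<bar>s\<bar> * cmod (W 0)) < real n" using reals_Archimedean2 by blast
        then have "4 * B * B' < real n * (2 / \<bar>s\<bar> * cmod (W 0))" using p by (simp only: pos_divide_less_eq)
        then show False using le[of n] by (simp add: mult_ac)
      qed
    qed
    obtain x y where "(x, y) \<noteq> (0, 0)" "x * fcoeff h u 0 + y * fcoeff h u' 0 = 0"
      "x * fcoeff h u 1 + y * fcoeff h u' 1 = 0"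
      by (rule nontrivial_kernel[of "fcoeff h u 0" "fcoeff h u' 1" "fcoeff h u' 0" "fcoeff h u 1"])
        (use W0 in \<open>auto simp: W_def\<close>)
    then have False
    proof (rule no_zero)
      fix n assume "of_int n + of_real h = (0 :: complex)"
      then have "of_int n + h = 0"
        by (metis of_real_add of_real_eq_0_iff of_real_of_int_eq)
      with nz show "x * fcoeff h v n + y * fcoeff h v' n = 0" by blast
    qed
    then show ?thesis ..
  qed
qed

section \<open>Identity flow maps and bounded solutions of the recurrence\<close>

lemma wronskian_cis_nonzero:
  assumes "cis x \<noteq> cis y"
  shows "cis (x / 2) * cis (- y / 2) - cis (y / 2) * cis (- x / 2) \<noteq> 0"
proof
  assume "cis (x / 2) * cis (- y / 2) - cis (y / 2) * cis (- x / 2) = 0"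
  then have "cis ((x - y) / 2) = cis ((y - x) / 2)" by (simp add: cis_mult diff_divide_distrib)
  then have "cis ((x + y) / 2) * cis ((x - y) / 2) = cis ((x + y) / 2) * cis ((y - x) / 2)" by simp
  moreover have "(x + y) / 2 + (x - y) / 2 = x" "(x + y) / 2 + (y - x) / 2 = y" by (simp_all add: field_simps)
  ultimately show False using assms by (simp add: cis_mult)
qed

text \<open>The multipliers of any two of three independent solutions are inverse to each other, so all
  three multipliers agree and equal \<open>\<plusminus>1\<close>.\<close>

lemma periodic_solutions_in_spec:
  assumes per: "\<And>z. z \<in> sphere 0 1 - {c} \<Longrightarrow>
      \<exists>\<theta>. josephson_solution (- int m) a s \<theta> \<and> cis (\<theta> 0) = z \<and> cis (\<theta> (2 * pi)) = z"
    and a: "a > 0" and s: "s \<noteq> 0"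
  shows "in_spec m (a\<^sup>2) s"
proof -
  have "\<exists>z1 z2 z3. {z1, z2, z3} \<subseteq> sphere 0 1 - {c} \<and> z1 \<noteq> z2 \<and> z1 \<noteq> z3 \<and> z2 \<noteq> z3"
  proof -
    consider "c = 1" | "c = - 1" | "c = \<i>" | "c \<noteq> 1" "c \<noteq> - 1" "c \<noteq> \<i>" by blast
    then show ?thesis
    proof cases
      case 1
      then show ?thesis by (intro exI[of _ "- 1"] exI[of _ "\<i>"] exI[of _ "- \<i>"]) (auto simp: complex_eq_iff)
    next
      case 2
      then show ?thesis by (intro exI[of _ 1] exI[of _ "\<i>"] exI[of _ "- \<i>"]) (auto simp: complex_eq_iff)
    next
      case 3
      then show ?thesis by (intro exI[of _ 1] exI[of _ "- 1"] exI[of _ "- \<i>"]) (auto simp: complex_eq_iff)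
    next
      case 4
      moreover have "(1 :: complex) \<noteq> \<i>" "(- 1 :: complex) \<noteq> \<i>" by (auto simp: complex_eq_iff)
      ultimately show ?thesis by (intro exI[of _ 1] exI[of _ "- 1"] exI[of _ "\<i>"]) auto
    qed
  qed
  then obtain z1 z2 z3 where z: "z1 \<in> sphere 0 1 - {c}" "z2 \<in> sphere 0 1 - {c}" "z3 \<in> sphere 0 1 - {c}"
    and ne: "z1 \<noteq> z2" "z1 \<noteq> z3" "z2 \<noteq> z3" by auto
  have ex: "\<exists>u v \<theta> (\<nu> :: real). lin_sys (- int m) a s u v \<and> u 0 = cis (\<theta> / 2) \<and> v 0 = cis (- \<theta> / 2) \<and> cis \<theta> = z
      \<and> u (2 * pi) = of_real \<nu> * u 0 \<and> v (2 * pi) = of_real \<nu> * v 0" if z: "z \<in> sphere 0 1 - {c}" for z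
  proof -
    obtain \<theta> where \<theta>: "josephson_solution (- int m) a s \<theta>" "cis (\<theta> 0) = z" "cis (\<theta> (2 * pi)) = z"
      using per[OF z] by blast
    then have "cis (\<theta> (2 * pi)) = cis (\<theta> 0)" by simp
    from josephson_lin_sys[OF \<theta>(1) this] show ?thesis using \<theta>(2) by metis
  qed
  obtain u1 v1 \<theta>1 \<nu>1 where 1: "lin_sys (- int m) a s u1 v1" "u1 0 = cis (\<theta>1 / 2)" "v1 0 = cis (- \<theta>1 / 2)" "cis \<theta>1 = z1"
    "u1 (2 * pi) = of_real \<nu>1 * u1 0" "v1 (2 * pi) = of_real \<nu>1 * v1 0" using ex[OF z(1)] by blast
  obtain u2 v2 \<theta>2 \<nu>2 where 2: "lin_sys (- int m) a s u2 v2" "u2 0 = cis (\<theta>2 / 2)" "v2 0 = cis (- \<theta>2 / 2)" "cis \<theta>2 = z2"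
    "u2 (2 * pi) = of_real \<nu>2 * u2 0" "v2 (2 * pi) = of_real \<nu>2 * v2 0" using ex[OF z(2)] by blast
  obtain u3 v3 \<theta>3 \<nu>3 where 3: "lin_sys (- int m) a s u3 v3" "u3 0 = cis (\<theta>3 / 2)" "v3 0 = cis (- \<theta>3 / 2)" "cis \<theta>3 = z3"
    "u3 (2 * pi) = of_real \<nu>3 * u3 0" "v3 (2 * pi) = of_real \<nu>3 * v3 0" using ex[OF z(3)] by blast
  have prod: "\<nu> * \<nu>' = 1"
    if "lin_sys (- int m) a s u v" "lin_sys (- int m) a s u' v'"
      "u (2 * pi) = of_real \<nu> * u 0" "v (2 * pi) = of_real \<nu> * v 0"
      "u' (2 * pi) = of_real \<nu>' * u' 0" "v' (2 * pi) = of_real \<nu>' * v' 0"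
      "u 0 * v' 0 - u' 0 * v 0 \<noteq> 0" for u v u' v' and \<nu> \<nu>' :: real
  proof -
    have "of_real (\<nu> * \<nu>') * (u 0 * v' 0 - u' 0 * v 0) = 1 * (u 0 * v' 0 - u' 0 * v 0)"
      using wronskian_periodic[OF that(1,2)] unfolding that(3-6) by (simp add: algebra_simps)
    then have "complex_of_real (\<nu> * \<nu>') = 1" using that(7) by (simp only: mult_cancel_right) simp
    then show ?thesis by (simp only: of_real_eq_1_iff)
  qed
  have W12: "u1 0 * v2 0 - u2 0 * v1 0 \<noteq> 0" unfolding 1 2 by (rule wronskian_cis_nonzero) (use 1 2 ne in simp)
  have W13: "u1 0 * v3 0 - u3 0 * v1 0 \<noteq> 0" unfolding 1 3 by (rule wronskian_cis_nonzero) (use 1 3 ne in simp)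
  have W23: "u2 0 * v3 0 - u3 0 * v2 0 \<noteq> 0" unfolding 2 3 by (rule wronskian_cis_nonzero) (use 2 3 ne in simp)
  have p: "\<nu>1 * \<nu>2 = 1" "\<nu>1 * \<nu>3 = 1" "\<nu>2 * \<nu>3 = 1"
    using prod[OF 1(1) 2(1) 1(5,6) 2(5,6) W12] prod[OF 1(1) 3(1) 1(5,6) 3(5,6) W13] prod[OF 2(1) 3(1) 2(5,6) 3(5,6) W23] .
  have "\<nu>3 \<noteq> 0" using p(2) by auto
  moreover have "\<nu>1 * \<nu>3 = \<nu>2 * \<nu>3" using p by simp
  ultimately have eq: "\<nu>2 = \<nu>1" by simp
  then have "\<nu>1 = 1 \<or> \<nu>1 = - 1" using p(1) square_eq_1_iff[of \<nu>1] by simp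
  then show ?thesis
    using 1(5,6) 2(5,6) unfolding eq
    by (intro lin_sys_in_spec[OF 1(1) 2(1) refl a s, of "of_real \<nu>1"] W12) auto
qed

section \<open>Time reversal and the sign of s\<close>

lemma rec_sol_uminus: "rec_sol (\<lambda>n. - q n) n = (-1) ^ Suc n * rec_sol q n"
  by (induction q n rule: rec_sol.induct) (simp_all add: algebra_simps)

lemma jcoef_minus: "jcoef m b (- s) = (\<lambda>n. - jcoef m b s n)"
  by (auto simp: jcoef_def)

text \<open>Negating s multiplies e_n by (-1)^(n+1), which boundedness ignores; this admits time
  reversal, which turns s into -s.\<close>

lemma in_spec_minus: "in_spec m b (- s) \<longleftrightarrow> in_spec m b s"
  unfolding in_spec_def jcoef_minus bounded_iff by (auto simp: rec_sol_uminus abs_mult)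

lemma flow_map_id_in_spec:
  assumes id: "\<And>z. z \<in> sphere 0 1 \<Longrightarrow> flow_map l a s z = z" and a: "a > 0" and s: "s \<noteq> 0"
  shows "in_spec (nat \<bar>l\<bar>) (a\<^sup>2) s"
proof -
  obtain c where c: "\<And>z. z \<in> sphere 0 1 - {c} \<Longrightarrow>
      \<exists>\<theta>. josephson_solution l a s \<theta> \<and> cis (\<theta> 0) = z \<and> cis (\<theta> (2 * pi)) = z"
    using flow_map_id_solutions[OF id] by blast
  show ?thesis
  proof (cases "l \<le> 0")
    case True
    then have "l = - int (nat \<bar>l\<bar>)" by simp
    then show ?thesis using c by (intro periodic_solutions_in_spec[of c] a s) metis
  next
    case False
    then have l: "- l = - int (nat \<bar>l\<bar>)" by simp
    have "\<exists>\<theta>. josephson_solution (- int (nat \<bar>l\<bar>)) a (- s) \<theta> \<and> cis (\<theta> 0) = z \<and> cis (\<theta> (2 * pi)) = z"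
      if z: "z \<in> sphere 0 1 - {- c}" for z
    proof -
      have "- z \<in> sphere 0 1 - {c}" using z by auto
      then obtain \<theta> where \<theta>: "josephson_solution l a s \<theta>" "cis (\<theta> 0) = - z" "cis (\<theta> (2 * pi)) = - z"
        using c by blast
      then show ?thesis
        using josephson_solution_reverse[OF \<theta>(1)] unfolding l
        by (intro exI[of _ "\<lambda>t. \<theta> (2 * pi - t) + pi"]) (simp add: minus_cis[symmetric])
    qed
    then show ?thesis using periodic_solutions_in_spec[of "- c" "nat \<bar>l\<bar>" a "- s"] a s in_spec_minus by simp
  qed
qed

section \<open>From the linear system back to the angle\<close>

lemma log_lift:
  fixes v :: "real \<Rightarrow> complex"
  assumes d: "\<And>t. t \<in> {a..b} \<Longrightarrow> (v has_vector_derivative v' t) (at t within {a..b})"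
    and c: "continuous_on {a..b} v'" and nz: "\<And>t. t \<in> {a..b} \<Longrightarrow> v t \<noteq> 0"
  obtains L where "\<And>t. t \<in> {a..b} \<Longrightarrow> (L has_vector_derivative v' t / v t) (at t within {a..b})"
    "\<And>t. t \<in> {a..b} \<Longrightarrow> exp (L t) = v t"
proof (cases "a \<le> b")
  case False
  then show ?thesis using that by auto
next
  case True
  have cv: "continuous_on {a..b} v" by (rule continuous_on_vector_derivative[OF d])
  define L where "L t = Ln (v a) + integral {a..t} (\<lambda>t. v' t / v t)" for t
  have dL: "(L has_vector_derivative v' t / v t) (at t within {a..b})" if "t \<in> {a..b}" for t
    unfolding L_def
    by (rule has_vector_derivative_eq_rhs[OF has_vector_derivative_add[OF has_vector_derivative_const
          integral_has_vector_derivative]]) (use that nz in \<open>auto intro!: continuous_intros c cv\<close>)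
  have "((\<lambda>t. v t * exp (- L t)) has_vector_derivative 0) (at t within {a..b})" if t: "t \<in> {a..b}" for t
    by (rule has_vector_derivative_eq_rhs[OF has_vector_derivative_mult[OF d[OF t]
        has_vector_derivative_exp_compose[OF has_vector_derivative_minus[OF dL[OF t]]]]])
      (use nz[OF t] in simp)
  then obtain k where k: "\<And>t. t \<in> {a..b} \<Longrightarrow> v t * exp (- L t) = k"
    using has_vector_derivative_zero_constant[of "{a..b}" "\<lambda>t. v t * exp (- L t)"] by (auto simp: convex_real_interval)
  have "k = 1" using k[of a] True nz[of a] by (simp add: L_def exp_minus)
  then have "exp (L t) = v t" if "t \<in> {a..b}" for t using k[OF that] by (simp add: exp_minus field_simps)
  with dL show ?thesis using that by blast
qed

text \<open>Reflection in the unit circle: w = u / v goes to 1 / cnj w, which fixes w = exp(i theta)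
  for real theta. The \<open>cis\<close> factor cancels the term that conjugation brings into the
  second equation.\<close>

lemma lin_sys_conj:
  assumes "lin_sys l a s u v"
  shows "lin_sys l a s (\<lambda>t. cis (of_int l * t + s * sin t) * cnj (v t)) (\<lambda>t. cis (of_int l * t + s * sin t) * cnj (u t))"
  unfolding lin_sys_def
proof (intro ballI conjI)
  fix t :: real assume t: "t \<in> {0..2*pi}"
  let ?G = "\<lambda>t. cis (of_int l * t + s * sin t)"
  have d: "(u has_vector_derivative \<i> * of_real (of_int l + s * cos t) * u t + \<i> * of_real (a / 2) * v t) (at t within {0..2*pi})"
     "(v has_vector_derivative - (\<i> * of_real (a / 2) * u t)) (at t within {0..2*pi})"
    using assms t by (auto simp: lin_sys_def)
  have "((\<lambda>t. of_int l * t + s * sin t) has_real_derivative of_int l + s * cos t) (at t within {0..2*pi})"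
    by (auto intro!: derivative_eq_intros)
  then have "((\<lambda>t. \<i> * complex_of_real (of_int l * t + s * sin t)) has_vector_derivative
    \<i> * of_real (of_int l + s * cos t)) (at t within {0..2*pi})"
    by (intro has_vector_derivative_mult_right has_vector_derivative_of_real)
  from has_vector_derivative_exp_compose[OF this]
  have dG: "(?G has_vector_derivative \<i> * of_real (of_int l + s * cos t) * ?G t) (at t within {0..2*pi})"
    unfolding cis_conv_exp .
  show "((\<lambda>t. ?G t * cnj (v t)) has_vector_derivative
     \<i> * of_real (of_int l + s * cos t) * (?G t * cnj (v t)) + \<i> * of_real (a / 2) * (?G t * cnj (u t))) (at t within {0..2*pi})"
    by (rule has_vector_derivative_eq_rhs[OF has_vector_derivative_mult[OF dG has_vector_derivative_cnj[OF d(2)]]])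
      (simp add: algebra_simps)
  show "((\<lambda>t. ?G t * cnj (u t)) has_vector_derivative - (\<i> * of_real (a / 2) * (?G t * cnj (v t)))) (at t within {0..2*pi})"
    by (rule has_vector_derivative_eq_rhs[OF has_vector_derivative_mult[OF dG has_vector_derivative_cnj[OF d(1)]]])
      (simp add: algebra_simps)
qed

text \<open>A solution fixed by the reflection has |u| = |v|, and the argument of u / v is l t + s
  sin t minus twice that of v; \<open>log_lift\<close> supplies a differentiable argument of
  v.\<close>

lemma lin_sys_josephson:
  assumes sys: "lin_sys l a s u v" and v: "\<And>t. t \<in> {0..2*pi} \<Longrightarrow> v t \<noteq> 0"
    and re: "\<And>t. t \<in> {0..2*pi} \<Longrightarrow> u t = cis (of_int l * t + s * sin t) * cnj (v t)"
  obtains \<theta> where "josephson_solution l a s \<theta>" "\<And>t. t \<in> {0..2*pi} \<Longrightarrow> cis (\<theta> t) = u t / v t"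
proof -
  define v' where "v' t = - (\<i> * of_real (a / 2) * u t)" for t
  have dv: "(v has_vector_derivative v' t) (at t within {0..2*pi})" if "t \<in> {0..2*pi}" for t
    using sys that by (auto simp: lin_sys_def v'_def)
  have cv': "continuous_on {0..2*pi} v'" unfolding v'_def by (intro continuous_intros lin_sys_continuous[OF sys])
  obtain L where L: "\<And>t. t \<in> {0..2*pi} \<Longrightarrow> (L has_vector_derivative v' t / v t) (at t within {0..2*pi})"
    "\<And>t. t \<in> {0..2*pi} \<Longrightarrow> exp (L t) = v t"
    using log_lift[OF dv cv' v] by blast
  define \<theta> where "\<theta> t = of_int l * t + s * sin t - 2 * Im (L t)" for t
  have cis\<theta>: "cis (\<theta> t) = u t / v t" if t: "t \<in> {0..2*pi}" for t
  proof -
    have "cnj (v t) / v t = exp (cnj (L t) - L t)"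
      unfolding L(2)[OF t, symmetric] exp_diff exp_cnj ..
    also have "cnj (L t) - L t = \<i> * of_real (- 2 * Im (L t))" by (simp add: complex_eq_iff)
    finally have "cnj (v t) / v t = cis (- 2 * Im (L t))" by (simp only: cis_conv_exp)
    then have "u t / v t = cis (of_int l * t + s * sin t) * cis (- 2 * Im (L t))"
      unfolding re[OF t] by (simp only: times_divide_eq_right[symmetric])
    then show ?thesis unfolding cis_mult \<theta>_def by simp
  qed
  have "josephson_solution l a s \<theta>"
    unfolding josephson_solution_def
  proof
    fix t :: real assume t: "t \<in> {0..2*pi}"
    have dIm: "((\<lambda>t. Im (L t)) has_real_derivative Im (v' t / v t)) (at t within {0..2*pi})"
      unfolding has_real_derivative_iff_has_vector_derivative
      by (rule bounded_linear.has_vector_derivative[OF bounded_linear_Im L(1)[OF t]])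
    have "(\<theta> has_real_derivative of_int l + s * cos t - 2 * Im (v' t / v t)) (at t within {0..2*pi})"
      unfolding \<theta>_def by (rule dIm derivative_eq_intros refl)+ simp
    moreover have "v' t / v t = - (\<i> * of_real (a / 2) * cis (\<theta> t))"
      unfolding cis\<theta>[OF t] v'_def by simp
    then have "- 2 * Im (v' t / v t) = a * cos (\<theta> t)" by simp
    then have "of_int l + s * cos t - 2 * Im (v' t / v t) = a * cos (\<theta> t) + of_int l + s * cos t" by linarith
    ultimately show "(\<theta> has_real_derivative a * cos (\<theta> t) + of_int l + s * cos t) (at t within {0..2*pi})"
      by (simp only:)
  qed
  with cis\<theta> show ?thesis using that by blast
qed


section \<open>A holomorphic solution from a decaying solution of the recurrence\<close>

locale decaying_solution =
  fixes e :: "nat \<Rightarrow> real" and m :: nat and a s C :: real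
  assumes a: "a > 0" and s: "s \<noteq> 0"
    and e0: "e 0 = 0" and e1: "e 1 = 1"
    and e_rec: "\<And>n. e (Suc (Suc n)) = jcoef m (a\<^sup>2) s (Suc n) * e (Suc n) - e n"
    and e_bound: "\<And>n. \<bar>e n\<bar> \<le> C * (1/2) ^ n"
begin

text \<open>Taylor coefficients of the second unknown. For n > 0 they are forced by the second
  equation; the constant mode of the first one, 0 = s/2 + (a/2) c_0, determines the remaining
  one.\<close>

definition c :: "nat \<Rightarrow> real" where
  "c n = (if n = 0 then - s / a else - (a / 2) * e n / n)"

definition U :: "complex \<Rightarrow> complex" where "U z = (\<Sum>n. of_real (e n) * z ^ n)"
definition V :: "complex \<Rightarrow> complex" where "V z = (\<Sum>n. of_real (c n) * z ^ n)"
definition U' :: "complex \<Rightarrow> complex" where "U' z = (\<Sum>n. diffs (\<lambda>n. of_real (e n)) n * z ^ n)"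
definition V' :: "complex \<Rightarrow> complex" where "V' z = (\<Sum>n. diffs (\<lambda>n. of_real (c n)) n * z ^ n)"

text \<open>The factor (1/2)^n gives radius of convergence at least 2, hence functions holomorphic
  around the closed unit disc.\<close>

lemma summable_geometric_bound:
  fixes f :: "nat \<Rightarrow> real" and z :: complex
  assumes "\<And>n. \<bar>f n\<bar> \<le> B * (1/2) ^ n" "cmod z < 2"
  shows "summable (\<lambda>n. of_real (f n) * z ^ n)"
proof (rule summable_comparison_test')
  show "summable (\<lambda>n. B * (cmod z / 2) ^ n)" using assms(2) by (intro summable_mult summable_geometric) auto
  fix n :: nat assume "n \<ge> 0"
  have "\<bar>f n\<bar> * cmod z ^ n \<le> (B * (1/2) ^ n) * cmod z ^ n" by (intro mult_right_mono assms) auto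
  then show "cmod (of_real (f n) * z ^ n) \<le> B * (cmod z / 2) ^ n"
    by (simp add: norm_mult norm_power power_divide)
qed

lemma c_bound: "\<bar>c n\<bar> \<le> (\<bar>s\<bar> / a + a / 2 * C) * (1/2) ^ n"
proof (cases "n = 0")
  case True
  have "C \<ge> 0" using e_bound[of 0] e0 by simp
  then show ?thesis using a True by (simp add: c_def)
next
  case False
  have C: "C \<ge> 0" using e_bound[of 0] e0 by simp
  have "\<bar>c n\<bar> = (a / 2) * (\<bar>e n\<bar> / n)" using False a by (simp add: c_def abs_mult)
  also have "\<dots> \<le> (a / 2) * (\<bar>e n\<bar> / 1)" using False a by (intro mult_left_mono divide_left_mono) auto
  also have "\<dots> \<le> (a / 2) * (C * (1/2) ^ n)" using e_bound[of n] a by (intro mult_left_mono) auto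
  also have "\<dots> \<le> (\<bar>s\<bar> / a + a / 2 * C) * (1/2) ^ n"
    unfolding mult.assoc[symmetric] using a by (intro mult_right_mono) auto
  finally show ?thesis .
qed

lemma U_sums: "cmod z < 2 \<Longrightarrow> (\<lambda>n. of_real (e n) * z ^ n) sums U z"
  unfolding U_def by (intro summable_sums summable_geometric_bound[OF e_bound])

lemma V_sums: "cmod z < 2 \<Longrightarrow> (\<lambda>n. of_real (c n) * z ^ n) sums V z"
  unfolding V_def by (intro summable_sums summable_geometric_bound[OF c_bound])

lemma U_deriv: "cmod z < 2 \<Longrightarrow> (U has_field_derivative U' z) (at z)"
  unfolding U_def[abs_def] U'_def by (rule termdiffs_strong'[of 2]) (auto intro: summable_geometric_bound[OF e_bound])

lemma V_deriv: "cmod z < 2 \<Longrightarrow> (V has_field_derivative V' z) (at z)"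
  unfolding V_def[abs_def] V'_def by (rule termdiffs_strong'[of 2]) (auto intro: summable_geometric_bound[OF c_bound])

lemma zU'_sums: assumes "cmod z < 2" shows "(\<lambda>n. of_real (real n * e n) * z ^ n) sums (z * U' z)"
  and "(\<lambda>n. of_real (real n * c n) * z ^ n) sums (z * V' z)"
proof -
  have *: "(\<lambda>n. of_real (real n * f n) * z ^ n) sums (z * (\<Sum>n. diffs (\<lambda>n. of_real (f n)) n * z ^ n))"
    if "\<And>z. cmod z < 2 \<Longrightarrow> summable (\<lambda>n. of_real (f n) * z ^ n)" for f :: "nat \<Rightarrow> real"
  proof -
    have "summable (\<lambda>n. diffs (\<lambda>n. complex_of_real (f n)) n * z ^ n)"
      by (rule termdiff_converges[OF assms that])
    from sums_mult[OF diffs_equiv[OF this], of z]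
    have "(\<lambda>n. z * (of_nat n * of_real (f n) * z ^ (n - Suc 0))) sums (z * (\<Sum>n. diffs (\<lambda>n. of_real (f n)) n * z ^ n))" .
    moreover have "z * (of_nat n * of_real (f n) * z ^ (n - Suc 0)) = of_real (real n * f n) * z ^ n" for n
      by (cases n) (simp_all add: mult_ac)
    ultimately show ?thesis by simp
  qed
  show "(\<lambda>n. of_real (real n * e n) * z ^ n) sums (z * U' z)"
    unfolding U'_def by (rule *) (rule summable_geometric_bound[OF e_bound])
  show "(\<lambda>n. of_real (real n * c n) * z ^ n) sums (z * V' z)"
    unfolding V'_def by (rule *) (rule summable_geometric_bound[OF c_bound])
qed

lemma V'_eq:
  assumes z: "cmod z < 2"
  shows "z * V' z = - of_real (a / 2) * U z"
proof -
  have "real n * c n = - (a / 2) * e n" for n by (simp add: c_def e0)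
  then have "(\<lambda>n. of_real (- (a / 2) * e n) * z ^ n) sums (z * V' z)" using zU'_sums(2)[OF z] by (simp only:)
  moreover have "(\<lambda>n. - of_real (a / 2) * (of_real (e n) * z ^ n)) sums (- of_real (a / 2) * U z)"
    by (intro sums_mult U_sums z)
  ultimately show ?thesis by (simp add: sums_iff mult.assoc)
qed

lemma U'_eq:
  assumes z: "cmod z < 2" "z \<noteq> 0"
  shows "z * U' z = - of_nat m * U z + of_real (s / 2) * (z + 1 / z) * U z + of_real (a / 2) * V z"
proof -
  define ep where "ep n = (case n of 0 \<Rightarrow> 0 | Suc k \<Rightarrow> e k)" for n
  have 1: "(\<lambda>n. of_real (ep n) * z ^ n) sums (z * U z)"
  proof -
    have "(\<lambda>n. of_real (ep (Suc n)) * z ^ Suc n) sums (z * U z)"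
      using sums_mult[OF U_sums[OF z(1)], of z] by (simp add: ep_def mult_ac)
    then show ?thesis using sums_Suc[of "\<lambda>n. of_real (ep n) * z ^ n"] by (simp add: ep_def)
  qed
  have 2: "(\<lambda>n. of_real (e (Suc n)) * z ^ n) sums (1 / z * U z)"
  proof -
    have "(\<lambda>n. of_real (e (Suc n)) * z ^ Suc n) sums U z"
      using U_sums[OF z(1)] by (subst sums_Suc_iff) (simp add: e0)
    from sums_mult[OF this, of "1 / z"] show ?thesis using z(2) by (simp add: mult_ac)
  qed
  \<comment> \<open>Coefficient by coefficient this is the recurrence for n \<ge> 1 and the choice
    of \<open>c 0\<close> for n = 0.\<close>
  have "real n * e n = - real m * e n + s / 2 * (ep n + e (Suc n)) + a / 2 * c n" for n
  proof (cases n)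
    case 0
    then show ?thesis using a by (simp add: e0 e1[simplified] ep_def c_def)
  next
    case (Suc k)
    define Q where "Q = a\<^sup>2 / (4 * real (Suc k))"
    have 1: "s / 2 * (e k + e (Suc (Suc k))) = (real (Suc k) + real m + Q) * e (Suc k)"
      unfolding e_rec jcoef_def Q_def using s by simp
    have 2: "a / 2 * c (Suc k) = - Q * e (Suc k)"
      by (simp add: c_def Q_def power2_eq_square)
    show ?thesis unfolding Suc ep_def nat.case 1 2 by (simp add: algebra_simps)
  qed
  then have "(\<lambda>n. of_real (- real m * e n + s / 2 * (ep n + e (Suc n)) + a / 2 * c n) * z ^ n) sums (z * U' z)"
    using zU'_sums(1)[OF z(1)] by (simp only:)
  moreover have "(\<lambda>n. - of_nat m * (of_real (e n) * z ^ n) + of_real (s / 2) * (of_real (ep n) * z ^ n + of_real (e (Suc n)) * z ^ n)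
      + of_real (a / 2) * (of_real (c n) * z ^ n))
    sums (- of_nat m * U z + of_real (s / 2) * (z * U z + 1 / z * U z) + of_real (a / 2) * V z)"
    by (intro sums_add sums_mult U_sums V_sums z 1 2)
  moreover have "of_real (- real m * e n + s / 2 * (ep n + e (Suc n)) + a / 2 * c n) * z ^ n =
     - of_nat m * (of_real (e n) * z ^ n) + of_real (s / 2) * (of_real (ep n) * z ^ n + of_real (e (Suc n)) * z ^ n)
      + of_real (a / 2) * (of_real (c n) * z ^ n)" for n
    by (simp add: algebra_simps)
  ultimately have "z * U' z = - of_nat m * U z + of_real (s / 2) * (z * U z + 1 / z * U z) + of_real (a / 2) * V z"
    by (simp only: sums_unique2)
  then show ?thesis by (simp add: distrib_left distrib_right mult.assoc)
qed

definition u :: "real \<Rightarrow> complex" where "u t = U (cis t)"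
definition v :: "real \<Rightarrow> complex" where "v t = V (cis t)"

lemma circle_deriv:
  assumes "(F has_field_derivative F') (at (cis t))"
  shows "((\<lambda>t. F (cis t)) has_vector_derivative \<i> * (cis t * F')) (at t within S)"
proof -
  have "((\<lambda>t. \<i> * complex_of_real t) has_vector_derivative \<i> * of_real 1) (at t within S)"
    by (intro has_vector_derivative_mult_right has_vector_derivative_of_real) (rule DERIV_ident)
  from has_vector_derivative_exp_compose[OF this]
  have "(cis has_vector_derivative \<i> * cis t) (at t within S)" by (simp add: cis_conv_exp[abs_def])
  from field_vector_diff_chain_within[OF this, of F F'] show ?thesis
    using has_field_derivative_at_within[OF assms] by (simp add: o_def mult.assoc)
qed

lemma lin_sys_uv: "lin_sys (- int m) a s u v"
  unfolding lin_sys_def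
proof (intro ballI conjI)
  fix t :: real
  have z: "cmod (cis t) < 2" "cis t \<noteq> 0" by auto
  have cs: "cis t + 1 / cis t = 2 * of_real (cos t)" by (simp add: cis_divide[of 0, simplified] complex_eq_iff)
  have "cis t * U' (cis t) = of_real (of_int (- int m) + s * cos t) * u t + of_real (a / 2) * v t"
    unfolding U'_eq[OF z] cs u_def v_def by (simp add: algebra_simps)
  then have eq: "\<i> * (cis t * U' (cis t)) = \<i> * of_real (of_int (- int m) + s * cos t) * u t + \<i> * of_real (a / 2) * v t"
    by (simp only: distrib_left mult.assoc)
  show "(u has_vector_derivative \<i> * of_real (of_int (- int m) + s * cos t) * u t + \<i> * of_real (a / 2) * v t)
    (at t within {0..2*pi})"
    using circle_deriv[OF U_deriv[OF z(1)], of "{0..2*pi}"] unfolding eq u_def[symmetric] .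
  have eq: "\<i> * (cis t * V' (cis t)) = - (\<i> * of_real (a / 2) * u t)"
    unfolding V'_eq[OF z(1)] u_def by simp
  show "(v has_vector_derivative - (\<i> * of_real (a / 2) * u t)) (at t within {0..2*pi})"
    using circle_deriv[OF V_deriv[OF z(1)], of "{0..2*pi}"] unfolding eq v_def[symmetric] .
qed

lemma uv_periodic: "u (2 * pi) = u 0" "v (2 * pi) = v 0"
  by (simp_all add: u_def v_def)

text \<open>The system preserves a Hermitian form of signature (1,1); this is the reason why
  solutions that start with u / v on the unit circle stay there.\<close>

lemma norm_diff_constant:
  assumes "t \<in> {0..2*pi}"
  shows "(cmod (u t))\<^sup>2 - (cmod (v t))\<^sup>2 = (cmod (u 0))\<^sup>2 - (cmod (v 0))\<^sup>2"
proof -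
  define k where "k t = u t * cnj (u t) - v t * cnj (v t)" for t
  have "(k has_vector_derivative 0) (at t within {0..2*pi})" if "t \<in> {0..2*pi}" for t
  proof -
    have d: "(u has_vector_derivative \<i> * of_real (of_int (- int m) + s * cos t) * u t + \<i> * of_real (a / 2) * v t) (at t within {0..2*pi})"
     "(v has_vector_derivative - (\<i> * of_real (a / 2) * u t)) (at t within {0..2*pi})"
      using lin_sys_uv that by (auto simp: lin_sys_def)
    show ?thesis unfolding k_def
      by (rule has_vector_derivative_eq_rhs[OF has_vector_derivative_diff[OF
          has_vector_derivative_mult[OF d(1) has_vector_derivative_cnj[OF d(1)]]
          has_vector_derivative_mult[OF d(2) has_vector_derivative_cnj[OF d(2)]]]])
        (simp add: algebra_simps)
  qed
  then obtain c where "\<And>t. t \<in> {0..2*pi} \<Longrightarrow> k t = c"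
    using has_vector_derivative_zero_constant[of "{0..2*pi}" k] by (auto simp: convex_real_interval)
  then have "k t = k 0" using assms by simp
  moreover have "k t = of_real ((cmod (u t))\<^sup>2 - (cmod (v t))\<^sup>2)" for t
    unfolding k_def complex_norm_square[symmetric] by simp
  ultimately show ?thesis by (simp only: of_real_eq_iff)
qed

lemma V_0: "V 0 \<noteq> 0"
proof -
  have "V 0 = of_real (c 0)" using powser_sums_zero_iff[of "\<lambda>n. of_real (c n)" "V 0"] V_sums[of 0] by simp
  then show ?thesis using a s by (simp add: c_def)
qed

lemma V_holomorphic: "V holomorphic_on ball 0 2"
  unfolding holomorphic_on_open[OF open_ball] using V_deriv by (auto intro!: exI)

text \<open>By the maximum modulus principle V would otherwise vanish at the centre, where its value
  is -s/a.\<close>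

lemma v_not_zero: "\<exists>t\<in>{0..2*pi}. v t \<noteq> 0"
proof (rule ccontr)
  assume "\<not> ?thesis"
  then have v: "v t = 0" if "t \<in> {0..2*pi}" for t using that by auto
  have "cmod (V 0) \<le> 0"
  proof (rule maximum_modulus_frontier[of V "ball 0 1"])
    show "V holomorphic_on interior (ball 0 1)" by (rule holomorphic_on_subset[OF V_holomorphic]) (auto simp: interior_open)
    show "continuous_on (closure (ball 0 1)) V"
      by (rule holomorphic_on_imp_continuous_on[OF holomorphic_on_subset[OF V_holomorphic]]) auto
    fix z :: complex assume "z \<in> frontier (ball 0 1)"
    then have "cmod z = 1" by simp
    then have "z = cis (Arg2pi z)" using Arg2pi_eq[of z] by (simp add: cis_conv_exp)
    then have "V z = v (Arg2pi z)" by (simp add: v_def)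
    then show "cmod (V z) \<le> 0" using v[of "Arg2pi z"] Arg2pi_ge_0[of z] Arg2pi_lt_2pi[of z] by simp
  qed auto
  then show False using V_0 by simp
qed

text \<open>If \<open>|u| = |v|\<close>, then \<open>v\<close> is a multiple of \<open>G cnj u\<close> with
  \<open>G = exp (\<i> (l t + s sin t))\<close>; hence \<open>z\<^sup>m U V exp (- s z)\<close>, which is holomorphic and
  vanishes at \<open>0\<close>, is on the circle a constant multiple of a nonnegative function.\<close>

lemma norm_diff_nonzero: "(cmod (u 0))\<^sup>2 - (cmod (v 0))\<^sup>2 \<noteq> 0"
proof
  assume "(cmod (u 0))\<^sup>2 - (cmod (v 0))\<^sup>2 = 0"
  then have "(cmod (u t))\<^sup>2 = (cmod (v t))\<^sup>2" if "t \<in> {0..2*pi}" for t using norm_diff_constant[OF that] by simp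
  then have eq: "cmod (u t) = cmod (v t)" if "t \<in> {0..2*pi}" for t using that by (simp add: power2_eq_iff_nonneg)
  define v' where "v' t = - (\<i> * of_real (a / 2) * u t)" for t
  have dv: "(v has_vector_derivative v' t) (at t within {0..2*pi})" if "t \<in> {0..2*pi}" for t
    using lin_sys_uv that by (auto simp: lin_sys_def v'_def)
  \<comment> \<open>Under |u| = |v| the derivative of \<open>(cmod (v t))\<^sup>2\<close> is at most
    a times the function itself, so one zero of v would spread over the whole period.\<close>
  have nz: "v t \<noteq> 0" if t: "t \<in> {0..2*pi}" for t
  proof
    assume vt: "v t = 0"
    define D where "D t = Re (v t * cnj (v t))" for t
    define D' where "D' t = Re (v t * cnj (v' t) + v' t * cnj (v t))" for t
    have Dn: "D t = (cmod (v t))\<^sup>2" for t unfolding D_def complex_norm_square[symmetric] by simp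
    have "D x = 0" if x: "x \<in> {0..2*pi}" for x
    proof (rule gronwall_zero[of 0 "2*pi" D D' a t x])
      fix y assume y: "y \<in> {0..2*pi}"
      show "(D has_real_derivative D' y) (at y within {0..2*pi})"
        unfolding has_real_derivative_iff_has_vector_derivative D_def D'_def
        by (intro bounded_linear.has_vector_derivative[OF bounded_linear_Re] has_vector_derivative_mult
            has_vector_derivative_cnj dv y)
      show "D y \<ge> 0" by (simp add: Dn)
      have n: "cmod (v' y) = a / 2 * cmod (v y)" using a by (simp add: v'_def norm_mult eq[OF y])
      have "\<bar>D' y\<bar> \<le> cmod (v y * cnj (v' y) + v' y * cnj (v y))" unfolding D'_def by (rule abs_Re_le_cmod)
      also have "\<dots> \<le> cmod (v y * cnj (v' y)) + cmod (v' y * cnj (v y))" by (rule norm_triangle_ineq)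
      also have "\<dots> = a * D y" by (simp add: norm_mult n Dn power2_eq_square)
      finally show "\<bar>D' y\<bar> \<le> a * D y" .
    qed (use t x vt in \<open>auto simp: D_def\<close>)
    then have "v x = 0" if "x \<in> {0..2*pi}" for x using that by (simp add: Dn)
    then show False using v_not_zero by blast
  qed
  define G where "G t = cis (of_int (- int m) * t + s * sin t)" for t
  have GG: "G t * cnj (G t) = 1" for t by (simp add: G_def cis_cnj cis_mult)
  \<comment> \<open>The second component of the reflected solution. Because |u| = |v|, it satisfies
    the same scalar equation B' = (v'/v) B as v and is therefore a multiple of v.\<close>
  define B where "B t = G t * cnj (u t)" for t
  have dB: "(B has_vector_derivative - (\<i> * of_real (a / 2) * (G t * cnj (v t)))) (at t within {0..2*pi})" if "t \<in> {0..2*pi}" for t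
    using lin_sys_conj[OF lin_sys_uv] that unfolding lin_sys_def B_def[abs_def] G_def by blast
  have cv': "continuous_on {0..2*pi} v'" unfolding v'_def by (intro continuous_intros lin_sys_continuous[OF lin_sys_uv])
  obtain L where L: "\<And>t. t \<in> {0..2*pi} \<Longrightarrow> (L has_vector_derivative v' t / v t) (at t within {0..2*pi})"
    "\<And>t. t \<in> {0..2*pi} \<Longrightarrow> exp (L t) = v t"
    using log_lift[OF dv cv' nz] by blast
  have "((\<lambda>t. B t * exp (- L t)) has_vector_derivative 0) (at t within {0..2*pi})" if t: "t \<in> {0..2*pi}" for t
  proof (rule has_vector_derivative_eq_rhs[OF has_vector_derivative_mult[OF dB[OF t]
        has_vector_derivative_exp_compose[OF has_vector_derivative_minus[OF L(1)[OF t]]]]])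
    have "u t * cnj (u t) = v t * cnj (v t)" unfolding complex_norm_square[symmetric] eq[OF t] ..
    then have "G t * cnj (v t) = B t * (u t / v t)" using nz[OF t] by (simp add: B_def field_simps)
    then show "B t * (- (v' t / v t) * exp (- L t)) + - (\<i> * of_real (a / 2) * (G t * cnj (v t))) * exp (- L t) = 0"
      by (simp add: v'_def)
  qed
  then obtain k where k: "\<And>t. t \<in> {0..2*pi} \<Longrightarrow> B t * exp (- L t) = k"
    using has_vector_derivative_zero_constant[of "{0..2*pi}" "\<lambda>t. B t * exp (- L t)"] by (auto simp: convex_real_interval)
  have Bk: "B t = k * v t" if "t \<in> {0..2*pi}" for t
    using k[OF that] nz[OF that] by (simp add: exp_minus L(2)[OF that] field_simps)
  have k0: "k \<noteq> 0"
  proof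
    assume "k = 0"
    then have "u 0 = 0" using Bk[of 0] by (simp add: B_def G_def)
    then show False using eq[of 0] nz[of 0] by simp
  qed
  \<comment> \<open>By z V' = -(a/2) U this is \<open>z\<^sup>m U V exp (- s z)\<close> divided by
    z, in a form without division at 0.\<close>
  define H where "H z = - of_real (2 / a) * z ^ m * V' z * V z * exp (- of_real s * z)" for z
  have "V' holomorphic_on ball 0 2"
  proof -
    have "deriv V holomorphic_on ball 0 2" by (intro holomorphic_deriv V_holomorphic) auto
    then show ?thesis by (rule holomorphic_transform) (use V_deriv in \<open>auto intro: DERIV_imp_deriv\<close>)
  qed
  then have "H holomorphic_on ball 0 2" unfolding H_def by (intro holomorphic_intros V_holomorphic) auto
  then obtain P where P: "\<And>z. z \<in> ball 0 2 \<Longrightarrow> (P has_field_derivative H z) (at z within ball 0 2)"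
    using holomorphic_convex_primitive'[of "ball 0 2" H] by auto
  have P': "(P has_field_derivative H (cis t)) (at (cis t))" for t
    using P[of "cis t"] by (simp add: at_within_open[of _ "ball 0 2"])
  define w where "w t = (cmod (v t))\<^sup>2 * exp (- s * cos t)" for t
  have Hw: "cis t * H (cis t) = cnj k * of_real (w t)" if t: "t \<in> {0..2*pi}" for t
  proof -
    \<comment> \<open>On the circle \<open>z\<^sup>m exp (- s z)\<close> is cnj G times the positive
      factor exp(-s cos t), and u cnj G is a constant multiple of cnj v.\<close>
    have "G t * cis (of_int (int m) * t) = cis (s * sin t)" by (simp add: G_def cis_mult)
    then have "G t * cis t ^ m = cis (s * sin t)" unfolding Complex.DeMoivre by (simp only: of_int_of_nat_eq)
    then have cm: "cis t ^ m = cnj (G t) * cis (s * sin t)"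
      using GG[of t] by (metis mult.assoc mult.commute mult_1)
    have "- of_real s * cis t = of_real (- s * cos t) + \<i> * of_real (- (s * sin t))" by (simp add: complex_eq_iff)
    then have ex: "exp (- of_real s * cis t) = of_real (exp (- s * cos t)) * cis (- (s * sin t))"
      by (simp only: exp_add exp_of_real cis_conv_exp)
    have "u t * cnj (G t) = cnj (B t)" by (simp add: B_def)
    then have u: "u t * cnj (G t) = cnj k * cnj (v t)" using Bk[OF t] by simp
    have "cis t * H (cis t) = - of_real (2 / a) * cis t ^ m * (cis t * V' (cis t)) * v t * exp (- of_real s * cis t)"
      unfolding H_def v_def by (simp only: mult_ac)
    also have "cis t * V' (cis t) = - of_real (a / 2) * u t" using V'_eq[of "cis t"] by (simp add: u_def)
    also have "- of_real (2 / a) * cis t ^ m * (- of_real (a / 2) * u t) * v t * exp (- of_real s * cis t)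
      = (of_real (2 / a) * of_real (a / 2)) * (cis (s * sin t) * cis (- (s * sin t))) * (u t * cnj (G t)) * v t * of_real (exp (- s * cos t))"
      unfolding cm ex by (simp only: mult_minus_left mult_minus_right minus_minus mult_ac)
    also have "\<dots> = cnj k * (v t * cnj (v t)) * of_real (exp (- s * cos t))"
      unfolding u cis_mult using a by (simp add: mult_ac flip: of_real_mult)
    also have "\<dots> = cnj k * of_real (w t)"
      unfolding w_def complex_norm_square[symmetric] by simp
    finally show ?thesis .
  qed
  have cw: "continuous_on {0..2*pi} w" unfolding w_def
    by (intro continuous_intros lin_sys_continuous[OF lin_sys_uv])
  \<comment> \<open>The contour integral of H vanishes because H has a primitive on the disc,
    whereas its integrand is a nonzero constant times the nonnegative w.\<close>
  have "((\<lambda>t. \<i> * (cis t * H (cis t))) has_integral P (cis (2 * pi)) - P (cis 0)) {0..2*pi}"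
    by (intro fundamental_theorem_of_calculus circle_deriv P') auto
  then have "((\<lambda>t. \<i> * (cis t * H (cis t))) has_integral 0) {0..2*pi}" by simp
  then have "((\<lambda>t. \<i> * cnj k * of_real (w t)) has_integral 0) {0..2*pi}"
    by (rule has_integral_eq[rotated]) (simp only: Hw mult.assoc)
  then have "((\<lambda>t. of_real (w t) :: complex) has_integral 0) {0..2*pi}"
    using has_integral_mult_right[of "\<lambda>t. \<i> * cnj k * of_real (w t)" 0 "{0..2*pi}" "1 / (\<i> * cnj k)"] k0 by simp
  then have "(w has_integral 0) {0..2*pi}"
    using has_integral_Re[of "\<lambda>t. of_real (w t)" 0] by simp
  then have "integral {0..2*pi} w = 0" by (rule integral_unique)
  then have "w 0 = 0" using integral_eq_0_iff[OF cw] by (auto simp: w_def)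
  then show False using nz[of 0] by (simp add: w_def)
qed

text \<open>Adding to \<alpha> (u, v) its reflection gives a solution fixed by the reflection, hence
  an angle. The initial value is a real-linear condition on \<alpha>, solvable because |u 0| and |v
  0| differ; periodicity is inherited from u and v.\<close>

lemma periodic_solution_exists:
  assumes z: "cmod z = 1"
  shows "\<exists>\<theta>. josephson_solution (- int m) a s \<theta> \<and> cis (\<theta> 0) = z \<and> cis (\<theta> (2 * pi)) = z"
proof -
  obtain \<phi> where \<phi>: "z = cis \<phi>" using z by (metis cis_Arg norm_zero zero_neq_one complex_norm_eq_1_exp sgn_eq div_by_1 of_real_1)
  define y where "y = cis (- \<phi> / 2)"
  define d where "d = (cmod (v 0))\<^sup>2 - (cmod (u 0))\<^sup>2"
  have d: "d \<noteq> 0" using norm_diff_nonzero by (simp add: d_def)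
  \<comment> \<open>Cramer's rule for q 0 = y and its conjugate, with p and q the combination below;
    y has minus half the angle of z, as p 0 / q 0 = cnj y / y.\<close>
  define \<alpha> where "\<alpha> = (cnj (v 0) * y - cnj (u 0) * cnj y) / of_real d"
  have dd: "of_real d = v 0 * cnj (v 0) - u 0 * cnj (u 0)"
    unfolding d_def of_real_diff complex_norm_square ..
  have cd: "cnj \<alpha> = (v 0 * cnj y - u 0 * y) / of_real d" by (simp add: \<alpha>_def)
  have y: "\<alpha> * v 0 + cnj \<alpha> * cnj (u 0) = y"
  proof -
    have "\<alpha> * v 0 + cnj \<alpha> * cnj (u 0) = (v 0 * cnj (v 0) - u 0 * cnj (u 0)) * y / of_real d"
      unfolding cd \<alpha>_def by (simp add: add_divide_distrib[symmetric] algebra_simps)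
    also have "\<dots> = y" unfolding dd[symmetric] using d by simp
    finally show ?thesis .
  qed
  have \<alpha>: "\<alpha> \<noteq> 0" using y by (auto simp: y_def)
  let ?G = "\<lambda>t. cis (of_int (- int m) * t + s * sin t)"
  define p where "p t = \<alpha> * u t + cnj \<alpha> * (?G t * cnj (v t))" for t
  define q where "q t = \<alpha> * v t + cnj \<alpha> * (?G t * cnj (u t))" for t
  have sys: "lin_sys (- int m) a s p q"
    unfolding p_def q_def by (rule lin_sys_combination[OF lin_sys_uv lin_sys_conj[OF lin_sys_uv]])
  have pq: "p t = ?G t * cnj (q t)" for t
  proof -
    have "?G t * cnj (?G t) = 1" by (simp only: cis_cnj cis_mult) simp
    then have "?G t * (cnj (?G t) * (\<alpha> * u t)) = \<alpha> * u t" by (simp only: mult.assoc[symmetric] mult_1)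
    then show ?thesis unfolding p_def q_def by (simp add: distrib_left mult_ac)
  qed
  \<comment> \<open>A zero of q would make |u t| and |v t| equal, but their squares differ by a
    nonzero constant.\<close>
  have qnz: "q t \<noteq> 0" if t: "t \<in> {0..2*pi}" for t
  proof
    assume q: "q t = 0"
    then have "\<alpha> * v t = - (cnj \<alpha> * (?G t * cnj (u t)))" by (simp add: q_def eq_neg_iff_add_eq_0)
    then have "cmod (\<alpha> * v t) = cmod (cnj \<alpha> * (?G t * cnj (u t)))" by (simp only: norm_minus_cancel)
    then have "cmod (v t) = cmod (u t)" using \<alpha> by (simp add: norm_mult)
    then show False using norm_diff_constant[OF t] norm_diff_nonzero by simp
  qed
  obtain \<theta> where \<theta>: "josephson_solution (- int m) a s \<theta>" "\<And>t. t \<in> {0..2*pi} \<Longrightarrow> cis (\<theta> t) = p t / q t"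
    using lin_sys_josephson[OF sys qnz pq] by blast
  have q0: "q 0 = y" using y by (simp add: q_def)
  have G2: "?G (2 * pi) = 1" using cis_eq_iff[of "of_int (- int m) * (2 * pi) + s * sin (2 * pi)" 0]
    by (auto intro!: exI[of _ "- int m"])
  have q2: "q (2 * pi) = y" unfolding q_def G2 uv_periodic using y by simp
  have "p 0 / q 0 = z" "p (2 * pi) / q (2 * pi) = z"
    unfolding pq G2 q0 q2 by (simp_all add: y_def \<phi> cis_cnj cis_divide)
  then have "cis (\<theta> 0) = z" "cis (\<theta> (2 * pi)) = z" using \<theta>(2)[of 0] \<theta>(2)[of "2*pi"] by auto
  with \<theta>(1) show ?thesis by blast
qed

end

lemma in_spec_periodic_solution:
  assumes sp: "in_spec m (a\<^sup>2) s" and a: "a > 0" and s: "s \<noteq> 0" and z: "cmod z = 1"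
  shows "\<exists>\<theta>. josephson_solution (- int m) a s \<theta> \<and> cis (\<theta> 0) = z \<and> cis (\<theta> (2 * pi)) = z"
proof -
  have "in_spec m (a\<^sup>2) \<bar>s\<bar>" using sp in_spec_minus[of m "a\<^sup>2" s] by (simp add: abs_if)
  then have b: "bounded (range (rec_sol (jcoef m (a\<^sup>2) \<bar>s\<bar>)))" by (simp add: in_spec_def)
  obtain C where C: "\<And>n. \<bar>rec_sol (jcoef m (a\<^sup>2) \<bar>s\<bar>) n\<bar> \<le> C * (1/2) ^ n"
    by (rule bounded_rec_sol_geometric[OF _ b, of "nat \<lceil>2 * \<bar>s\<bar>\<rceil>"])
      (use s jcoef_ge_4_beyond[of "a\<^sup>2" "\<bar>s\<bar>" "\<bar>s\<bar>"] in auto)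
  have "\<bar>rec_sol (jcoef m (a\<^sup>2) s) n\<bar> = \<bar>rec_sol (jcoef m (a\<^sup>2) \<bar>s\<bar>) n\<bar>" for n
    by (cases "s < 0") (simp_all add: jcoef_minus rec_sol_uminus abs_mult)
  then interpret decaying_solution "rec_sol (jcoef m (a\<^sup>2) s)" m a s C
    by unfold_locales (use a s C in auto)
  show ?thesis by (rule periodic_solution_exists[OF z])
qed

lemma flow_map_id_iff_in_spec:
  assumes a: "a > 0" and s: "s \<noteq> 0"
  shows "(\<forall>z\<in>sphere 0 1. flow_map l a s z = z) \<longleftrightarrow> in_spec (nat \<bar>l\<bar>) (a\<^sup>2) s"
proof
  assume "\<forall>z\<in>sphere 0 1. flow_map l a s z = z"
  then show "in_spec (nat \<bar>l\<bar>) (a\<^sup>2) s" using flow_map_id_in_spec[OF _ a s] by blast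
next
  assume sp: "in_spec (nat \<bar>l\<bar>) (a\<^sup>2) s"
  show "\<forall>z\<in>sphere 0 1. flow_map l a s z = z"
  proof
    fix z :: complex assume "z \<in> sphere 0 1"
    then have z: "cmod z = 1" by simp
    have "\<exists>\<theta>. josephson_solution l a s \<theta> \<and> cis (\<theta> 0) = z \<and> cis (\<theta> (2 * pi)) = z"
    proof (cases "l \<le> 0")
      case True
      then have "l = - int (nat \<bar>l\<bar>)" by simp
      then show ?thesis using in_spec_periodic_solution[OF sp a s z] by metis
    next
      case False
      have "in_spec (nat \<bar>l\<bar>) (a\<^sup>2) (- s)" using sp by (simp add: in_spec_minus)
      then obtain \<theta> where \<theta>: "josephson_solution (- int (nat \<bar>l\<bar>)) a (- s) \<theta>" "cis (\<theta> 0) = - z" "cis (\<theta> (2 * pi)) = - z"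
        using in_spec_periodic_solution[of "nat \<bar>l\<bar>" a "- s" "- z"] a s z by auto
      have "josephson_solution l a s (\<lambda>t. \<theta> (2 * pi - t) + pi)"
        using josephson_solution_reverse[OF \<theta>(1)] False by simp
      then show ?thesis
        using \<theta>(2,3) by (intro exI[of _ "\<lambda>t. \<theta> (2 * pi - t) + pi"]) (simp add: minus_cis[symmetric])
    qed
    then show "flow_map l a s z = z" using flow_map_eq by metis
  qed
qed

section \<open>Constriction curves\<close>

lemma Constr_iff:
  "(a, s) \<in> Constr l \<longleftrightarrow> 0 < a \<and> 0 < s \<and> in_spec (nat \<bar>l\<bar>) (a\<^sup>2) s"
  using flow_map_id_iff_in_spec[of a s l] by (auto simp: Constr_def)

definition branch :: "nat \<Rightarrow> nat \<Rightarrow> (real \<times> real) set" where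
  "branch m K = (\<lambda>a. (a, spec_curve m K (a\<^sup>2))) ` {0<..}"

lemma continuous_branch: "continuous_on {0..} (\<lambda>a. (a, spec_curve m K (a\<^sup>2)))"
  by (intro continuous_intros continuous_on_compose2[OF continuous_spec_curve]) auto

lemma mem_branch_iff:
  "(a, s) \<in> branch m K \<longleftrightarrow> 0 < a \<and> 0 < s \<and> in_spec m (a\<^sup>2) s \<and> spec_index m (a\<^sup>2) s = K"
proof
  assume "(a, s) \<in> branch m K"
  then have "0 < a" "s = spec_curve m K (a\<^sup>2)" by (auto simp: branch_def)
  then show "0 < a \<and> 0 < s \<and> in_spec m (a\<^sup>2) s \<and> spec_index m (a\<^sup>2) s = K"
    using in_spec_curve[of "a\<^sup>2" m K] spec_curve_ge_1[of "a\<^sup>2" m K] by auto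
next
  assume *: "0 < a \<and> 0 < s \<and> in_spec m (a\<^sup>2) s \<and> spec_index m (a\<^sup>2) s = K"
  then have "s = spec_curve m K (a\<^sup>2)" using spec_curve_unique[of m "a\<^sup>2" s] by auto
  then show "(a, s) \<in> branch m K" using * by (auto simp: branch_def)
qed

text \<open>The index is locally constant on \<open>Constr l\<close>, so a connected subset lies in
  a single branch, and each branch is connected as a continuous image of a half-line.\<close>

lemma components_Constr: "components (Constr l) = range (branch (nat \<bar>l\<bar>))"
proof -
  define m where "m = nat \<bar>l\<bar>"
  define ix where "ix = (\<lambda>x :: real \<times> real. spec_index m ((fst x)\<^sup>2) (snd x))"
  have conn: "connected (branch m K)" for K
    unfolding branch_def
    by (intro connected_continuous_image continuous_on_subset[OF continuous_branch]) auto
  have sub: "branch m K \<subseteq> Constr l" for K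
    by (auto simp: Constr_iff mem_branch_iff m_def)
  have const: "ix x = ix y" if S: "connected S" "S \<subseteq> Constr l" "x \<in> S" "y \<in> S" for S x y
  proof (rule connected_local_const[OF S(1,3,4)], rule ballI)
    fix z assume "z \<in> S"
    then have "(fst z, snd z) \<in> Constr l" using S(2) by auto
    then have z: "0 < snd z" "in_spec m ((fst z)\<^sup>2) (snd z)" unfolding Constr_iff m_def by blast+
    have "\<forall>\<^sub>F w in at z within S. spec_index m ((fst w)\<^sup>2) (snd w) = spec_index m ((fst z)\<^sup>2) (snd z)"
    proof (rule spec_index_locally_constant)
      have "\<forall>\<^sub>F w in at z within S. w \<in> S" by (simp add: eventually_at_filter)
      then show "\<forall>\<^sub>F w in at z within S. (fst w)\<^sup>2 \<ge> 0 \<and> in_spec m ((fst w)\<^sup>2) (snd w)"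
        by eventually_elim (use S(2) Constr_iff[of _ _ l] in \<open>auto simp: m_def\<close>)
    qed (use z in \<open>auto intro!: tendsto_intros\<close>)
    then show "\<forall>\<^sub>F w in at z within S. ix z = ix w" unfolding ix_def by eventually_elim simp
  qed
  have in_branch: "x \<in> branch m (ix x)" if "x \<in> Constr l" for x
    using that by (cases x) (simp add: Constr_iff mem_branch_iff ix_def m_def)
  have ix_branch: "ix x = K" if "x \<in> branch m K" for x K
    using that by (cases x) (simp add: mem_branch_iff ix_def)
  have comp: "branch m K \<in> components (Constr l)" for K
    unfolding in_components_maximal
  proof (intro conjI allI impI)
    have "(1, spec_curve m K (1\<^sup>2)) \<in> branch m K" unfolding branch_def by (rule image_eqI[of _ _ 1]) auto
    then show ne: "branch m K \<noteq> {}" by auto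
    fix D assume D: "D \<noteq> {} \<and> branch m K \<subseteq> D \<and> D \<subseteq> Constr l \<and> connected D"
    obtain x where x: "x \<in> branch m K" using ne by auto
    have "D \<subseteq> branch m K"
    proof
      fix y assume y: "y \<in> D"
      have "ix y = ix x" using const[of D y x] D x y by auto
      then show "y \<in> branch m K" using in_branch[of y] D y ix_branch[OF x] by auto
    qed
    then show "D = branch m K" using D by auto
  qed (use conn sub in auto)
  have "C \<in> range (branch m)" if C: "C \<in> components (Constr l)" for C
  proof -
    obtain x where x: "x \<in> C" using in_components_nonempty[OF C] by auto
    then have "x \<in> branch m (ix x)" using in_branch in_components_subset[OF C] by blast
    then have "C \<inter> branch m (ix x) \<noteq> {}" using x by auto
    then have "C = branch m (ix x)" using components_nonoverlap[OF C comp] by blast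
    then show ?thesis by auto
  qed
  then show ?thesis using comp unfolding m_def by auto
qed

text \<open>The graph continues continuously to a = 0, and the graph over the closed half-line is a
  closed set.\<close>

lemma closure_branch:
  "(0, t) \<in> closure (branch m K) \<longleftrightarrow> t = spec_curve m K 0"
proof
  let ?g = "\<lambda>a. (a, spec_curve m K (a\<^sup>2))"
  have g: "continuous_on {0..} ?g" by (rule continuous_branch)
  have "closed (?g ` {0..})"
  proof -
    have "?g ` {0..} = {x. x \<in> {0..} \<times> UNIV \<and> snd x - spec_curve m K ((fst x)\<^sup>2) = 0}" by auto
    moreover have "closed {x. x \<in> {0..} \<times> UNIV \<and> snd x - spec_curve m K ((fst x)\<^sup>2) = (0 :: real)}"
      by (intro continuous_closed_preimage_constant continuous_intros
          continuous_on_compose2[OF continuous_spec_curve[of m K]] closed_Times) auto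
    ultimately show ?thesis by simp
  qed
  moreover have "branch m K \<subseteq> ?g ` {0..}" unfolding branch_def by auto
  ultimately have "closure (branch m K) \<subseteq> ?g ` {0..}" by (rule closure_minimal[rotated])
  moreover assume "(0, t) \<in> closure (branch m K)"
  ultimately show "t = spec_curve m K 0" by auto
next
  let ?g = "\<lambda>a. (a, spec_curve m K (a\<^sup>2))"
  assume t: "t = spec_curve m K 0"
  have "?g ` closure {0<..} \<subseteq> closure (?g ` {0<..})"
    by (rule image_closure_subset) (simp_all add: continuous_branch closure_subset)
  moreover have "(0, t) \<in> ?g ` closure {0<..}" unfolding t by (intro image_eqI[of _ _ 0]) auto
  ultimately show "(0, t) \<in> closure (branch m K)" unfolding branch_def by auto
qed

text \<open>The number of zeros up to t jumps at every zero, so it identifies the zero and makes the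
  description in \<open>bessel_zero\<close> unique.\<close>

lemma bessel_zero_eq:
  assumes s: "s > 0" "bessel_J l s = 0"
  shows "\<exists>k\<ge>1. bessel_zero l k = s"
proof -
  define Z where "Z t = {x. 0 < x \<and> x \<le> t \<and> bessel_J l x = 0}" for t
  have "Z t = {x. 0 < x \<and> x \<le> t \<and> in_spec (nat \<bar>l\<bar>) 0 x}" for t
    unfolding Z_def using bessel_zero_iff_in_spec by blast
  then have fin: "finite (Z t)" for t using finite_spec_below by simp
  have lt: "card (Z x) < card (Z y)" if "0 < y" "bessel_J l y = 0" "x < y" for x y
  proof (rule psubset_card_mono[OF fin])
    have "Z x \<subseteq> Z y" "y \<in> Z y" "y \<notin> Z x" using that by (auto simp: Z_def)
    then show "Z x \<subset> Z y" by blast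
  qed
  define k where "k = card (Z s)"
  have "s \<in> Z s" using s by (simp add: Z_def)
  then have "k \<ge> 1" using fin[of s] unfolding k_def by (metis One_nat_def Suc_leI card_gt_0_iff empty_iff)
  moreover have "bessel_zero l k = s"
    unfolding bessel_zero_def Z_def[symmetric]
  proof (rule the_equality)
    show "0 < s \<and> bessel_J l s = 0 \<and> finite (Z s) \<and> card (Z s) = k" using s fin by (simp add: k_def)
    show "t = s" if "0 < t \<and> bessel_J l t = 0 \<and> finite (Z t) \<and> card (Z t) = k" for t
      using lt[of t s] lt[of s t] s that unfolding k_def by (metis linorder_neqE_linordered_idom less_irrefl)
  qed
  ultimately show ?thesis by blast
qed

theorem proposition1p18:
  fixes l :: int and C S1 S2 :: "(real \<times> real) set" and p :: "real \<times> real"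
  assumes "C \<in> components (Constr l)"
    and "p \<in> C"
    and "components (C - {p}) = {S1, S2}" and "S1 \<noteq> S2"
    and "bounded (fst ` S1) \<or> bounded (fst ` S2)"
  shows "\<exists>k\<ge>1. C = constr_curve l k"
proof -
  define m where "m = nat \<bar>l\<bar>"
  obtain K where C: "C = branch m K" using assms(1) unfolding components_Constr m_def by auto
  define \<sigma> where "\<sigma> = spec_curve m K 0"
  have \<sigma>: "\<sigma> > 0" using spec_curve_ge_1[of 0 m K] by (simp add: \<sigma>_def)
  have sp: "in_spec m 0 \<sigma>" "spec_index m 0 \<sigma> = K" using in_spec_curve[of 0 m K] by (simp_all add: \<sigma>_def)
  then have "bessel_J l \<sigma> = 0" using bessel_zero_iff_in_spec[OF \<sigma>] by (simp add: m_def)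
  then obtain k where k: "k \<ge> 1" "bessel_zero l k = \<sigma>" using bessel_zero_eq[OF \<sigma>] by blast
  have "constr_curve l k = C"
    unfolding constr_curve_def k(2)
  proof (rule the_equality)
    show "C \<in> components (Constr l) \<and> (0, \<sigma>) \<in> closure C"
      using assms(1) closure_branch[of \<sigma> m K] by (simp add: C \<sigma>_def)
    fix C' assume C': "C' \<in> components (Constr l) \<and> (0, \<sigma>) \<in> closure C'"
    then obtain K' where K': "C' = branch m K'" unfolding components_Constr m_def by auto
    then have "\<sigma> = spec_curve m K' 0" using C' closure_branch by blast
    \<comment> \<open>Branches that end at the same point of the axis coincide, because the index
      can be read off from that point at b = 0.\<close>
    then have "K' = K" using in_spec_curve[of 0 m K'] sp by simp
    then show "C' = C" by (simp add: K' C)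
  qed
  then show ?thesis using k(1) by blast
qed

end
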